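(* Let $\lambda=(1^{a_1},2^{a_2},\ldots,m^{a_m})$ with all $a_i\ge1$ and $m\ge3$. Let $r_1$ be the number of indices $k\in\{1,\ldots,m-1\}$ with $a_k\ge2$ and $a_{k+1}\ge2$. Let $r_2=1$ if $a_i=a_{m+1-i}$ for all $1\le i\le m$, and $r_2=0$ otherwise. Then $$\mathrm{Aut}(\mathrm{GT}_\lambda)\cong\big(S_{a_2}^{\delta_{1,a_1}}\times S_{a_{m-1}}^{\delta_{1,a_m}}\times\mathbb{Z}_2^{r_1+1}\big)\ltimes_\varphi\mathbb{Z}_2^{r_2},$$ where, if $r_2=1$, the homomorphism $\varphi:\mathbb{Z}_2\to\mathrm{Aut}\big(S_{a_2}^{\delta_{1,a_1}}\times S_{a_{m-1}}^{\delta_{1,a_m}}\times\mathbb{Z}_2^{r_1+1}\big)$ sends the nonidentity element to the map $(\sigma_1,\sigma_2,z_1,\ldots,z_{r_1},z_{r_1+1})\mapsto(\sigma_2,\sigma_1,z_{r_1},\ldots,z_1,z_{r_1+1})$ (if $r_2=0$ the product is direct with nothing).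
   Context: For a partition $\lambda=(\lambda_1\le\cdots\le\lambda_n)$ of positive integers, the Gelfand–Tsetlin polytope $\mathrm{GT}_\lambda$ is the set of points $(x_{i,j})_{1\le j\le i\le n}\in\mathbb{R}^{n(n+1)/2}$ with $x_{i,i}=\lambda_i$ for all $i$ and $x_{i-1,j}\le x_{i,j}\le x_{i+1,j}$, $x_{i,j-1}\le x_{i,j}\le x_{i,j+1}$ whenever the indices lie in $\{(i,j):1\le j\le i\le n\}$. The notation $(1^{a_1},\ldots,m^{a_m})$ means $a_1$ copies of $1$, then $a_2$ copies of $2$, etc. $\mathrm{Aut}(\mathrm{GT}_\lambda)$ is the group of automorphisms of the face poset of $\mathrm{GT}_\lambda$ (faces ordered by inclusion). $S_a$ is the symmetric group on $a$ letters; $G^{0}$ denotes the trivial group and $G^1=G$; $\delta_{x,y}=1$ if $x=y$ and $0$ otherwise; $\mathbb{Z}_2$ is the cyclic group of order 2. Note that when $r_2=1$ one has $a_1=a_m$ and $a_2=a_{m-1}$, so the swap in $\varphi$ is well defined. *)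

theory Defs
  imports "HOL-Analysis.Analysis" "HOL-Analysis.Finite_Function_Topology" "HOL-Algebra.Algebra"
begin

section \<open>Gelfand--Tsetlin polytopes\<close>

definition GT_indices :: "nat \<Rightarrow> (nat \<times> nat) set"
  where "GT_indices n = {(i, j). 1 \<le> j \<and> j \<le> i \<and> i \<le> n}"

text \<open>
  The space of real arrays indexed by the triangle \<open>GT_indices n\<close> is realised inside the real vector
  space \<open>(nat \<times> nat) \<Rightarrow>\<^sub>0 real\<close> as the coordinate subspace of those arrays that vanish outside the
  triangle. The partition is a list, so its part with index \<open>i \<ge> 1\<close> is \<open>\<lambda> ! (i - 1)\<close>.
\<close>

definition GT_polytope :: "nat list \<Rightarrow> ((nat \<times> nat) \<Rightarrow>\<^sub>0 real) set"
  where "GT_polytope lam =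
    (let n = length lam; T = GT_indices n in
     {x. Poly_Mapping.keys x \<subseteq> T \<and>
         (\<forall>i\<in>{1..n}. Poly_Mapping.lookup x (i, i) = real (lam ! (i - 1))) \<and>
         (\<forall>i j. (i, j) \<in> T \<and> (i + 1, j) \<in> T \<longrightarrow>
            Poly_Mapping.lookup x (i, j) \<le> Poly_Mapping.lookup x (i + 1, j)) \<and>
         (\<forall>i j. (i, j) \<in> T \<and> (i, j + 1) \<in> T \<longrightarrow>
            Poly_Mapping.lookup x (i, j) \<le> Poly_Mapping.lookup x (i, j + 1))})"

text \<open>The partition with \<open>a 1\<close> parts equal to 1, then \<open>a 2\<close> parts equal to 2, up to \<open>a m\<close> parts
  equal to \<open>m\<close>.\<close>

definition mult_partition :: "nat \<Rightarrow> (nat \<Rightarrow> nat) \<Rightarrow> nat list"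
  where "mult_partition m a = concat (map (\<lambda>k. replicate (a k) k) [1..<m + 1])"


section \<open>Automorphisms of a face poset\<close>

text \<open>As in \<open>BijGroup\<close>, automorphisms are made extensional so that they are determined by their
  values on the carrier.\<close>

definition poset_Aut :: "'a set \<Rightarrow> ('a \<Rightarrow> 'a \<Rightarrow> bool) \<Rightarrow> ('a \<Rightarrow> 'a) monoid"
  where "poset_Aut A R =
    BijGroup A \<lparr>carrier := {f \<in> Bij A. \<forall>x\<in>A. \<forall>y\<in>A. R (f x) (f y) \<longleftrightarrow> R x y}\<rparr>"

lemma group_poset_Aut: "group (poset_Aut A R)"
proof -
  have sub: "subgroup {f \<in> Bij A. \<forall>x\<in>A. \<forall>y\<in>A. R (f x) (f y) \<longleftrightarrow> R x y} (BijGroup A)"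
  proof (rule group.subgroupI[OF group_BijGroup])
    show "{f \<in> Bij A. \<forall>x\<in>A. \<forall>y\<in>A. R (f x) (f y) \<longleftrightarrow> R x y} \<noteq> {}"
      using id_Bij[of A] by fastforce
  next
    fix f assume f: "f \<in> {f \<in> Bij A. \<forall>x\<in>A. \<forall>y\<in>A. R (f x) (f y) \<longleftrightarrow> R x y}"
    then have b: "bij_betw f A A" by (simp add: Bij_def)
    have "R (inv_into A f x) (inv_into A f y) \<longleftrightarrow> R x y" if "x \<in> A" "y \<in> A" for x y
    proof -
      have "inv_into A f x \<in> A" "inv_into A f y \<in> A"
        "f (inv_into A f x) = x" "f (inv_into A f y) = y"
        using b that by (auto simp: bij_betw_def inv_into_into f_inv_into_f)
      then show ?thesis using f by force
    qed
    then show "inv\<^bsub>BijGroup A\<^esub> f \<in> {f \<in> Bij A. \<forall>x\<in>A. \<forall>y\<in>A. R (f x) (f y) \<longleftrightarrow> R x y}"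
      using f by (simp add: inv_BijGroup restrict_inv_into_Bij)
  next
    fix f g assume "f \<in> {f \<in> Bij A. \<forall>x\<in>A. \<forall>y\<in>A. R (f x) (f y) \<longleftrightarrow> R x y}"
      "g \<in> {f \<in> Bij A. \<forall>x\<in>A. \<forall>y\<in>A. R (f x) (f y) \<longleftrightarrow> R x y}"
    then show "f \<otimes>\<^bsub>BijGroup A\<^esub> g \<in> {f \<in> Bij A. \<forall>x\<in>A. \<forall>y\<in>A. R (f x) (f y) \<longleftrightarrow> R x y}"
      by (auto simp: BijGroup_def compose_Bij compose_eq dest: Bij_imp_funcset)
  qed (auto simp: BijGroup_def)
  show ?thesis
    unfolding poset_Aut_def by (rule subgroup.subgroup_is_group[OF sub group_BijGroup])
qed

text \<open>The faces include the empty face and the polytope itself.\<close>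

definition face_Aut :: "'a::real_vector set \<Rightarrow> ('a set \<Rightarrow> 'a set) monoid"
  where "face_Aut P = poset_Aut {F. F face_of P} (\<subseteq>)"


section \<open>Group constructions\<close>

definition kronecker :: "'a \<Rightarrow> 'a \<Rightarrow> nat"
  where "kronecker x y = (if x = y then 1 else 0)"

text \<open>The power of a group for an exponent that is 0 or 1.\<close>

definition zero_one_power :: "'a monoid \<Rightarrow> nat \<Rightarrow> 'a monoid"
  where "zero_one_power G e = (if e = 0 then singleton_group \<one>\<^bsub>G\<^esub> else G)"

abbreviation Z2 :: "int monoid"
  where "Z2 \<equiv> integer_mod_group 2"

definition semidirect ::
    "('a, 'c) monoid_scheme \<Rightarrow> ('b, 'd) monoid_scheme \<Rightarrow> ('b \<Rightarrow> 'a \<Rightarrow> 'a) \<Rightarrow> ('a \<times> 'b) monoid"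
  where "semidirect N H \<phi> =
    \<lparr>carrier = carrier N \<times> carrier H,
     monoid.mult = (\<lambda>(x, h) (y, k). (x \<otimes>\<^bsub>N\<^esub> \<phi> h y, h \<otimes>\<^bsub>H\<^esub> k)),
     one = (\<one>\<^bsub>N\<^esub>, \<one>\<^bsub>H\<^esub>)\<rparr>"

lemma group_semidirect:
  assumes N: "group N" and H: "group H" and phi: "\<phi> \<in> hom H (AutoGroup N)"
  shows "group (semidirect N H \<phi>)"
proof -
  interpret N: group N by fact
  interpret H: group H by fact
  have aut: "\<phi> h \<in> hom N N" "\<phi> h \<in> Bij (carrier N)" if "h \<in> carrier H" for h
    using phi that by (auto simp: hom_def AutoGroup_def auto_def BijGroup_def)
  have cl: "\<phi> h x \<in> carrier N" if "h \<in> carrier H" "x \<in> carrier N" for h x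
    using aut that by (auto simp: hom_def)
  have ml: "\<phi> h (x \<otimes>\<^bsub>N\<^esub> y) = \<phi> h x \<otimes>\<^bsub>N\<^esub> \<phi> h y"
    if "h \<in> carrier H" "x \<in> carrier N" "y \<in> carrier N" for h x y
    using aut that by (auto simp: hom_def)
  have co: "\<phi> (h \<otimes>\<^bsub>H\<^esub> k) x = \<phi> h (\<phi> k x)"
    if "h \<in> carrier H" "k \<in> carrier H" "x \<in> carrier N" for h k x
    using phi aut that by (simp add: hom_def AutoGroup_def BijGroup_def compose_eq)
  have one: "\<phi> \<one>\<^bsub>H\<^esub> x = x" if "x \<in> carrier N" for x
  proof -
    have "\<phi> \<one>\<^bsub>H\<^esub> (\<phi> \<one>\<^bsub>H\<^esub> x) = \<phi> \<one>\<^bsub>H\<^esub> x"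
      using co[of "\<one>\<^bsub>H\<^esub>" "\<one>\<^bsub>H\<^esub>" x] that by simp
    moreover have "inj_on (\<phi> \<one>\<^bsub>H\<^esub>) (carrier N)"
      using aut(2)[of "\<one>\<^bsub>H\<^esub>"] by (auto simp: Bij_def bij_betw_def)
    ultimately show ?thesis using that cl[of "\<one>\<^bsub>H\<^esub>" x] by (auto dest: inj_onD)
  qed
  show ?thesis
  proof (rule groupI)
    fix x assume "x \<in> carrier (semidirect N H \<phi>)"
    then obtain n h where x: "x = (n, h)" "n \<in> carrier N" "h \<in> carrier H"
      by (auto simp: semidirect_def)
    have "\<phi> (inv\<^bsub>H\<^esub> h) (inv\<^bsub>N\<^esub> n) \<otimes>\<^bsub>N\<^esub> \<phi> (inv\<^bsub>H\<^esub> h) n = \<phi> (inv\<^bsub>H\<^esub> h) \<one>\<^bsub>N\<^esub>"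
      using x ml[of "inv\<^bsub>H\<^esub> h" "inv\<^bsub>N\<^esub> n" n] by simp
    also have "\<dots> = \<one>\<^bsub>N\<^esub>"
      using hom_one[OF aut(1) N N] x by simp
    finally show "\<exists>y\<in>carrier (semidirect N H \<phi>). y \<otimes>\<^bsub>semidirect N H \<phi>\<^esub> x = \<one>\<^bsub>semidirect N H \<phi>\<^esub>"
      using x cl
      by (intro bexI[of _ "(\<phi> (inv\<^bsub>H\<^esub> h) (inv\<^bsub>N\<^esub> n), inv\<^bsub>H\<^esub> h)"]) (auto simp: semidirect_def)
  qed (auto simp: semidirect_def cl ml co one N.m_assoc H.m_assoc)
qed

definition GT_normal_part ::
    "nat \<Rightarrow> (nat \<Rightarrow> nat) \<Rightarrow> nat \<Rightarrow> ((nat \<Rightarrow> nat) \<times> (nat \<Rightarrow> nat) \<times> (nat \<Rightarrow> int)) monoid"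
  where "GT_normal_part m a r =
    zero_one_power (sym_group (a 2)) (kronecker 1 (a 1)) \<times>\<times>
    zero_one_power (sym_group (a (m - 1))) (kronecker 1 (a m)) \<times>\<times>
    product_group {1..r + 1} (\<lambda>_. Z2)"

text \<open>
  The neutral element of \<open>Z2\<close> acts as the identity; the other one exchanges the two permutations and
  reverses the first \<open>r\<close> of the \<open>r + 1\<close> binary components. The exchange stays inside \<open>N\<close> when the
  first two factors of \<open>N\<close> coincide.
\<close>

definition swap_hom ::
    "('s \<times> 's \<times> (nat \<Rightarrow> 'z)) monoid \<Rightarrow> nat \<Rightarrow> int
      \<Rightarrow> ('s \<times> 's \<times> (nat \<Rightarrow> 'z)) \<Rightarrow> ('s \<times> 's \<times> (nat \<Rightarrow> 'z))"
  where "swap_hom N r h =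
    (if h = \<one>\<^bsub>Z2\<^esub> then (\<lambda>x\<in>carrier N. x)
     else (\<lambda>x\<in>carrier N. case x of (\<sigma>\<^sub>1, \<sigma>\<^sub>2, z) \<Rightarrow>
             (\<sigma>\<^sub>2, \<sigma>\<^sub>1, \<lambda>i\<in>{1..r + 1}. if i \<le> r then z (r + 1 - i) else z i)))"

lemma group_GT_normal_part: "group (GT_normal_part m a r)"
  by (auto simp: GT_normal_part_def zero_one_power_def sym_group_is_group
      intro!: DirProd_group product_group)

lemma swap_hom_trivial: "swap_hom N r \<in> hom (zero_one_power Z2 0) (AutoGroup N)"
  if "group N"
  using that group.id_in_auto[OF that] id_Bij[of "carrier N"]
  by (auto simp: hom_def zero_one_power_def singleton_group_def swap_hom_def AutoGroup_def BijGroup_def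
      compose_def intro!: ext)

lemma swap_hom_in_hom:
  assumes "a 1 = a m" "a 2 = a (m - 1)"
  shows "swap_hom (GT_normal_part m a r) r \<in> hom (zero_one_power Z2 1) (AutoGroup (GT_normal_part m a r))"
proof -
  define G where "G = zero_one_power (sym_group (a 2)) (kronecker 1 (a 1))"
  define P where "P = product_group {1..r + 1} (\<lambda>_. Z2)"
  define N where "N = G \<times>\<times> G \<times>\<times> P"
  define s where "s = swap_hom N r 1"
  have N: "GT_normal_part m a r = N"
    using assms by (simp add: GT_normal_part_def N_def G_def P_def)
  have grp: "group N" using group_GT_normal_part[of m a r] by (simp add: N)
  have s_eq: "s (x, y, z) = (y, x, \<lambda>i\<in>{1..r + 1}. if i \<le> r then z (r + 1 - i) else z i)"
    if "(x, y, z) \<in> carrier N" for x y z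
    using that by (simp add: s_def swap_hom_def)
  have clP: "(\<lambda>i\<in>{1..r + 1}. if i \<le> r then z (r + 1 - i) else z i) \<in> carrier P"
    if "z \<in> carrier P" for z
    using that by (auto simp: P_def PiE_iff)
  have cl: "s x \<in> carrier N" if "x \<in> carrier N" for x
    using that clP by (cases x) (auto simp: s_eq N_def)
  have ss: "s (s x) = x" if "x \<in> carrier N" for x
  proof -
    obtain p q z where x: "x = (p, q, z)" by (cases x)
    have z: "z \<in> extensional {1..r + 1}" using that by (auto simp: x N_def P_def PiE_def)
    have "(\<lambda>i\<in>{1..r + 1}. if i \<le> r
             then (\<lambda>i\<in>{1..r + 1}. if i \<le> r then z (r + 1 - i) else z i) (r + 1 - i)
             else (\<lambda>i\<in>{1..r + 1}. if i \<le> r then z (r + 1 - i) else z i) i) = z"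
      using z by (auto simp: fun_eq_iff restrict_def extensional_def)
    then show ?thesis using that cl[OF that] by (simp add: x s_eq del: One_nat_def)
  qed
  have "bij_betw s (carrier N) (carrier N)"
    by (rule bij_betw_byWitness[where f' = s]) (auto simp: ss cl)
  then have bij: "s \<in> Bij (carrier N)" by (simp add: Bij_def s_def swap_hom_def)
  have "s (x \<otimes>\<^bsub>N\<^esub> y) = s x \<otimes>\<^bsub>N\<^esub> s y" if "x \<in> carrier N" "y \<in> carrier N" for x y
  proof -
    obtain p q z p' q' z' where xy: "x = (p, q, z)" "y = (p', q', z')" by (cases x, cases y)
    have "x \<otimes>\<^bsub>N\<^esub> y \<in> carrier N" using grp that by (simp add: group.is_monoid monoid.m_closed)
    then show ?thesis using that
      by (auto simp: xy s_eq N_def P_def fun_eq_iff)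
  qed
  then have aut: "s \<in> carrier (AutoGroup N)"
    using bij cl by (simp add: AutoGroup_def auto_def hom_def)
  have mult: "f \<otimes>\<^bsub>AutoGroup N\<^esub> g = compose (carrier N) f g"
    if "f \<in> Bij (carrier N)" "g \<in> Bij (carrier N)" for f g
    using that by (simp add: AutoGroup_def BijGroup_def)
  let ?id = "\<lambda>x\<in>carrier N. x"
  have id: "?id \<in> carrier (AutoGroup N)" "?id \<in> Bij (carrier N)"
    using group.id_in_auto[OF grp] id_Bij by (auto simp: AutoGroup_def)
  have ext: "s \<in> extensional (carrier N)" using bij by (simp add: Bij_def)
  have comps: "compose (carrier N) s s = ?id" "compose (carrier N) s ?id = s"
    "compose (carrier N) ?id s = s" "compose (carrier N) ?id ?id = ?id"
    using ext by (auto simp: fun_eq_iff compose_def restrict_def ss cl extensional_def)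
  have val: "swap_hom N r 0 = ?id" "swap_hom N r 1 = s"
    by (simp_all add: swap_hom_def s_def)
  have car: "carrier Z2 = {0, 1}" by (auto simp: carrier_integer_mod_group)
  show ?thesis unfolding N
    using aut id bij
    by (auto simp: hom_def zero_one_power_def car val mult comps)
qed

end

theory Submission
  imports Defs
begin

text \<open>
  A nonempty face of the polytope is determined by the facet inequalities that are tight on it, so
  automorphisms of the face poset are the permutations of the facets that preserve the family of tight
  sets. The facets are the edges of a grid graph on an order ideal of \<open>nat \<times> nat\<close> with \<open>m\<close> marked
  cells, which carry the fixed values \<open>1, \<dots>, m\<close>. Two edges force a third one exactly if they form
  one of the two chains of a unit square; hence an automorphism permutes the unit squares and, up to the
  transposition of the ideal, fixes each of them. What remains free is the exchange of the two edges at
  the innermost corner and at the outer corners, and the permutation of the pendant edges at the first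
  and last marks. The two edges at an outer corner that is a mark cannot be exchanged, because the
  shortest paths between consecutive marks are never entirely tight. All other exchanges come from affine
  symmetries: reflect an entry between its two neighbours, or permute the successive differences along a
  pendant chain.
\<close>

section \<open>Faces of a polyhedron and permutations of its facets\<close>

text \<open>The relation \<open>forces\<close> sees only unit squares, so it cannot pin down what an
  automorphism does at marks and pendant edges once every square is fixed. Those are controlled by
  the global fact that the path \<open>Xp k\<close> between two marks is never tight: each exclusion
  exhibits one explicit point \<open>rowpt w\<close> (or its transpose) at which the supposed image
  of a whole path is tight. An inner mark exists because \<open>m \<ge> 3\<close>; its pair of edges
  rules out reversal of orientation. For \<open>m \<ge> 4\<close> neighbouring inner marks fix each
  other. For \<open>m = 3\<close> and first and last multiplicity 1 there is a single square, which
  the transposition fixes too, so fixing squares does not separate the transposition from the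
  identity; this case needs its own argument. The counts in the theorem: \<open>r\<^sub>1\<close> is
  the number of outer corners that are not marks, and the extra \<open>Z2\<close> belongs to the
  cell \<open>(0, 0)\<close>. The column of the first mark has as many pendant edges as the second
  multiplicity if the first multiplicity is 1, and a single one otherwise; dually at the last
  mark.\<close>

definition tight :: "('e \<Rightarrow> 'v \<Rightarrow> real) \<Rightarrow> 'e set \<Rightarrow> 'v \<Rightarrow> 'e set"
  where "tight g E x = {e \<in> E. g e x = 0}"

definition perm_Aut :: "'e set \<Rightarrow> 'e set set \<Rightarrow> ('e \<Rightarrow> 'e) monoid"
  where "perm_Aut E K =
    \<lparr>carrier = {\<pi>. \<pi> permutes E \<and> (`) \<pi> ` K = K}, monoid.mult = (\<circ>), one = id\<rparr>"

lemma group_perm_Aut: "group (perm_Aut E K)"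
proof (rule groupI)
  fix x assume "x \<in> carrier (perm_Aut E K)"
  then have x: "x permutes E" "(`) x ` K = K" by (auto simp: perm_Aut_def)
  have "(`) (inv_into UNIV x) ` K = (`) (inv_into UNIV x) ` (`) x ` K" using x by simp
  also have "\<dots> = K" using x(1) by (auto simp: image_image permutes_inverses)
  finally show "\<exists>y\<in>carrier (perm_Aut E K). y \<otimes>\<^bsub>perm_Aut E K\<^esub> x = \<one>\<^bsub>perm_Aut E K\<^esub>"
    using x by (intro bexI[of _ "inv_into UNIV x"])
      (auto simp: perm_Aut_def permutes_inv_o permutes_inv)
next
  fix x y assume xy: "x \<in> carrier (perm_Aut E K)" "y \<in> carrier (perm_Aut E K)"
  have "(`) (x \<circ> y) ` K = (`) x ` (`) y ` K" by (simp add: image_image)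
  then show "x \<otimes>\<^bsub>perm_Aut E K\<^esub> y \<in> carrier (perm_Aut E K)"
    using xy by (simp add: perm_Aut_def permutes_compose)
qed (auto simp: perm_Aut_def permutes_id)

lemma poset_Aut_iso:
  assumes h: "bij_betw h A B" and R: "\<And>x y. x \<in> A \<Longrightarrow> y \<in> A \<Longrightarrow> R' (h x) (h y) \<longleftrightarrow> R x y"
  shows "poset_Aut A R \<cong> poset_Aut B R'"
proof -
  define k where "k = inv_into A h"
  have kB: "k y \<in> A" "h (k y) = y" if "y \<in> B" for y
    using h that by (auto simp: k_def bij_betw_def inv_into_into f_inv_into_f)
  have hA: "h x \<in> B" "k (h x) = x" if "x \<in> A" for x
    using h that by (auto simp: k_def bij_betw_def)
  define \<theta> where "\<theta> = (\<lambda>f. \<lambda>y\<in>B. h (f (k y)))"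
  have car: "f \<in> carrier (poset_Aut V S) \<longleftrightarrow>
      f \<in> extensional V \<and> bij_betw f V V \<and> (\<forall>x\<in>V. \<forall>y\<in>V. S (f x) (f y) \<longleftrightarrow> S x y)"
    for f and V :: "'z set" and S
    by (auto simp: poset_Aut_def Bij_def)
  have cl: "f x \<in> V" if "f \<in> carrier (poset_Aut V S)" "x \<in> V" for f x and V :: "'z set" and S
    using that by (auto simp: car bij_betw_def)
  have mult: "f \<otimes>\<^bsub>poset_Aut V S\<^esub> g = compose V f g"
    if "f \<in> carrier (poset_Aut V S)" "g \<in> carrier (poset_Aut V S)" for f g and V :: "'z set" and S
    using that by (simp add: poset_Aut_def BijGroup_def)
  have th: "\<theta> f \<in> carrier (poset_Aut B R')" if f: "f \<in> carrier (poset_Aut A R)" for f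
  proof -
    have "bij_betw k B A" unfolding k_def using h by (rule bij_betw_inv_into)
    moreover have "bij_betw f A A" using f by (simp add: car)
    ultimately have "bij_betw (h \<circ> (f \<circ> k)) B B"
      using h by (blast intro: bij_betw_trans)
    then have "bij_betw (\<theta> f) B B"
      by (rule bij_betw_cong[THEN iffD1, rotated]) (simp add: \<theta>_def)
    then show ?thesis
      using f kB cl[OF f] R by (auto simp: car \<theta>_def) metis+
  qed
  have "\<theta> \<in> hom (poset_Aut A R) (poset_Aut B R')"
  proof (rule homI)
    fix f g assume fg: "f \<in> carrier (poset_Aut A R)" "g \<in> carrier (poset_Aut A R)"
    show "\<theta> (f \<otimes>\<^bsub>poset_Aut A R\<^esub> g) = \<theta> f \<otimes>\<^bsub>poset_Aut B R'\<^esub> \<theta> g"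
      unfolding mult[OF fg] mult[OF th[OF fg(1)] th[OF fg(2)]]
      using kB hA cl[OF fg(1)] cl[OF fg(2)] by (auto simp: \<theta>_def compose_def fun_eq_iff)
  qed (rule th)
  moreover have "bij_betw \<theta> (carrier (poset_Aut A R)) (carrier (poset_Aut B R'))"
  proof (rule bij_betw_imageI)
    show "inj_on \<theta> (carrier (poset_Aut A R))"
    proof (rule inj_onI)
      fix f g assume fg: "f \<in> carrier (poset_Aut A R)" "g \<in> carrier (poset_Aut A R)" "\<theta> f = \<theta> g"
      show "f = g"
      proof (rule extensionalityI[of _ A])
        fix x assume x: "x \<in> A"
        have "\<theta> f (h x) = \<theta> g (h x)" using fg by simp
        then have "h (f x) = h (g x)" using x hA by (simp add: \<theta>_def)
        then show "f x = g x" by (metis cl fg(1,2) hA(2) x)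
      qed (use fg car in auto)
    qed
    show "\<theta> ` carrier (poset_Aut A R) = carrier (poset_Aut B R')"
    proof
      show "\<theta> ` carrier (poset_Aut A R) \<subseteq> carrier (poset_Aut B R')"
        using \<open>\<theta> \<in> hom _ _\<close> by (auto simp: hom_def)
      show "carrier (poset_Aut B R') \<subseteq> \<theta> ` carrier (poset_Aut A R)"
      proof
        fix f assume f: "f \<in> carrier (poset_Aut B R')"
        define f' where "f' = (\<lambda>x\<in>A. k (f (h x)))"
        have fB: "f y \<in> B" if "y \<in> B" for y using cl[OF f that] .
        have "bij_betw k B A" unfolding k_def using h by (rule bij_betw_inv_into)
        moreover have "bij_betw f B B" using f by (simp add: car)
        ultimately have "bij_betw (k \<circ> (f \<circ> h)) A A"
          using h by (blast intro: bij_betw_trans)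
        then have "bij_betw f' A A"
          by (rule bij_betw_cong[THEN iffD1, rotated]) (simp add: f'_def)
        moreover have "R (f' x) (f' y) \<longleftrightarrow> R x y" if "x \<in> A" "y \<in> A" for x y
        proof -
          have "R (f' x) (f' y) \<longleftrightarrow> R' (h (f' x)) (h (f' y))"
            using that hA kB fB R[of "f' x" "f' y"] by (simp add: f'_def)
          also have "\<dots> \<longleftrightarrow> R' (f (h x)) (f (h y))"
            using that hA kB fB by (simp add: f'_def)
          also have "\<dots> \<longleftrightarrow> R' (h x) (h y)" using f that hA by (auto simp: car)
          finally show ?thesis using that R by simp
        qed
        ultimately have "f' \<in> carrier (poset_Aut A R)" by (auto simp: car f'_def)
        moreover have "\<theta> f' = f"
        proof (rule extensionalityI[of _ B])
          fix y assume "y \<in> B"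
          then show "\<theta> f' y = f y" using kB fB by (simp add: \<theta>_def f'_def)
        qed (use f car in \<open>auto simp: \<theta>_def\<close>)
        ultimately show "f \<in> \<theta> ` carrier (poset_Aut A R)" by blast
      qed
    qed
  qed
  ultimately show ?thesis by (auto simp: is_iso_def iso_def)
qed

text \<open>The least set \<open>{}\<close> is preserved, hence so are the singletons just above it,
  and an order automorphism is the image map of the permutation induced on them. Inclusion is
  reversed because faces shrink as tight sets grow.\<close>

lemma perm_Aut_iso_poset_Aut:
  fixes E :: "'e set"
  assumes K: "K \<subseteq> Pow E" and empty: "{} \<in> K" and single: "\<And>e. e \<in> E \<Longrightarrow> {e} \<in> K"
  shows "perm_Aut E K \<cong> poset_Aut K (\<lambda>V W. W \<subseteq> V)"
proof -
  define \<theta> where "\<theta> = (\<lambda>\<pi> :: 'e \<Rightarrow> 'e. \<lambda>V\<in>K. \<pi> ` V)"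
  have car: "f \<in> carrier (poset_Aut K (\<lambda>V W. W \<subseteq> V)) \<longleftrightarrow>
      f \<in> extensional K \<and> bij_betw f K K \<and> (\<forall>x\<in>K. \<forall>y\<in>K. f y \<subseteq> f x \<longleftrightarrow> y \<subseteq> x)" for f
    by (auto simp: poset_Aut_def Bij_def)
  have pcar: "\<pi> \<in> carrier (perm_Aut E K) \<longleftrightarrow> \<pi> permutes E \<and> (`) \<pi> ` K = K" for \<pi>
    by (simp add: perm_Aut_def)
  have th: "\<theta> \<pi> \<in> carrier (poset_Aut K (\<lambda>V W. W \<subseteq> V))" if "\<pi> \<in> carrier (perm_Aut E K)" for \<pi>
  proof -
    have pi: "inj \<pi>" "(`) \<pi> ` K = K" using that by (auto simp: pcar permutes_inj)
    have "bij_betw ((`) \<pi>) K K"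
      using pi by (auto simp: bij_betw_def inj_on_def inj_image_eq_iff)
    then have "bij_betw (\<theta> \<pi>) K K"
      by (rule bij_betw_cong[THEN iffD1, rotated]) (simp add: \<theta>_def)
    then show ?thesis using pi by (auto simp: car \<theta>_def inj_image_subset_iff)
  qed
  have "\<theta> \<in> hom (perm_Aut E K) (poset_Aut K (\<lambda>V W. W \<subseteq> V))"
  proof (rule homI)
    fix f g assume fg: "f \<in> carrier (perm_Aut E K)" "g \<in> carrier (perm_Aut E K)"
    have "g ` V \<in> K" if "V \<in> K" for V using fg that by (auto simp: pcar)
    then show "\<theta> (f \<otimes>\<^bsub>perm_Aut E K\<^esub> g) = \<theta> f \<otimes>\<^bsub>poset_Aut K (\<lambda>V W. W \<subseteq> V)\<^esub> \<theta> g"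
      using th[OF fg(1)] th[OF fg(2)]
      by (auto simp: poset_Aut_def BijGroup_def perm_Aut_def \<theta>_def compose_def fun_eq_iff image_comp)
  qed (rule th)
  moreover have "inj_on \<theta> (carrier (perm_Aut E K))"
  proof (rule inj_onI, rule ext)
    fix f g e assume fg: "f \<in> carrier (perm_Aut E K)" "g \<in> carrier (perm_Aut E K)" "\<theta> f = \<theta> g"
    show "f e = g e"
    proof (cases "e \<in> E")
      case True
      have "\<theta> f {e} = \<theta> g {e}" using fg by simp
      then show ?thesis using single[OF True] by (simp add: \<theta>_def)
    next
      case False
      then show ?thesis using fg(1,2) by (metis pcar permutes_not_in)
    qed
  qed
  moreover have "f \<in> \<theta> ` carrier (perm_Aut E K)"
    if f: "f \<in> carrier (poset_Aut K (\<lambda>V W. W \<subseteq> V))" for f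
  proof -
    have fK: "f V \<in> K" if "V \<in> K" for V using f that by (auto simp: car bij_betw_def)
    have mono: "f W \<subseteq> f V \<longleftrightarrow> W \<subseteq> V" if "V \<in> K" "W \<in> K" for V W using f that by (auto simp: car)
    have onto: "\<exists>W\<in>K. f W = V" if "V \<in> K" for V
    proof -
      have "f ` K = K" using f by (simp add: car bij_betw_def)
      then show ?thesis using that by (metis imageE)
    qed
    have f0: "f {} = {}"
      using onto[OF empty] mono[OF _ empty] by fastforce
    \<comment> \<open>For \<open>e'\<close> in \<open>f {e}\<close>, the preimage \<open>W\<close>
      of \<open>{e'}\<close> is contained in \<open>{e}\<close>, and it is not empty since
      \<open>f {} = {}\<close>.\<close>
    have "\<exists>e'\<in>E. f {e} = {e'}" if e: "e \<in> E" for e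
    proof -
      have "f {e} \<noteq> {}" using mono[OF empty single[OF e]] f0 by auto
      then obtain e' where e': "e' \<in> f {e}" by blast
      have "e' \<in> E" using e' fK[OF single[OF e]] K by blast
      then obtain W where W: "W \<in> K" "f W = {e'}" using onto single by blast
      then have "W \<subseteq> {e}" using mono[OF single[OF e] W(1)] e' by auto
      moreover have "W \<noteq> {}" using W f0 by auto
      ultimately have "W = {e}" by blast
      then show ?thesis using W \<open>e' \<in> E\<close> by blast
    qed
    then obtain p where p: "\<And>e. e \<in> E \<Longrightarrow> p e \<in> E \<and> f {e} = {p e}" by metis
    define \<pi> where "\<pi> = (\<lambda>e. if e \<in> E then p e else e)"
    have inj: "inj_on p E"
      using p mono[OF single single] by (metis inj_onI insert_subset singleton_iff subset_refl)
    have surj: "p ` E = E"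
    proof -
      have "e' \<in> p ` E" if e': "e' \<in> E" for e'
      proof -
        obtain W where W: "W \<in> K" "f W = {e'}" using onto single[OF e'] by blast
        then have "W \<noteq> {}" using f0 by auto
        then obtain e where e: "e \<in> W" by blast
        then have "e \<in> E" using W K by blast
        then have "f {e} \<subseteq> f W" using mono[OF W(1) single] e by simp
        then show ?thesis using p[OF \<open>e \<in> E\<close>] W \<open>e \<in> E\<close> by auto
      qed
      then show ?thesis using p by auto
    qed
    have perm: "\<pi> permutes E"
      by (rule bij_imp_permutes)
        (use inj surj in \<open>auto simp: \<pi>_def bij_betw_def inj_on_def\<close>)
    have img: "f V = \<pi> ` V" if V: "V \<in> K" for V
    proof
      show "\<pi> ` V \<subseteq> f V"
      proof
        fix e' assume "e' \<in> \<pi> ` V"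
        then obtain e where e: "e \<in> V" "e' = \<pi> e" by blast
        then have "e \<in> E" using V K by blast
        then have "f {e} \<subseteq> f V" using mono[OF V single] e by simp
        then show "e' \<in> f V" using p[OF \<open>e \<in> E\<close>] e \<open>e \<in> E\<close> by (simp add: \<pi>_def)
      qed
      show "f V \<subseteq> \<pi> ` V"
      proof
        fix e' assume e': "e' \<in> f V"
        then have "e' \<in> E" using fK[OF V] K by blast
        then have "e' \<in> p ` E" by (simp add: surj)
        then obtain e where e: "e \<in> E" "p e = e'" by blast
        then have "f {e} \<subseteq> f V" using p e' by auto
        then show "e' \<in> \<pi> ` V" using mono[OF V single[OF e(1)]] e by (auto simp: \<pi>_def)
      qed
    qed
    have "(`) \<pi> ` K = K" 
    proof -
      have "(`) \<pi> ` K = f ` K" using img by (auto intro!: image_cong)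
      also have "\<dots> = K" using f by (simp add: car bij_betw_def)
      finally show ?thesis .
    qed
    then have "\<pi> \<in> carrier (perm_Aut E K)" using perm by (simp add: pcar)
    moreover have "\<theta> \<pi> = f"
      by (rule extensionalityI[of _ K]) (use f car img in \<open>auto simp: \<theta>_def\<close>)
    ultimately show ?thesis by blast
  qed
  ultimately have "bij_betw \<theta> (carrier (perm_Aut E K)) (carrier (poset_Aut K (\<lambda>V W. W \<subseteq> V)))"
    unfolding bij_betw_def using th by blast
  then show ?thesis using \<open>\<theta> \<in> hom _ _\<close> by (auto simp: is_iso_def iso_def)
qed

text \<open>The last assumption says that \<open>P\<close> is cut out of an affine space by the inequalities
  \<open>g e \<ge> 0\<close> near \<open>x\<close>.\<close>

locale inequality_system =
  fixes P :: "'v::real_vector set" and E :: "'e set" and g :: "'e \<Rightarrow> 'v \<Rightarrow> real"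
  assumes finite_E: "finite E" and convex_P: "convex P"
    and lin: "e \<in> E \<Longrightarrow> linear (g e)"
    and nonneg: "x \<in> P \<Longrightarrow> e \<in> E \<Longrightarrow> 0 \<le> g e x"
    and extend: "x \<in> P \<Longrightarrow> y \<in> P \<Longrightarrow> tight g E x \<subseteq> tight g E y \<Longrightarrow>
      \<exists>t>0. x + t *\<^sub>R (x - y) \<in> P"
begin

definition face_with :: "'e set \<Rightarrow> 'v set"
  where "face_with S = {x \<in> P. S \<subseteq> tight g E x}"

lemma g_convex:
  assumes "e \<in> E"
  shows "g e ((1 - u) *\<^sub>R x + u *\<^sub>R y) = (1 - u) * g e x + u * g e y"
  using lin[OF assms] by (simp add: linear_add linear_scale)

text \<open>A nonnegative affine function vanishes at an inner point of a segment only if it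
  vanishes at both ends.\<close>

lemma tight_between:
  assumes "a \<in> P" "b \<in> P" "x \<in> open_segment a b"
  shows "tight g E x = tight g E a \<inter> tight g E b"
proof -
  obtain u where u: "0 < u" "u < 1" "x = (1 - u) *\<^sub>R a + u *\<^sub>R b"
    using assms(3) by (auto simp: in_segment)
  have "g e x = 0 \<longleftrightarrow> g e a = 0 \<and> g e b = 0" if "e \<in> E" for e
    unfolding u(3) g_convex[OF that]
    using nonneg[OF assms(1) that] nonneg[OF assms(2) that] u by (simp add: add_nonneg_eq_0_iff)
  then show ?thesis by (auto simp: tight_def)
qed

lemma face_with_face: "face_with S face_of P"
  unfolding face_of_def
proof (intro conjI ballI impI)
  show "face_with S \<subseteq> P" by (auto simp: face_with_def)
  show "convex (face_with S)"
  proof (rule convexI)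
    fix x y and u v :: real
    assume xy: "x \<in> face_with S" "y \<in> face_with S" and uv: "0 \<le> u" "0 \<le> v" "u + v = 1"
    have u: "u = 1 - v" using uv by simp
    have "u *\<^sub>R x + v *\<^sub>R y \<in> P" using xy uv convex_P by (auto simp: face_with_def convex_def)
    then show "u *\<^sub>R x + v *\<^sub>R y \<in> face_with S"
      using xy by (auto simp: face_with_def tight_def u g_convex subset_iff)
  qed
  fix a b x assume "a \<in> P" "b \<in> P" "x \<in> face_with S" "x \<in> open_segment a b"
  then show "a \<in> face_with S" "b \<in> face_with S"
    using tight_between by (auto simp: face_with_def)
qed

text \<open>A point of \<open>F\<close> with fewest tight inequalities plays the part of a relative
  interior point: its midpoint with any \<open>y\<close> in \<open>F\<close> cannot lose a tight
  inequality, so whatever is tight at \<open>x\<close> is tight on \<open>F\<close>. Conversely,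
  \<open>extend\<close> prolongs the segment from \<open>y\<close> beyond \<open>x\<close>, and the
  face property pulls \<open>y\<close> into \<open>F\<close>.\<close>

lemma face_is_face_with:
  assumes F: "F face_of P" and ne: "F \<noteq> {}"
  shows "\<exists>x\<in>F. F = face_with (tight g E x)"
proof -
  have FP: "F \<subseteq> P" "convex F" using F by (auto simp: face_of_def)
  obtain x where x: "x \<in> F" "\<And>y. y \<in> F \<Longrightarrow> card (tight g E x) \<le> card (tight g E y)"
    using ne ex_has_least_nat[of "\<lambda>x. x \<in> F" _ "\<lambda>x. card (tight g E x)"] by blast
  have fin: "finite (tight g E z)" for z using finite_E by (simp add: tight_def)
  have min: "tight g E x \<subseteq> tight g E y" if y: "y \<in> F" for y
  proof (cases "x = y")
    case False
    define z where "z = midpoint x y"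
    have zs: "z \<in> open_segment x y" using False by (simp add: z_def)
    have "z \<in> F" using FP zs x y by (meson closed_segment_subset open_closed_segment subsetD)
    then have "card (tight g E x) \<le> card (tight g E x \<inter> tight g E y)"
      using x(2)[of z] tight_between[OF _ _ zs] x(1) y FP by (metis subsetD)
    then have "tight g E x \<inter> tight g E y = tight g E x"
      by (intro card_seteq fin) auto
    then show ?thesis by blast
  qed simp
  have "F = face_with (tight g E x)"
  proof
    show "F \<subseteq> face_with (tight g E x)" using min FP by (auto simp: face_with_def)
    show "face_with (tight g E x) \<subseteq> F"
    proof
      fix y assume "y \<in> face_with (tight g E x)"
      then have y: "y \<in> P" "tight g E x \<subseteq> tight g E y" by (auto simp: face_with_def)
      show "y \<in> F"
      proof (cases "y = x")
        case False
        obtain t where t: "t > 0" "x + t *\<^sub>R (x - y) \<in> P" using extend[OF _ y] x(1) FP by blast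
        define w where "w = x + t *\<^sub>R (x - y)"
        \<comment> \<open>Since \<open>w - x\<close> is \<open>t\<close> times \<open>x - y\<close>,
          the point \<open>x\<close> divides the segment from \<open>y\<close> to \<open>w\<close>
          in the ratio 1 to \<open>t\<close>.\<close>
        have "x = (1 - 1 / (1 + t)) *\<^sub>R y + (1 / (1 + t)) *\<^sub>R w"
        proof -
          have "(1 + t) *\<^sub>R ((1 - 1 / (1 + t)) *\<^sub>R y + (1 / (1 + t)) *\<^sub>R w) = t *\<^sub>R y + w"
            using t by (simp add: scaleR_right_distrib field_simps)
          also have "\<dots> = (1 + t) *\<^sub>R x" by (simp add: w_def algebra_simps)
          finally show ?thesis using t by (simp add: scaleR_cancel_left)
        qed
        moreover have "w \<noteq> y"
        proof
          assume "w = y"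
          then have "(1 + t) *\<^sub>R (x - y) = 0" by (simp add: w_def algebra_simps)
          then show False using t False by simp
        qed
        ultimately have "x \<in> open_segment y w"
          using t unfolding in_segment
          by (intro conjI exI[of _ "1 / (1 + t)"]) (auto simp: field_simps)
        then show ?thesis using F x(1) y(1) t(2) unfolding face_of_def w_def by blast
      qed (use x in simp)
    qed
  qed
  then show ?thesis using x by blast
qed

text \<open>The empty face is encoded by the set \<open>E\<close>, which no point attains; with it,
  \<open>face_with\<close> becomes an order-reversing bijection onto all faces. Every permutation of
  \<open>E\<close> maps \<open>E\<close> to itself, so adding this set leaves the group
  unchanged.\<close>

theorem face_Aut_iso_perm_Aut:
  assumes empty: "{} \<in> tight g E ` P" and single: "\<And>e. e \<in> E \<Longrightarrow> {e} \<in> tight g E ` P"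
    and noall: "E \<notin> tight g E ` P"
  shows "face_Aut P \<cong> perm_Aut E (tight g E ` P)"
proof -
  define K where "K = insert E (tight g E ` P)"
  have TE: "tight g E x \<subseteq> E" for x by (auto simp: tight_def)
  have fE: "face_with E = {}" using noall TE by (fastforce simp: face_with_def)
  have incl: "face_with V \<subseteq> face_with W \<longleftrightarrow> W \<subseteq> V" if VW: "V \<in> K" "W \<in> K" for V W
  proof (cases "V = E")
    case True
    then show ?thesis using VW TE by (auto simp: K_def fE)
  next
    case False
    then obtain x where "x \<in> P" "V = tight g E x" using VW(1) unfolding K_def by blast
    then show ?thesis by (auto simp: face_with_def)
  qed
  have "bij_betw face_with K {F. F face_of P}"
  proof (rule bij_betw_imageI)
    show "inj_on face_with K" by (rule inj_onI) (use incl in blast)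
    show "face_with ` K = {F. F face_of P}"
    proof
      show "face_with ` K \<subseteq> {F. F face_of P}" using face_with_face by blast
      show "{F. F face_of P} \<subseteq> face_with ` K"
      proof
        fix F assume "F \<in> {F. F face_of P}"
        then have F: "F face_of P" by simp
        show "F \<in> face_with ` K"
        proof (cases "F = {}")
          case True
          then show ?thesis using fE by (auto simp: K_def)
        next
          case False
          have "F \<subseteq> P" using F by (simp add: face_of_def)
          then show ?thesis using face_is_face_with[OF F False] by (auto simp: K_def)
        qed
      qed
    qed
  qed
  then have "poset_Aut K (\<lambda>V W. W \<subseteq> V) \<cong> face_Aut P"
    unfolding face_Aut_def using incl by (rule poset_Aut_iso) auto
  moreover have "perm_Aut E K \<cong> poset_Aut K (\<lambda>V W. W \<subseteq> V)"
    by (rule perm_Aut_iso_poset_Aut) (use empty single TE in \<open>auto simp: K_def\<close>)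
  moreover have "perm_Aut E K = perm_Aut E (tight g E ` P)"
  proof -
    have "(`) \<pi> ` K = K \<longleftrightarrow> (`) \<pi> ` tight g E ` P = tight g E ` P" if pi: "\<pi> permutes E" for \<pi>
    proof -
      have inj: "inj ((`) \<pi>)" by (rule injI) (simp add: inj_image_eq_iff[OF permutes_inj[OF pi]])
      have piE: "\<pi> ` E = E" using pi by (rule permutes_image)
      have "E \<notin> (`) \<pi> ` tight g E ` P" 
      proof
        assume "E \<in> (`) \<pi> ` tight g E ` P"
        then obtain Z where Z: "Z \<in> tight g E ` P" "\<pi> ` Z = \<pi> ` E" using piE by auto
        then have "Z = E" using inj by (auto dest: injD)
        then show False using Z noall by simp
      qed
      then show ?thesis using noall piE by (auto simp: K_def insert_ident)
    qed
    then show ?thesis by (simp add: perm_Aut_def cong: conj_cong)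
  qed
  moreover have "group (perm_Aut E K)" by (rule group_perm_Aut)
  ultimately show ?thesis by (metis iso_trans group.iso_sym)
qed

end

section \<open>Order ideals with marked cells\<close>

datatype edge = Ho nat nat | Ve nat nat

text \<open>Edges point towards larger entries. A smaller \<open>r\<close> means a larger entry,
  hence the direction of \<open>Ve\<close>.\<close>

fun src :: "edge \<Rightarrow> nat \<times> nat"
  where "src (Ho r c) = (r, c)" | "src (Ve r c) = (Suc r, c)"

fun tgt :: "edge \<Rightarrow> nat \<times> nat"
  where "tgt (Ho r c) = (r, Suc c)" | "tgt (Ve r c) = (r, c)"

definition below :: "nat \<times> nat \<Rightarrow> nat \<times> nat \<Rightarrow> bool"
  where "below p q \<longleftrightarrow> fst q \<le> fst p \<and> snd p \<le> snd q"

text \<open>Each edge raises this by one, so comparable cells of equal rank coincide; the analysis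
  of contracted edges rests on this count.\<close>

definition rank :: "nat \<times> nat \<Rightarrow> int"
  where "rank p = int (snd p) - int (fst p)"

lemma below_refl [simp]: "below p p"
  by (simp add: below_def)

lemma below_trans: "below p q \<Longrightarrow> below q u \<Longrightarrow> below p u"
  by (auto simp: below_def)

lemma rank_below: "below p q \<Longrightarrow> rank p \<le> rank q"
  by (auto simp: below_def rank_def)

lemma rank_below_eq: "below p q \<Longrightarrow> rank q \<le> rank p \<Longrightarrow> p = q"
  by (auto simp: below_def rank_def prod_eq_iff)

lemma rank_tgt [simp]: "rank (tgt e) = rank (src e) + 1"
  by (cases e) (auto simp: rank_def)

lemma below_edge: "below (src e) (tgt e)"
  by (cases e) (auto simp: below_def)

text \<open>Entry \<open>(i, j)\<close> of a Gelfand--Tsetlin array is read in the coordinates \<open>r = n - i\<close>,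
  \<open>c = j - 1\<close>, so that the entries with two different blocks form an order ideal of
  \<open>nat \<times> nat\<close>. Here \<open>s k\<close> is the number of parts that are at most \<open>k\<close>, and \<open>mk k\<close> is the only
  entry with forced value \<open>k\<close> that bounds a facet.\<close>

locale shape =
  fixes m :: nat and s :: "nat \<Rightarrow> nat"
  assumes m3: "3 \<le> m" and s_0 [simp]: "s 0 = 0" and s_Suc: "k < m \<Longrightarrow> s k < s (Suc k)"
begin

definition t :: "nat \<Rightarrow> nat"
  where "t k = s m - s k"

definition mk :: "nat \<Rightarrow> nat \<times> nat"
  where "mk k = (t k, s (k - 1))"

definition Q :: "(nat \<times> nat) set"
  where "Q = {(r, c). \<exists>k\<in>{1..m - 1}. r < t k \<and> c < s k}"

definition H :: "(nat \<times> nat) set"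
  where "H = Q \<union> mk ` {1..m}"

definition E :: "edge set"
  where "E = {e. src e \<in> H \<and> tgt e \<in> H}"

text \<open>Values outside \<open>H\<close> are arbitrary; neither the constraints nor
  \<open>tt\<close> look at them.\<close>

definition pts :: "(nat \<times> nat \<Rightarrow> real) set"
  where "pts = {f. (\<forall>k\<in>{1..m}. f (mk k) = real k) \<and> (\<forall>e\<in>E. f (src e) \<le> f (tgt e))}"

definition tt :: "(nat \<times> nat \<Rightarrow> real) \<Rightarrow> edge set"
  where "tt f = {e \<in> E. f (src e) = f (tgt e)}"

definition Ts :: "edge set set"
  where "Ts = tt ` pts"

section \<open>Partial sums, the order ideal and its marked corners\<close>

lemma s_less: "i < j \<Longrightarrow> j \<le> m \<Longrightarrow> s i < s j"
proof (induction j)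
  case (Suc j)
  then show ?case using s_Suc[of j] by (cases "i = j") auto
qed simp

lemma s_less_iff: "i \<le> m \<Longrightarrow> j \<le> m \<Longrightarrow> s i < s j \<longleftrightarrow> i < j"
  using s_less by (metis less_asym linorder_neqE_nat)

lemma s_le_iff: "i \<le> m \<Longrightarrow> j \<le> m \<Longrightarrow> s i \<le> s j \<longleftrightarrow> i \<le> j"
  using s_less_iff by (metis linorder_not_less)

lemma s_eq_iff: "i \<le> m \<Longrightarrow> j \<le> m \<Longrightarrow> s i = s j \<longleftrightarrow> i = j"
  using s_le_iff by (metis order_antisym order_refl)

lemma s_plus_t: "k \<le> m \<Longrightarrow> s k + t k = s m"
  using s_le_iff[of k m] by (simp add: t_def)

lemma t_less_iff: "i \<le> m \<Longrightarrow> j \<le> m \<Longrightarrow> t i < t j \<longleftrightarrow> j < i"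
  using s_plus_t[of i] s_plus_t[of j] s_less_iff[of j i] by linarith

lemma t_le_iff: "i \<le> m \<Longrightarrow> j \<le> m \<Longrightarrow> t i \<le> t j \<longleftrightarrow> j \<le> i"
  using t_less_iff by (metis linorder_not_less)

lemma t_eq_iff: "i \<le> m \<Longrightarrow> j \<le> m \<Longrightarrow> t i = t j \<longleftrightarrow> i = j"
  using t_le_iff by (metis order_antisym order_refl)

lemma t_m [simp]: "t m = 0"
  by (simp add: t_def)

lemma t_0 [simp]: "t 0 = s m"
  by (simp add: t_def)

lemma Q_down: "(r, c) \<in> Q \<Longrightarrow> r' \<le> r \<Longrightarrow> c' \<le> c \<Longrightarrow> (r', c') \<in> Q"
proof -
  assume "(r, c) \<in> Q" and le: "r' \<le> r" "c' \<le> c"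
  then obtain k where "k \<in> {1..m - 1}" "r < t k" "c < s k" by (auto simp: Q_def)
  then have "k \<in> {1..m - 1}" "r' < t k" "c' < s k" using le by auto
  then show ?thesis unfolding Q_def by blast
qed

text \<open>Above the row of the mark the cell lies in the rectangle of index \<open>k\<close>; in
  that row it is strictly left of the mark and lies in the rectangle of index
  \<open>k - 1\<close>.\<close>

lemma below_mk_Q:
  assumes k: "k \<in> {1..m}" and le: "r \<le> t k" "c \<le> s (k - 1)" and ne: "(r, c) \<noteq> mk k"
  shows "(r, c) \<in> Q"
proof (cases "r < t k")
  case True
  then have "k \<noteq> m" by auto
  then have "k \<in> {1..m - 1}" using k by auto
  moreover have "c < s k" using le s_less[of "k - 1" k] k by auto
  ultimately show ?thesis using True by (auto simp: Q_def)
next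
  case False
  then have "c < s (k - 1)" "r = t k" using le ne by (auto simp: mk_def)
  moreover from this have "k \<noteq> 1" by auto
  ultimately have "k - 1 \<in> {1..m - 1} \<and> r < t (k - 1) \<and> c < s (k - 1)"
    using k t_less_iff[of k "k - 1"] by auto
  then show ?thesis unfolding Q_def by blast
qed

lemma H_down: "(r, c) \<in> H \<Longrightarrow> r' \<le> r \<Longrightarrow> c' \<le> c \<Longrightarrow> (r', c') \<in> H"
  unfolding H_def using below_mk_Q Q_down by (fastforce simp: mk_def)

lemma mk_in_H [simp]: "k \<in> {1..m} \<Longrightarrow> mk k \<in> H"
  by (simp add: H_def)

lemma mk_notin_Q: "k \<in> {1..m} \<Longrightarrow> mk k \<notin> Q"
proof
  assume k: "k \<in> {1..m}" and "mk k \<in> Q"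
  then obtain l where l: "l \<in> {1..m - 1}" "t k < t l" "s (k - 1) < s l" by (auto simp: Q_def mk_def)
  have "l < k" using l t_less_iff[of k l] k by auto
  moreover have "k - 1 < l" using l s_less_iff[of "k - 1" l] k by auto
  ultimately show False by simp
qed

text \<open>Marks are maximal in \<open>H\<close> for the product order: a cell of \<open>Q\<close>
  beyond a mark would put the mark into \<open>Q\<close>, and two marks are incomparable because
  \<open>t\<close> decreases while \<open>s\<close> increases.\<close>

lemma mk_corner:
  assumes k: "k \<in> {1..m}"
  shows "(Suc (t k), s (k - 1)) \<notin> H" "(t k, Suc (s (k - 1))) \<notin> H"
proof -
  have no: "(r, c) \<notin> H" if "t k \<le> r" "s (k - 1) \<le> c" "(r, c) \<noteq> mk k" for r c
  proof
    assume "(r, c) \<in> H"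
    then consider "(r, c) \<in> Q" | l where "l \<in> {1..m}" "(r, c) = mk l" by (auto simp: H_def)
    then show False
    proof cases
      case 1
      then have "mk k \<in> Q" using Q_down that by (auto simp: mk_def)
      then show ?thesis using mk_notin_Q k by blast
    next
      case 2
      then have "t k \<le> t l" "s (k - 1) \<le> s (l - 1)" using that by (auto simp: mk_def)
      then have "l \<le> k" "k - 1 \<le> l - 1"
        using t_le_iff[of k l] s_le_iff[of "k - 1" "l - 1"] k 2 by auto
      then have "l = k" using k 2 by auto
      then show ?thesis using 2 that by simp
    qed
  qed
  show "(Suc (t k), s (k - 1)) \<notin> H" "(t k, Suc (s (k - 1))) \<notin> H"
    by (rule no; simp add: mk_def)+
qed

lemma H_bound: "(r, c) \<in> H \<Longrightarrow> r \<le> s m \<and> c \<le> s m"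
proof -
  assume "(r, c) \<in> H"
  then obtain k where k: "k \<in> {1..m}" "r \<le> t k" "c \<le> s k \<or> c \<le> s (k - 1)"
    unfolding H_def Q_def mk_def by force
  moreover have "t k \<le> s m" "s k \<le> s m" "s (k - 1) \<le> s m"
    using k(1) by (auto simp: t_def s_le_iff)
  ultimately show ?thesis by linarith
qed

lemma finite_H: "finite H"
  by (rule finite_subset[of _ "{..s m} \<times> {..s m}"]) (use H_bound in auto)

lemma Ho_in_E: "Ho r c \<in> E \<longleftrightarrow> (r, Suc c) \<in> H"
  using H_down[of r "Suc c" r c] by (auto simp: E_def)

lemma Ve_in_E: "Ve r c \<in> E \<longleftrightarrow> (Suc r, c) \<in> H"
  using H_down[of "Suc r" c r c] by (auto simp: E_def)

lemma finite_E: "finite E"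
proof (rule finite_subset)
  show "E \<subseteq> (\<lambda>(r, c). Ho r c) ` ({..s m} \<times> {..s m}) \<union> (\<lambda>(r, c). Ve r c) ` ({..s m} \<times> {..s m})"
  proof
    fix e assume e: "e \<in> E"
    show "e \<in> (\<lambda>(r, c). Ho r c) ` ({..s m} \<times> {..s m}) \<union> (\<lambda>(r, c). Ve r c) ` ({..s m} \<times> {..s m})"
      using e H_bound by (cases e) (fastforce simp: E_def)+
  qed
qed auto

text \<open>Follow edges first up to the row of \<open>q\<close>, then right; in this order the path
  never leaves the order ideal.\<close>

lemma pts_below:
  assumes f: "f \<in> pts"
  shows "p \<in> H \<Longrightarrow> q \<in> H \<Longrightarrow> below p q \<Longrightarrow> f p \<le> f q"
proof (induction "fst p + snd q - (fst q + snd p)" arbitrary: p rule: less_induct)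
  case less
  obtain r c r' c' where pq: "p = (r, c)" "q = (r', c')" by (cases p, cases q)
  have le: "r' \<le> r" "c \<le> c'" using less.prems by (auto simp: pq below_def)
  show ?case
  proof (cases "r' < r")
    case True
    then obtain u where u: "r = Suc u" by (cases r) auto
    have e: "Ve u c \<in> E" using less.prems by (simp add: Ve_in_E pq u)
    then have "f (u, c) \<le> f q"
      by (intro less.hyps) (use less.prems True le in \<open>auto simp: pq u below_def E_def\<close>)
    moreover have "f p \<le> f (u, c)" using f e by (force simp: pts_def pq u)
    ultimately show ?thesis by simp
  next
    case False
    show ?thesis
    proof (cases "c < c'")
      case True
      have "(r, Suc c) \<in> H" using less.prems le True False H_down[of r' c' r "Suc c"] by (auto simp: pq)
      then have e: "Ho r c \<in> E" by (simp add: Ho_in_E)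
      then have "f (r, Suc c) \<le> f q"
        by (intro less.hyps) (use less.prems True le in \<open>auto simp: pq below_def E_def\<close>)
      moreover have "f p \<le> f (r, Suc c)" using f e by (force simp: pts_def pq)
      ultimately show ?thesis by simp
    next
      case c: False
      then show ?thesis using le False by (simp add: pq)
    qed
  qed
qed

text \<open>Both coordinates change between marks. Contracting a single edge bridges a rank
  difference of at most one, so it cannot merge two marks; this is what makes \<open>{e}\<close> a
  tight set in \<open>Ts_single\<close>.\<close>

lemma mk_rank: "1 \<le> k \<Longrightarrow> k < l \<Longrightarrow> l \<le> m \<Longrightarrow> rank (mk k) + 2 \<le> rank (mk l)"
proof -
  assume kl: "1 \<le> k" "k < l" "l \<le> m"
  then have "t l < t k" "s (k - 1) < s (l - 1)"
    using t_less_iff[of l k] s_less[of "k - 1" "l - 1"] by simp_all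
  then show ?thesis by (simp add: rank_def mk_def)
qed

lemma mk_first: "p \<in> H \<Longrightarrow> below (mk 1) p"
proof -
  assume "p \<in> H"
  then obtain k where k: "k \<in> {1..m}" "fst p \<le> t k"
    unfolding H_def Q_def by (force simp: mk_def)
  then have "fst p \<le> t 1" using t_le_iff[of k 1] by auto
  then show ?thesis by (simp add: below_def mk_def)
qed

lemma mk_last: "p \<in> H \<Longrightarrow> below p (mk m)"
proof -
  assume "p \<in> H"
  then consider k where "k \<in> {1..m - 1}" "snd p < s k" | k where "k \<in> {1..m}" "snd p = s (k - 1)"
    unfolding H_def Q_def by (force simp: mk_def)
  then have "snd p \<le> s (m - 1)"
  proof cases
    case 1
    then have "k \<le> m" by auto
    then show ?thesis using 1 s_le_iff[of k "m - 1"] by auto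
  next
    case 2
    then show ?thesis using s_le_iff[of "k - 1" "m - 1"] by auto
  qed
  then show ?thesis by (simp add: below_def mk_def)
qed

text \<open>Between the largest mark below and the smallest mark above a point, interpolate by the size of
  its down-set: this is strictly increasing on the classes of the preorder.\<close>

lemma realise_preorder:
  assumes sub: "\<And>p q. p \<in> H \<Longrightarrow> q \<in> H \<Longrightarrow> below p q \<Longrightarrow> R p q"
    and tr: "\<And>p q u. p \<in> H \<Longrightarrow> q \<in> H \<Longrightarrow> u \<in> H \<Longrightarrow> R p q \<Longrightarrow> R q u \<Longrightarrow> R p u"
    and marks: "\<And>k l. 1 \<le> k \<Longrightarrow> k < l \<Longrightarrow> l \<le> m \<Longrightarrow> \<not> R (mk l) (mk k)"
  shows "{e \<in> E. R (tgt e) (src e)} \<in> Ts"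
proof -
  define lo where "lo p = Max {k \<in> {1..m}. R (mk k) p}" for p
  define up where "up p = Min {k \<in> {1..m}. R p (mk k)}" for p
  \<comment> \<open>The \<open>+ 1\<close> keeps the weight strictly below 1, so that a cell with
    \<open>lo p < up p\<close> gets a value strictly between its bounds.\<close>
  define \<rho> where "\<rho> p = real (card {q \<in> H. R q p}) / (real (card H) + 1)" for p
  define f where "f p = (1 - \<rho> p) * real (lo p) + \<rho> p * real (up p)" for p
  have lo: "lo p \<in> {1..m}" "R (mk (lo p)) p" and up: "up p \<in> {1..m}" "R p (mk (up p))"
    if p: "p \<in> H" for p
  proof -
    have "1 \<in> {k \<in> {1..m}. R (mk k) p}" using sub[OF _ p mk_first[OF p]] m3 by simp
    then have "lo p \<in> {k \<in> {1..m}. R (mk k) p}" unfolding lo_def by (intro Max_in) auto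
    then show "lo p \<in> {1..m}" "R (mk (lo p)) p" by auto
    have "m \<in> {k \<in> {1..m}. R p (mk k)}" using sub[OF p _ mk_last[OF p]] m3 by simp
    then have "up p \<in> {k \<in> {1..m}. R p (mk k)}" unfolding up_def by (intro Min_in) auto
    then show "up p \<in> {1..m}" "R p (mk (up p))" by auto
  qed
  have lo_max: "k \<le> lo p" if "k \<in> {1..m}" "R (mk k) p" for k p
    unfolding lo_def using that by (intro Max_ge) auto
  have up_min: "up p \<le> k" if "k \<in> {1..m}" "R p (mk k)" for k p
    unfolding up_def using that by (intro Min_le) auto
  have lo_up: "lo p \<le> up p" if p: "p \<in> H" for p
  proof (rule ccontr)
    assume "\<not> lo p \<le> up p"
    moreover have "R (mk (lo p)) (mk (up p))"
      using tr[OF _ p _ lo(2)[OF p] up(2)[OF p]] lo up p by simp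
    ultimately show False using marks[of "up p" "lo p"] lo(1)[OF p] up(1)[OF p] by auto
  qed
  have rho: "0 < \<rho> p" "\<rho> p < 1" if p: "p \<in> H" for p
  proof -
    have "p \<in> {q \<in> H. R q p}" using sub p by auto
    then have "{q \<in> H. R q p} \<noteq> {}" by blast
    then have "0 < card {q \<in> H. R q p}" using finite_H by (simp add: card_gt_0_iff)
    moreover have "card {q \<in> H. R q p} \<le> card H" using finite_H by (intro card_mono) auto
    ultimately show "0 < \<rho> p" "\<rho> p < 1" by (simp_all add: \<rho>_def field_simps)
  qed
  have mono: "lo p \<le> lo q" "up p \<le> up q" "\<rho> p \<le> \<rho> q" if pq: "p \<in> H" "q \<in> H" "R p q" for p q
  proof -
    show "lo p \<le> lo q" by (rule lo_max) (use lo[OF pq(1)] tr[OF _ pq(1,2) _ pq(3)] in auto)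
    show "up p \<le> up q" by (rule up_min) (use up[OF pq(2)] tr[OF pq(1,2) _ pq(3)] in auto)
    have "{u \<in> H. R u p} \<subseteq> {u \<in> H. R u q}" using tr[OF _ pq(1,2) _ pq(3)] by auto
    then have "card {u \<in> H. R u p} \<le> card {u \<in> H. R u q}" using finite_H by (intro card_mono) auto
    then show "\<rho> p \<le> \<rho> q" by (simp add: \<rho>_def divide_right_mono)
  qed
  have le: "f p \<le> f q" if pq: "p \<in> H" "q \<in> H" "R p q" for p q
  proof -
    have "f p \<le> (1 - \<rho> q) * real (lo p) + \<rho> q * real (up p)"
    proof -
      have "0 \<le> (\<rho> q - \<rho> p) * (real (up p) - real (lo p))"
        using mono(3)[OF pq] lo_up[OF pq(1)] by simp
      then show ?thesis by (simp add: f_def algebra_simps)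
    qed
    also have "\<dots> \<le> f q"
      unfolding f_def using mono[OF pq] rho[OF pq(2)]
      by (intro add_mono mult_left_mono) auto
    finally show ?thesis .
  qed
  \<comment> \<open>Different bounds enclose the value strictly, so an integer value
    \<open>k\<close> that is not strictly inside them forces both bounds to be
    \<open>k\<close>.\<close>
  have eq_mark: "lo p = k \<and> up p = k" if p: "p \<in> H" and k: "k \<in> {1..m}" and f: "f p = real k"
    and kk: "k \<le> lo p \<or> up p \<le> k" for p k
  proof (rule ccontr)
    assume c: "\<not> (lo p = k \<and> up p = k)"
    have f': "f p = real (lo p) + \<rho> p * (real (up p) - real (lo p))"
      "f p = real (up p) - (1 - \<rho> p) * (real (up p) - real (lo p))"
      by (simp_all add: f_def algebra_simps)
    show False
    proof (cases "lo p = up p")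
      case True
      then have "f p = real (lo p)" by (simp add: f_def algebra_simps)
      then show False using c f True by simp
    next
      case False
      then have "0 < real (up p) - real (lo p)" using lo_up[OF p] by simp
      then have "0 < \<rho> p * (real (up p) - real (lo p))" "0 < (1 - \<rho> p) * (real (up p) - real (lo p))"
        using rho[OF p] by auto
      then have "real (lo p) < real k" "real k < real (up p)" using f' f by linarith+
      then show False using kk by auto
    qed
  qed
  have lt: "R q p" if pq: "p \<in> H" "q \<in> H" "R p q" and eq: "f p = f q" for p q
  proof (rule ccontr)
    assume n: "\<not> R q p"
    have "{u \<in> H. R u p} \<subset> {u \<in> H. R u q}"
      using tr[OF _ pq(1,2) _ pq(3)] n sub[of q q] pq by auto
    then have "card {u \<in> H. R u p} < card {u \<in> H. R u q}" using finite_H by (intro psubset_card_mono) auto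
    then have r: "\<rho> p < \<rho> q" by (simp add: \<rho>_def divide_strict_right_mono)
    \<comment> \<open>If both bounds of \<open>p\<close> are \<open>k\<close>, equal values put
      \<open>q\<close> below \<open>mk k\<close> in the preorder, hence below \<open>p\<close>.
      Otherwise the larger weight of \<open>q\<close> already separates the two values.\<close>
    show False
    proof (cases "lo p = up p")
      case True
      define k where "k = lo p"
      have k: "k \<in> {1..m}" "f p = real k" using lo[OF pq(1)] True by (auto simp: k_def f_def algebra_simps)
      have "lo q = k" using eq_mark[OF pq(2) k(1)] k eq mono[OF pq] by (auto simp: k_def)
      moreover have "up q = k" using eq_mark[OF pq(2) k(1)] k eq mono[OF pq] by (auto simp: k_def)
      ultimately have "R q (mk k)" "R (mk k) p" using lo[OF pq(1)] up[OF pq(2)] by (auto simp: k_def)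
      then show False using tr[of q "mk k" p] pq k n by auto
    next
      case False
      have "f p < (1 - \<rho> q) * real (lo p) + \<rho> q * real (up p)"
      proof -
        have "0 < (\<rho> q - \<rho> p) * (real (up p) - real (lo p))"
          using r lo_up[OF pq(1)] False by simp
        then show ?thesis by (simp add: f_def algebra_simps)
      qed
      also have "\<dots> \<le> f q"
        unfolding f_def using mono[OF pq] rho[OF pq(2)]
        by (intro add_mono mult_left_mono) auto
      finally show False using eq by simp
    qed
  qed
  have fmk: "f (mk k) = real k" if k: "k \<in> {1..m}" for k
  proof -
    have "k \<le> lo (mk k)" "up (mk k) \<le> k" using lo_max[OF k] up_min[OF k] sub[of "mk k" "mk k"] k by auto
    then have "lo (mk k) = k \<and> up (mk k) = k" using lo_up[of "mk k"] k by auto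
    then show ?thesis by (simp add: f_def algebra_simps)
  qed
  have EH: "src e \<in> H" "tgt e \<in> H" "R (src e) (tgt e)" if "e \<in> E" for e
    using that sub below_edge by (auto simp: E_def)
  have "f \<in> pts" using fmk le EH by (auto simp: pts_def)
  moreover have "tt f = {e \<in> E. R (tgt e) (src e)}"
  proof -
    have "f (src e) = f (tgt e) \<longleftrightarrow> R (tgt e) (src e)" if e: "e \<in> E" for e
      using lt[OF EH[OF e]] le[OF EH[OF e]] le[OF EH(2,1)[OF e]] by (meson order_antisym)
    then show ?thesis unfolding tt_def by blast
  qed
  ultimately show ?thesis unfolding Ts_def by (metis imageI)
qed

text \<open>The preorder obtained from \<open>below\<close> by collapsing the edges \<open>e\<close> and \<open>f\<close>.\<close>

definition contr :: "edge \<Rightarrow> edge \<Rightarrow> nat \<times> nat \<Rightarrow> nat \<times> nat \<Rightarrow> bool"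
  where "contr e f p q \<longleftrightarrow> below p q
    \<or> below p (tgt e) \<and> below (src e) q \<or> below p (tgt f) \<and> below (src f) q
    \<or> below p (tgt e) \<and> below (src e) (tgt f) \<and> below (src f) q
    \<or> below p (tgt f) \<and> below (src f) (tgt e) \<and> below (src e) q"

text \<open>A path using a contracted edge twice can be cut short between the two uses, so the five
  forms are closed under composition.\<close>

lemma contr_trans: "contr e f p q \<Longrightarrow> contr e f q u \<Longrightarrow> contr e f p u"
  unfolding contr_def by (meson below_trans below_edge)

text \<open>Soundness of \<open>contr\<close>: whatever it relates is ordered at every point where
  both edges are tight. \<open>realise_preorder\<close> supplies the converse.\<close>

lemma pts_contr:
  assumes "x \<in> pts" "e \<in> tt x" "f \<in> tt x" "p \<in> H" "q \<in> H" "contr e f p q"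
  shows "x p \<le> x q"
proof -
  have "src e \<in> H" "tgt e \<in> H" "x (src e) = x (tgt e)" "src f \<in> H" "tgt f \<in> H" "x (src f) = x (tgt f)"
    using assms by (auto simp: tt_def E_def)
  then show ?thesis
    using assms(6) pts_below[OF assms(1) assms(4)] pts_below[OF assms(1) _ assms(5)]
      pts_below[OF assms(1), of "src e" "tgt f"] pts_below[OF assms(1), of "src f" "tgt e"] assms(5)
    unfolding contr_def by fastforce
qed

lemma Ts_empty: "{} \<in> Ts"
proof -
  have "{e \<in> E. below (tgt e) (src e)} \<in> Ts"
  proof (rule realise_preorder)
    fix k l assume kl: "1 \<le> k" "k < l" "l \<le> m"
    show "\<not> below (mk l) (mk k)" using mk_rank[OF kl] rank_below[of "mk l" "mk k"] by auto
  qed (auto intro: below_trans)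
  moreover have "\<not> below (tgt e) (src e)" for e using rank_below[of "tgt e" "src e"] by auto
  ultimately show ?thesis by simp
qed

lemma Ts_single:
  assumes e: "e \<in> E"
  shows "{e} \<in> Ts"
proof -
  have c: "contr e e p q \<longleftrightarrow> below p q \<or> below p (tgt e) \<and> below (src e) q" for p q
    unfolding contr_def by (meson below_edge below_trans)
  have "{g \<in> E. contr e e (tgt g) (src g)} \<in> Ts"
  proof (rule realise_preorder)
    fix k l assume kl: "1 \<le> k" "k < l" "l \<le> m"
    show "\<not> contr e e (mk l) (mk k)"
      using mk_rank[OF kl] rank_below[of "mk l" "mk k"] rank_below[of "mk l" "tgt e"]
        rank_below[of "src e" "mk k"] unfolding c by auto
  next
    show "contr e e p q" if "below p q" for p q using that by (simp add: contr_def)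
  qed (rule contr_trans)
  moreover have "contr e e (tgt g) (src g) \<longleftrightarrow> g = e" for g
  proof
    assume "contr e e (tgt g) (src g)"
    then have b: "below (tgt g) (tgt e)" "below (src e) (src g)"
      unfolding c using rank_below[of "tgt g" "src g"] by auto
    then have "tgt g = tgt e" "src g = src e"
      using rank_below[OF b(1)] rank_below[OF b(2)] rank_below_eq[OF b(1)] rank_below_eq[OF b(2)] by auto
    then show "g = e" by (cases g; cases e) auto
  qed (simp add: c)
  ultimately show ?thesis using e by (simp add: conj_commute cong: conj_cong)
qed

section \<open>Squares\<close>

text \<open>The relation \<open>forces\<close> is visible in the face poset, and it detects the unit squares: in the square
  with corners \<open>(r, c)\<close> and \<open>(Suc r, Suc c)\<close>, the edges of \<open>Lp (r, c)\<close> and of \<open>Up (r, c)\<close> form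
  the two maximal chains, and if one chain is tight then so is the other.\<close>

definition forces :: "edge \<Rightarrow> edge \<Rightarrow> edge \<Rightarrow> bool"
  where "forces e f g \<longleftrightarrow> e \<in> E \<and> f \<in> E \<and> g \<in> E \<and> e \<noteq> f \<and> g \<noteq> e \<and> g \<noteq> f
    \<and> (\<exists>S\<in>Ts. e \<in> S \<and> f \<in> S) \<and> (\<forall>S\<in>Ts. e \<in> S \<and> f \<in> S \<longrightarrow> g \<in> S)"

definition D :: "(nat \<times> nat) set"
  where "D = {(r, c). (Suc r, Suc c) \<in> H}"

definition Lp :: "nat \<times> nat \<Rightarrow> edge set"
  where "Lp = (\<lambda>(r, c). {Ve r c, Ho r c})"

definition Up :: "nat \<times> nat \<Rightarrow> edge set"
  where "Up = (\<lambda>(r, c). {Ho (Suc r) c, Ve r (Suc c)})"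

text \<open>Some point has both edges tight, so \<open>contr e f\<close> keeps the marks apart and
  is itself realised by a point; the forced edge has to be tight there.\<close>

lemma forces_contr:
  assumes "forces e f g"
  shows "contr e f (tgt g) (src g)"
proof -
  obtain S where S: "S \<in> Ts" "e \<in> S" "f \<in> S" using assms by (auto simp: forces_def)
  then obtain x where x: "x \<in> pts" "S = tt x" by (auto simp: Ts_def)
  define Z where "Z = {g \<in> E. contr e f (tgt g) (src g)}"
  have "Z \<in> Ts" unfolding Z_def
  proof (rule realise_preorder)
    fix k l assume kl: "1 \<le> k" "k < l" "l \<le> m"
    show "\<not> contr e f (mk l) (mk k)"
    proof
      assume "contr e f (mk l) (mk k)"
      then have "x (mk l) \<le> x (mk k)" using pts_contr[of x e f] x S kl by auto
      then show False using x kl by (auto simp: pts_def)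
    qed
  next
    show "contr e f p q" if "below p q" for p q using that by (simp add: contr_def)
  qed (rule contr_trans)
  moreover have "e \<in> Z" "f \<in> Z" using assms by (auto simp: Z_def forces_def contr_def)
  ultimately have "g \<in> Z" using assms by (simp add: forces_def)
  then show ?thesis by (simp add: Z_def)
qed

text \<open>The interval spanned by two consecutive edges contains no further edge if the chain is
  straight, and is a unit square if the chain turns.\<close>

lemma chain_square:
  assumes "tgt f = src e" "g \<noteq> e" "g \<noteq> f"
    and "tgt g = tgt e \<and> below (src f) (src g) \<or> src g = src f \<and> below (tgt g) (tgt e)"
  shows "\<exists>r c. {e, f} = Lp (r, c) \<and> g \<in> Up (r, c) \<or> {e, f} = Up (r, c) \<and> g \<in> Lp (r, c)"
proof (cases f)
  case f: (Ho r c)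
  show ?thesis
  proof (cases e)
    case e: (Ho r' c')
    have "r' = r" "c' = Suc c" using assms(1) by (simp_all add: e f)
    then have False using assms(2-4) by (cases g) (auto simp: e f below_def)
    then show ?thesis ..
  next
    case e: (Ve r' c')
    have rc: "r = Suc r'" "c' = Suc c" using assms(1) by (simp_all add: e f)
    have "g \<in> Lp (r', c)" using assms(2-4) by (cases g) (auto simp: e f rc below_def Lp_def)
    moreover have "{e, f} = Up (r', c)" by (auto simp: e f rc Up_def)
    ultimately show ?thesis by blast
  qed
next
  case f: (Ve r c)
  show ?thesis
  proof (cases e)
    case e: (Ho r' c')
    have rc: "r' = r" "c' = c" using assms(1) by (simp_all add: e f)
    have "g \<in> Up (r, c)" using assms(2-4) by (cases g) (auto simp: e f rc below_def Up_def)
    moreover have "{e, f} = Lp (r, c)" by (auto simp: e f rc Lp_def)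
    ultimately show ?thesis by blast
  next
    case e: (Ve r' c')
    have "r = Suc r'" "c' = c" using assms(1) by (simp_all add: e f)
    then have False using assms(2-4) by (cases g) (auto simp: e f below_def)
    then show ?thesis ..
  qed
qed

text \<open>By rank, one contracted edge identifies only its own two ends. Two of them act together
  on \<open>g\<close> only if they form a chain of length two that shares an end with
  \<open>g\<close>, which is the situation of \<open>chain_square\<close>.\<close>

lemma forces_square:
  assumes fo: "forces e f g"
  shows "\<exists>q\<in>D. {e, f} = Lp q \<and> g \<in> Up q \<or> {e, f} = Up q \<and> g \<in> Lp q"
proof -
  have ne: "e \<noteq> f" "g \<noteq> e" "g \<noteq> f" using fo by (auto simp: forces_def)
  have EE: "e \<in> E" "f \<in> E" "g \<in> E" using fo by (auto simp: forces_def)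
  have edge_eq: "a = b" if "src a = src b" "tgt a = tgt b" for a b
    using that by (cases a; cases b) auto
  have one: "a = b" if b: "below (tgt a) (tgt b)" "below (src b) (src a)" for a b
  proof (rule edge_eq)
    show "tgt a = tgt b" by (rule rank_below_eq[OF b(1)]) (use rank_below[OF b(2)] in simp)
    show "src a = src b" by (rule rank_below_eq[OF b(2), symmetric]) (use rank_below[OF b(1)] in simp)
  qed
  have two: "\<exists>r c. {a, b} = Lp (r, c) \<and> g \<in> Up (r, c) \<or> {a, b} = Up (r, c) \<and> g \<in> Lp (r, c)"
    if b: "below (tgt g) (tgt a)" "below (src a) (tgt b)" "below (src b) (src g)"
      and n: "g \<noteq> a" "g \<noteq> b" "a \<noteq> b" for a b
  proof -
    have r: "rank (src g) \<le> rank (src a)" "rank (src a) \<le> rank (src b) + 1" "rank (src b) \<le> rank (src g)"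
      using rank_below[OF b(1)] rank_below[OF b(2)] rank_below[OF b(3)] by auto
    show ?thesis
    proof (cases "rank (src a) = rank (src b)")
      case True
      then have *: "tgt g = tgt a" "src b = src g"
        using rank_below_eq[OF b(1)] rank_below_eq[OF b(3)] r by auto
      \<comment> \<open>Here \<open>a\<close> enters the head of \<open>g\<close> and
        \<open>b\<close> leaves its tail, both transversally and on opposite sides of
        \<open>g\<close>, so \<open>src a\<close> cannot be below \<open>tgt b\<close>.\<close>
      have False
      proof (cases g)
        case g: (Ho r c)
        obtain r' where "b = Ve r' c" using *(2) n(2) by (cases b) (auto simp: g)
        moreover have "a = Ve r (Suc c)" using *(1) n(1) by (cases a) (auto simp: g)
        ultimately show False using b(2) by (simp add: below_def)
      next
        case g: (Ve r c)
        have "b = Ho (Suc r) c" using *(2) n(2) by (cases b) (auto simp: g)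
        moreover obtain c' where "a = Ho r c'" using *(1) n(1) by (cases a) (auto simp: g)
        ultimately show False using b(2) by (simp add: below_def)
      qed
      then show ?thesis ..
    next
      case False
      then have e: "rank (src a) = rank (src b) + 1" using r by simp
      have *: "src a = tgt b" using rank_below_eq[OF b(2)] e by auto
      have "tgt g = tgt a \<or> src b = src g"
      proof (cases "rank (src g) = rank (src b)")
        case True
        then show ?thesis using rank_below_eq[OF b(3)] by auto
      next
        case False
        then show ?thesis using rank_below_eq[OF b(1)] e r by auto
      qed
      then have "tgt g = tgt a \<and> below (src b) (src g) \<or> src g = src b \<and> below (tgt g) (tgt a)"
        using b by auto
      then show ?thesis by (rule chain_square[OF *[symmetric] n(1,2)])
    qed
  qed
  have "contr e f (tgt g) (src g)" by (rule forces_contr[OF fo])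
  moreover have "\<not> below (tgt g) (src g)" using rank_below[of "tgt g" "src g"] by auto
  ultimately consider "below (tgt g) (tgt e)" "below (src e) (src g)"
    | "below (tgt g) (tgt f)" "below (src f) (src g)"
    | "below (tgt g) (tgt e)" "below (src e) (tgt f)" "below (src f) (src g)"
    | "below (tgt g) (tgt f)" "below (src f) (tgt e)" "below (src e) (src g)"
    unfolding contr_def by (elim disjE conjE) simp_all
  then have "\<exists>r c. {e, f} = Lp (r, c) \<and> g \<in> Up (r, c) \<or> {e, f} = Up (r, c) \<and> g \<in> Lp (r, c)"
  proof cases
    case 1
    then show ?thesis using one[of g e] ne by simp
  next
    case 2
    then show ?thesis using one[of g f] ne by simp
  next
    case 3
    show ?thesis by (rule two[OF 3 ne(2,3,1)])
  next
    case 4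
    show ?thesis using two[OF 4 ne(3,2) ne(1)[symmetric]] by (simp add: insert_commute)
  qed
  then obtain r c where rc: "{e, f} = Lp (r, c) \<and> g \<in> Up (r, c) \<or> {e, f} = Up (r, c) \<and> g \<in> Lp (r, c)"
    by blast
  then have "g \<in> Up (r, c) \<or> e \<in> Up (r, c)" by (metis insertI1)
  then have "Ho (Suc r) c \<in> E \<or> Ve r (Suc c) \<in> E" using EE by (auto simp: Up_def)
  then have "(r, c) \<in> D" by (auto simp: D_def Ho_in_E Ve_in_E)
  then show ?thesis using rc by blast
qed

text \<open>On \<open>Q\<close>, the values \<open>Bb c\<close> and \<open>Rb r\<close> are those of the largest mark below and the smallest
  mark above \<open>(r, c)\<close>; on a mark both are its own value.\<close>

definition Rb :: "nat \<Rightarrow> nat"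
  where "Rb r = Suc (card {l \<in> {1..m - 1}. r < t l})"

definition Bb :: "nat \<Rightarrow> nat"
  where "Bb c = Suc (card {l \<in> {1..m - 1}. s l \<le> c})"

lemma Rb_anti: "r \<le> r' \<Longrightarrow> Rb r' \<le> Rb r"
  unfolding Rb_def by (auto intro: card_mono)

lemma Bb_mono: "c \<le> c' \<Longrightarrow> Bb c \<le> Bb c'"
  unfolding Bb_def by (auto intro: card_mono)

lemma Rb_eq:
  assumes "1 \<le> k" "k \<le> m" "t k \<le> r" "r < t (k - 1)"
  shows "Rb r = k"
proof -
  have "r < t l \<longleftrightarrow> l < k" if "l \<in> {1..m - 1}" for l
  proof -
    have "l \<le> m" "k - 1 \<le> m" using that assms by auto
    then show ?thesis using assms t_le_iff[of l k] t_le_iff[of "k - 1" l] by auto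
  qed
  then have "{l \<in> {1..m - 1}. r < t l} = {1..k - 1}" using assms by auto
  then show ?thesis using assms by (simp add: Rb_def)
qed

lemma Bb_eq:
  assumes "1 \<le> k" "k \<le> m" "s (k - 1) \<le> c" "c < s k"
  shows "Bb c = k"
proof -
  have "s l \<le> c \<longleftrightarrow> l < k" if "l \<in> {1..m - 1}" for l
  proof -
    have "l \<le> m" "k - 1 \<le> m" using that assms by auto
    then show ?thesis using assms s_le_iff[of k l] s_le_iff[of l "k - 1"] by auto
  qed
  then have "{l \<in> {1..m - 1}. s l \<le> c} = {1..k - 1}" using assms by auto
  then show ?thesis using assms by (simp add: Bb_def)
qed

lemma Rb_mk: "1 \<le> k \<Longrightarrow> k \<le> m \<Longrightarrow> Rb (t k) = k"
  using t_less_iff[of k "k - 1"] by (intro Rb_eq) auto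

lemma Bb_mk: "1 \<le> k \<Longrightarrow> k \<le> m \<Longrightarrow> Bb (s (k - 1)) = k"
  using s_less_iff[of "k - 1" k] by (intro Bb_eq) auto

text \<open>Both counted index sets are initial segments, so one is strictly larger exactly if it
  has an index outside the other, and such an index is a witness for \<open>Q\<close>.\<close>

lemma Q_iff: "(r, c) \<in> Q \<longleftrightarrow> Bb c < Rb r"
proof
  assume "(r, c) \<in> Q"
  then obtain k where k: "k \<in> {1..m - 1}" "r < t k" "c < s k" by (auto simp: Q_def)
  have "r < t l" if "l \<in> {1..m - 1}" and l: "s l \<le> c" for l
  proof -
    have "l \<le> m" "k \<le> m" using that k by auto
    then have "l < k" "t k \<le> t l \<longleftrightarrow> l \<le> k" using k l s_le_iff[of k l] t_le_iff[of k l] by auto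
    then show "r < t l" using k by auto
  qed
  then have "{l \<in> {1..m - 1}. s l \<le> c} \<subseteq> {l \<in> {1..m - 1}. r < t l}" by blast
  moreover have "k \<in> {l \<in> {1..m - 1}. r < t l} - {l \<in> {1..m - 1}. s l \<le> c}" using k by simp
  ultimately have "{l \<in> {1..m - 1}. s l \<le> c} \<subset> {l \<in> {1..m - 1}. r < t l}" by blast
  then have "card {l \<in> {1..m - 1}. s l \<le> c} < card {l \<in> {1..m - 1}. r < t l}"
    by (intro psubset_card_mono) auto
  then show "Bb c < Rb r" by (simp add: Bb_def Rb_def)
next
  assume lt: "Bb c < Rb r"
  show "(r, c) \<in> Q"
  proof (rule ccontr)
    assume "(r, c) \<notin> Q"
    then have "{l \<in> {1..m - 1}. r < t l} \<subseteq> {l \<in> {1..m - 1}. s l \<le> c}"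
      by (force simp: Q_def not_less)
    then have "card {l \<in> {1..m - 1}. r < t l} \<le> card {l \<in> {1..m - 1}. s l \<le> c}"
      by (intro card_mono) auto
    then show False using lt by (simp add: Bb_def Rb_def)
  qed
qed

lemma H_Bb_le_Rb: "(r, c) \<in> H \<Longrightarrow> Bb c \<le> Rb r"
proof -
  assume "(r, c) \<in> H"
  then consider "(r, c) \<in> Q" | k where "k \<in> {1..m}" "(r, c) = mk k" by (auto simp: H_def)
  then show ?thesis
  proof cases
    case 1
    then show ?thesis by (simp add: Q_iff)
  next
    case 2
    then show ?thesis using Rb_mk[of k] Bb_mk[of k] by (simp add: mk_def)
  qed
qed

text \<open>The source of all explicit test points: row \<open>r\<close> is raised to the threshold
  \<open>w r\<close> wherever the column bound is smaller. Horizontal edges become tight once the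
  threshold reaches the column bound, vertical ones where the threshold is constant or hidden by the
  column bound.\<close>

definition rowpt :: "(nat \<Rightarrow> nat) \<Rightarrow> nat \<times> nat \<Rightarrow> real"
  where "rowpt w = (\<lambda>(r, c). real (max (Bb c) (w r)))"

lemma rowpt_pts:
  assumes w: "antimono w" "\<And>r. w r \<le> Rb r"
  shows "rowpt w \<in> pts"
proof -
  have "rowpt w (mk k) = real k" if "k \<in> {1..m}" for k
    using w(2)[of "t k"] Rb_mk[of k] Bb_mk[of k] that by (simp add: rowpt_def mk_def)
  moreover have "rowpt w (src e) \<le> rowpt w (tgt e)" for e
  proof (cases e)
    case (Ho r c)
    then show ?thesis using Bb_mono[of c "Suc c"] by (auto simp: rowpt_def)
  next
    case (Ve r c)
    then show ?thesis using antimonoD[OF w(1), of r "Suc r"] by (auto simp: rowpt_def)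
  qed
  ultimately show ?thesis by (simp add: pts_def)
qed

lemma rowpt_Ts: "antimono w \<Longrightarrow> (\<And>r. w r \<le> Rb r) \<Longrightarrow> tt (rowpt w) \<in> Ts"
  unfolding Ts_def using rowpt_pts by blast

lemma rowpt_Ho: "Ho r c \<in> E \<Longrightarrow> Bb (Suc c) \<le> w r \<Longrightarrow> Ho r c \<in> tt (rowpt w)"
  using Bb_mono[of c "Suc c"] by (simp add: tt_def rowpt_def max_def)

lemma rowpt_Ho_Rb: "Ho r c \<in> E \<Longrightarrow> w r = Rb r \<Longrightarrow> Ho r c \<in> tt (rowpt w)"
  using H_Bb_le_Rb[of r "Suc c"] by (simp add: rowpt_Ho Ho_in_E)

lemma rowpt_Ho_Q: "(r, Suc c) \<in> Q \<Longrightarrow> Rb r \<le> Suc (w r) \<Longrightarrow> Ho r c \<in> tt (rowpt w)"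
  using Q_iff[of r "Suc c"] by (intro rowpt_Ho) (auto simp: Ho_in_E H_def)

lemma rowpt_Ve: "Ve r c \<in> E \<Longrightarrow> w (Suc r) = w r \<or> w r \<le> Bb c \<and> w (Suc r) \<le> w r \<Longrightarrow> Ve r c \<in> tt (rowpt w)"
  by (auto simp: tt_def rowpt_def max_def)

lemma Lp_D: "q \<in> D \<Longrightarrow> Lp q \<subseteq> E" and Up_D: "q \<in> D \<Longrightarrow> Up q \<subseteq> E"
  using H_down by (auto simp: D_def Lp_def Up_def Ho_in_E Ve_in_E)

lemma Lp_unique: "e \<in> Lp q \<Longrightarrow> e \<in> Lp q' \<Longrightarrow> q = q'"
  by (cases q; cases q') (auto simp: Lp_def)

lemma Up_unique: "e \<in> Up q \<Longrightarrow> e \<in> Up q' \<Longrightarrow> q = q'"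
  by (cases q; cases q') (auto simp: Up_def)

lemma Lp_ex: "\<exists>e. e \<in> Lp q" and Up_ex: "\<exists>e. e \<in> Up q"
  by (cases q; auto simp: Lp_def Up_def)+

lemma Lp_ne_Up: "Lp q \<noteq> Up q'"
proof
  assume eq: "Lp q = Up q'"
  obtain r c where q: "q = (r, c)" by (cases q)
  have "Ho r c \<in> Up q'" "Ve r c \<in> Up q'" using eq[symmetric] by (simp_all add: q Lp_def)
  then show False by (cases q') (auto simp: Up_def)
qed

lemma square_point:
  assumes q: "q \<in> D"
  shows "\<exists>S\<in>Ts. Lp q \<union> Up q \<subseteq> S"
proof -
  obtain r c where rc: "q = (r, c)" "(Suc r, Suc c) \<in> H" using q by (auto simp: D_def)
  \<comment> \<open>Capping at the bound of row \<open>Suc r\<close> gives all four corners of the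
    square this one value.\<close>
  define w where "w i = min (Rb i) (Rb (Suc r))" for i
  have w: "w r = Rb (Suc r)" "w (Suc r) = Rb (Suc r)"
    using Rb_anti[of r "Suc r"] by (auto simp: w_def)
  have "tt (rowpt w) \<in> Ts"
    by (rule rowpt_Ts) (auto simp: w_def antimono_def intro: Rb_anti min.coboundedI1)
  moreover have "Lp q \<union> Up q \<subseteq> tt (rowpt w)"
    using Lp_D[OF q] Up_D[OF q] H_Bb_le_Rb[OF rc(2)] w
    by (auto simp: Lp_def Up_def rc intro: rowpt_Ho rowpt_Ve)
  ultimately show ?thesis by blast
qed

text \<open>Both chains join \<open>(Suc r, c)\<close> to \<open>(r, Suc c)\<close>, so either is
  tight exactly if these two values agree.\<close>

lemma square_closed:
  assumes q: "q \<in> D" and S: "S \<in> Ts"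
  shows "Lp q \<subseteq> S \<longleftrightarrow> Up q \<subseteq> S"
proof -
  obtain r c where rc: "q = (r, c)" by (cases q)
  obtain f where f: "f \<in> pts" "S = tt f" using S by (auto simp: Ts_def)
  have E: "Ve r c \<in> E" "Ho r c \<in> E" "Ho (Suc r) c \<in> E" "Ve r (Suc c) \<in> E"
    using Lp_D[OF q] Up_D[OF q] by (auto simp: Lp_def Up_def rc)
  then have "f (Suc r, c) \<le> f (r, c)" "f (r, c) \<le> f (r, Suc c)"
    "f (Suc r, c) \<le> f (Suc r, Suc c)" "f (Suc r, Suc c) \<le> f (r, Suc c)"
    using f(1) unfolding pts_def by force+
  then show ?thesis using E by (auto simp: Lp_def Up_def rc f tt_def)
qed

lemma forces_squareI:
  assumes q: "q \<in> D" and ef: "{e, f} = Lp q \<and> g \<in> Up q \<or> {e, f} = Up q \<and> g \<in> Lp q"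
    and ne: "e \<noteq> f"
  shows "forces e f g"
proof -
  obtain r c where rc: "q = (r, c)" by (cases q)
  have dis: "Lp q \<inter> Up q = {}" by (auto simp: Lp_def Up_def rc)
  have in_sq: "e \<in> Lp q \<union> Up q" "f \<in> Lp q \<union> Up q" "g \<in> Lp q \<union> Up q" using ef by blast+
  have "g \<noteq> e" "g \<noteq> f" using ef dis by blast+
  moreover have "e \<in> E" "f \<in> E" "g \<in> E" using in_sq Lp_D[OF q] Up_D[OF q] by blast+
  moreover have "\<exists>S\<in>Ts. e \<in> S \<and> f \<in> S" using square_point[OF q] in_sq by blast
  moreover have "g \<in> S" if "S \<in> Ts" "e \<in> S" "f \<in> S" for S
  proof -
    have "{e, f} \<subseteq> S" using that by simp
    then have "Lp q \<subseteq> S \<and> Up q \<subseteq> S" using ef square_closed[OF q that(1)] by metis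
    then show ?thesis using in_sq by blast
  qed
  ultimately show ?thesis using ne by (simp add: forces_def)
qed

section \<open>Automorphisms of the family of tight sets\<close>

definition AutT :: "(edge \<Rightarrow> edge) set"
  where "AutT = {\<pi>. \<pi> permutes E \<and> (`) \<pi> ` Ts = Ts}"

lemma Ts_sub: "S \<in> Ts \<Longrightarrow> S \<subseteq> E"
  by (auto simp: Ts_def tt_def)

text \<open>\<open>Ts\<close> is finite and the image map is injective, so mapping \<open>Ts\<close>
  into itself is enough.\<close>

lemma AutT_I:
  assumes p: "\<pi> permutes E" and S: "\<And>S. S \<in> Ts \<Longrightarrow> \<pi> ` S \<in> Ts"
  shows "\<pi> \<in> AutT"
proof -
  have "finite Ts" by (rule finite_subset[of _ "Pow E"]) (use Ts_sub finite_E in auto)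
  moreover have "(`) \<pi> ` Ts \<subseteq> Ts" using S by auto
  moreover have "inj_on ((`) \<pi>) Ts"
    by (rule inj_onI) (simp add: inj_image_eq_iff[OF permutes_inj[OF p]])
  ultimately have "(`) \<pi> ` Ts = Ts" by (simp add: endo_inj_surj)
  then show ?thesis using p by (simp add: AutT_def)
qed

lemma AutT_Ts: "\<pi> \<in> AutT \<Longrightarrow> S \<in> Ts \<Longrightarrow> \<pi> ` S \<in> Ts"
  by (auto simp: AutT_def)

lemma AutT_preimage:
  assumes "\<pi> \<in> AutT" "S \<in> Ts"
  obtains S' where "S' \<in> Ts" "S = \<pi> ` S'"
proof -
  have "S \<in> (`) \<pi> ` Ts" using assms by (simp add: AutT_def)
  then show thesis using that by (elim imageE)
qed

lemma AutT_permutes: "\<pi> \<in> AutT \<Longrightarrow> \<pi> permutes E"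
  by (simp add: AutT_def)

lemma AutT_inj: "\<pi> \<in> AutT \<Longrightarrow> inj \<pi>"
  using AutT_permutes permutes_inj by blast

lemma AutT_E: "\<pi> \<in> AutT \<Longrightarrow> \<pi> e \<in> E \<longleftrightarrow> e \<in> E"
  using AutT_permutes permutes_in_image by metis

lemma AutT_comp: "\<pi> \<in> AutT \<Longrightarrow> \<pi>' \<in> AutT \<Longrightarrow> \<pi> \<circ> \<pi>' \<in> AutT"
  by (rule AutT_I) (simp_all only: AutT_permutes permutes_compose AutT_Ts image_comp[symmetric])

lemma AutT_inv:
  assumes "\<pi> \<in> AutT"
  shows "inv_into UNIV \<pi> \<in> AutT"
proof (rule AutT_I)
  show "inv_into UNIV \<pi> permutes E" using AutT_permutes[OF assms] by (rule permutes_inv)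
  fix S assume "S \<in> Ts"
  then obtain S' where "S' \<in> Ts" "S = \<pi> ` S'" by (rule AutT_preimage[OF assms])
  then show "inv_into UNIV \<pi> ` S \<in> Ts" using AutT_inj[OF assms] by (simp add: image_inv_f_f)
qed

lemma AutT_forces:
  assumes p: "\<pi> \<in> AutT" and f: "forces e f g"
  shows "forces (\<pi> e) (\<pi> f) (\<pi> g)"
proof -
  have inj: "\<pi> x = \<pi> y \<longleftrightarrow> x = y" for x y using AutT_inj[OF p] by (simp add: inj_eq)
  obtain S where "S \<in> Ts" "e \<in> S" "f \<in> S" using f by (auto simp: forces_def)
  then have "\<exists>S\<in>Ts. \<pi> e \<in> S \<and> \<pi> f \<in> S" by (intro bexI[OF _ AutT_Ts[OF p]]) auto
  moreover have "\<pi> g \<in> S" if S: "S \<in> Ts" "\<pi> e \<in> S" "\<pi> f \<in> S" for S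
  proof -
    obtain S' where S': "S' \<in> Ts" "S = \<pi> ` S'" by (rule AutT_preimage[OF p S(1)])
    then have "e \<in> S'" "f \<in> S'" using S inj by auto
    then have "g \<in> S'" using f S' by (simp add: forces_def)
    then show ?thesis using S' by simp
  qed
  ultimately show ?thesis using f inj AutT_E[OF p] by (simp add: forces_def)
qed

lemma card_Lp: "x \<in> Lp q \<Longrightarrow> y \<in> Lp q \<Longrightarrow> x \<noteq> y \<Longrightarrow> Lp q = {x, y}"
  and card_Up: "x \<in> Up q \<Longrightarrow> y \<in> Up q \<Longrightarrow> x \<noteq> y \<Longrightarrow> Up q = {x, y}"
  by (cases q; auto simp: Lp_def Up_def)+

text \<open>A chain determines its square and its type, so both edges forced by the image of one
  chain land in the opposite chain of the same square.\<close>

lemma AutT_square: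
  assumes p: "\<pi> \<in> AutT" and q: "q \<in> D"
  shows "\<exists>q'\<in>D. \<pi> ` Lp q = Lp q' \<and> \<pi> ` Up q = Up q' \<or> \<pi> ` Lp q = Up q' \<and> \<pi> ` Up q = Lp q'"
proof -
  obtain r c where rc: "q = (r, c)" by (cases q)
  define a b g h where "a = Ve r c" and "b = Ho r c" and "g = Ho (Suc r) c" and "h = Ve r (Suc c)"
  have LU: "Lp q = {a, b}" "Up q = {g, h}" by (auto simp: a_def b_def g_def h_def Lp_def Up_def rc)
  have ne: "\<pi> g \<noteq> \<pi> h" "a \<noteq> b"
    using AutT_inj[OF p] by (simp_all add: inj_eq g_def h_def a_def b_def)
  have fo: "forces (\<pi> a) (\<pi> b) (\<pi> g)" "forces (\<pi> a) (\<pi> b) (\<pi> h)"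
    by (rule AutT_forces[OF p forces_squareI[OF q _ ne(2)]]; simp add: LU)+
  obtain q1 where q1: "q1 \<in> D" "{\<pi> a, \<pi> b} = Lp q1 \<and> \<pi> g \<in> Up q1 \<or> {\<pi> a, \<pi> b} = Up q1 \<and> \<pi> g \<in> Lp q1"
    using forces_square[OF fo(1)] by (elim bexE)
  obtain q2 where q2: "q2 \<in> D" "{\<pi> a, \<pi> b} = Lp q2 \<and> \<pi> h \<in> Up q2 \<or> {\<pi> a, \<pi> b} = Up q2 \<and> \<pi> h \<in> Lp q2"
    using forces_square[OF fo(2)] by (elim bexE)
  have img: "\<pi> ` Lp q = {\<pi> a, \<pi> b}" "\<pi> ` Up q = {\<pi> g, \<pi> h}" by (simp_all add: LU)
  from q1(2) show ?thesis
  proof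
    assume 1: "{\<pi> a, \<pi> b} = Lp q1 \<and> \<pi> g \<in> Up q1"
    then have 2: "Lp q2 = Lp q1 \<and> \<pi> h \<in> Up q2" using q2(2) Lp_ne_Up by metis
    then have "q2 = q1" using Lp_ex Lp_unique by metis
    then have "Up q1 = {\<pi> g, \<pi> h}" using 1 2 ne card_Up by simp
    then have "\<pi> ` Lp q = Lp q1 \<and> \<pi> ` Up q = Up q1" using 1 img by simp
    then show ?thesis by (intro bexI[OF _ q1(1)] disjI1)
  next
    assume 1: "{\<pi> a, \<pi> b} = Up q1 \<and> \<pi> g \<in> Lp q1"
    then have 2: "Up q2 = Up q1 \<and> \<pi> h \<in> Lp q2" using q2(2) Lp_ne_Up by metis
    then have "q2 = q1" using Up_ex Up_unique by metis
    then have "Lp q1 = {\<pi> g, \<pi> h}" using 1 2 ne card_Lp by simp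
    then have "\<pi> ` Lp q = Up q1 \<and> \<pi> ` Up q = Lp q1" using 1 img by simp
    then show ?thesis by (intro bexI[OF _ q1(1)] disjI2)
  qed
qed

end

section \<open>Outer corners and exchanges of edges\<close>

definition swp :: "'a \<Rightarrow> 'a \<Rightarrow> 'a \<Rightarrow> 'a"
  where "swp e f x = (if x = e then f else if x = f then e else x)"

text \<open>Induction on \<open>r + c\<close>. A cell off the axes is determined by its two lower
  covers. A cell on an axis has one lower cover, which leaves the next cell on the axis and its
  neighbour off the axis; the latter has a second lower cover, whose preimage would be a second
  lower cover too. Only the two atoms can be exchanged, which the assumptions exclude.\<close>

lemma order_ideal_id:
  fixes A B :: "(nat \<times> nat) set"
  assumes downA: "\<And>r c r' c'. (r, c) \<in> A \<Longrightarrow> r' \<le> r \<Longrightarrow> c' \<le> c \<Longrightarrow> (r', c') \<in> A"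
    and downB: "\<And>r c r' c'. (r, c) \<in> B \<Longrightarrow> r' \<le> r \<Longrightarrow> c' \<le> c \<Longrightarrow> (r', c') \<in> B"
    and bij: "bij_betw \<sigma> A B"
    and cov: "\<And>p q. p \<in> A \<Longrightarrow> q \<in> A \<Longrightarrow>
      (\<sigma> q = (Suc (fst (\<sigma> p)), snd (\<sigma> p)) \<or> \<sigma> q = (fst (\<sigma> p), Suc (snd (\<sigma> p)))) \<longleftrightarrow>
      (q = (Suc (fst p), snd p) \<or> q = (fst p, Suc (snd p)))"
    and one: "(1, 0) \<in> A \<Longrightarrow> \<sigma> (1, 0) = (1, 0)" and one': "(0, 1) \<in> A \<Longrightarrow> \<sigma> (0, 1) = (0, 1)"
    and p: "p \<in> A"
  shows "\<sigma> p = p"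
proof -
  have inj: "\<sigma> x = \<sigma> y \<longleftrightarrow> x = y" if "x \<in> A" "y \<in> A" for x y
    using bij that by (auto simp: bij_betw_def inj_on_def)
  have into: "\<sigma> x \<in> B" if "x \<in> A" for x using bij that by (auto simp: bij_betw_def)
  have onto: "\<exists>x\<in>A. \<sigma> x = y" if "y \<in> B" for y
  proof -
    have "y \<in> \<sigma> ` A" using bij that by (simp add: bij_betw_def)
    then show ?thesis by auto
  qed
  have "(r, c) \<in> A \<longrightarrow> \<sigma> (r, c) = (r, c)" for r c
  proof (induction "r + c" arbitrary: r c rule: less_induct)
    case less
    show ?case
    proof
      assume rc: "(r, c) \<in> A"
      obtain r' c' where s: "\<sigma> (r, c) = (r', c')" by (cases "\<sigma> (r, c)")
      show "\<sigma> (r, c) = (r, c)"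
      proof (cases "r = 0")
        case r: True
        show ?thesis
        proof (cases "c = 0")
          case c: True
          have "r' = 0 \<and> c' = 0"
          proof (rule ccontr)
            assume n: "\<not> (r' = 0 \<and> c' = 0)"
            \<comment> \<open>A cell covered by the image of \<open>(0, 0)\<close>; its preimage
              would have to be covered by \<open>(0, 0)\<close>.\<close>
            define y where "y = (if r' = 0 then (r', c' - 1) else (r' - 1, c'))"
            have "(r', c') \<in> B" using into[OF rc] s by simp
            then have "y \<in> B" using downB[of r' c'] by (auto simp: y_def)
            then obtain x where x: "x \<in> A" "\<sigma> x = y" using onto by blast
            have "(0, 0) = (Suc (fst x), snd x) \<or> (0, 0) = (fst x, Suc (snd x))"
              using cov[OF x(1) rc] x(2) s n unfolding r c by (auto simp: y_def split: if_splits)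
            then show False by simp
          qed
          then show ?thesis using s r c by simp
        next
          case False
          then obtain d where c: "c = Suc d" by (cases c) auto
          show ?thesis
          proof (cases d)
            case 0
            then show ?thesis using one' rc r c by simp
          next
            case (Suc d')
            have p: "(0, d) \<in> A" using downA[OF rc] r c by simp
            have fp: "\<sigma> (0, d) = (0, d)" using less[of 0 d] p r c by simp
            have "(r', c') = (1, d) \<or> (r', c') = (0, Suc d)" using cov[OF p rc] fp s r c by simp
            moreover have "(r', c') \<noteq> (1, d)"
            proof
              assume e: "(r', c') = (1, d)"
              have "(1, d') \<in> B" using into[OF rc] downB[of 1 d 1 d'] s e Suc by auto
              then obtain x where x: "x \<in> A" "\<sigma> x = (1, d')" using onto by blast
              have "x = (0, d)" using cov[OF x(1) rc] x(2) s e r c Suc by (auto simp: prod_eq_iff)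
              then show False using fp x Suc by simp
            qed
            ultimately show ?thesis using s r c by auto
          qed
        qed
      next
        case False
        then obtain d where r: "r = Suc d" by (cases r) auto
        have p: "(d, c) \<in> A" using downA[OF rc] r by simp
        have fp: "\<sigma> (d, c) = (d, c)" using less[of d c] p r by simp
        show ?thesis
        proof (cases c)
          case c: 0
          show ?thesis
          proof (cases d)
            case 0
            then show ?thesis using one rc r c by simp
          next
            case (Suc d')
            have "(r', c') = (Suc d, 0) \<or> (r', c') = (d, 1)" using cov[OF p rc] fp s r c by simp
            moreover have "(r', c') \<noteq> (d, 1)"
            proof
              assume e: "(r', c') = (d, 1)"
              have "(d', 1) \<in> B" using into[OF rc] downB[of d 1 d' 1] s e Suc by auto
              then obtain x where x: "x \<in> A" "\<sigma> x = (d', 1)" using onto by blast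
              have "x = (d, 0)" using cov[OF x(1) rc] x(2) s e r c Suc by (auto simp: prod_eq_iff)
              then show False using fp x Suc c by simp
            qed
            ultimately show ?thesis using s r c by auto
          qed
        next
          case c: (Suc e)
          have p': "(r, e) \<in> A" using downA[OF rc] c by simp
          have fp': "\<sigma> (r, e) = (r, e)" using less[of r e] p' c by simp
          show ?thesis using cov[OF p rc] cov[OF p' rc] fp fp' s r c by auto
        qed
      qed
    qed
  qed
  then show ?thesis using p by (cases p) auto
qed

context shape begin

text \<open>A function whose differences are the permuted differences of \<open>f\<close> is
  automatically monotone, and its tight set is the image of \<open>tt f\<close>. Symmetries can thus
  be given by affine formulas.\<close>

lemma AutT_gapI:
  assumes p: "\<pi> permutes E"
    and f: "\<And>f. f \<in> pts \<Longrightarrow> \<exists>f'. (\<forall>k\<in>{1..m}. f' (mk k) = real k) \<and>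
      (\<forall>e\<in>E. f' (tgt (\<pi> e)) - f' (src (\<pi> e)) = f (tgt e) - f (src e))"
  shows "\<pi> \<in> AutT"
proof (rule AutT_I[OF p])
  fix S assume "S \<in> Ts"
  then obtain f where f1: "f \<in> pts" "S = tt f" by (auto simp: Ts_def)
  obtain f' where f': "\<forall>k\<in>{1..m}. f' (mk k) = real k"
    "\<And>e. e \<in> E \<Longrightarrow> f' (tgt (\<pi> e)) - f' (src (\<pi> e)) = f (tgt e) - f (src e)"
    using f[OF f1(1)] by blast
  have ex: "\<exists>e'\<in>E. e = \<pi> e'" if "e \<in> E" for e
  proof -
    have "e \<in> \<pi> ` E" using that permutes_image[OF p] by simp
    then show ?thesis by auto
  qed
  have E: "\<pi> e \<in> E" if "e \<in> E" for e using that p by (simp add: permutes_in_image)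
  have "f' (src e) \<le> f' (tgt e)" if e: "e \<in> E" for e
  proof -
    obtain e' where e': "e' \<in> E" "e = \<pi> e'" using ex[OF e] by blast
    have "f (src e') \<le> f (tgt e')" using f1(1) e'(1) by (simp add: pts_def)
    then show ?thesis using f'(2)[OF e'(1)] e'(2) by simp
  qed
  then have "f' \<in> pts" using f'(1) by (simp add: pts_def)
  moreover have "tt f' = \<pi> ` tt f"
  proof
    show "\<pi> ` tt f \<subseteq> tt f'"
    proof
      fix x assume "x \<in> \<pi> ` tt f"
      then obtain e where e: "e \<in> E" "x = \<pi> e" "f (src e) = f (tgt e)" by (auto simp: tt_def)
      then show "x \<in> tt f'" using f'(2)[OF e(1)] E by (simp add: tt_def)
    qed
    show "tt f' \<subseteq> \<pi> ` tt f"
    proof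
      fix x assume x: "x \<in> tt f'"
      then have "x \<in> E" by (simp add: tt_def)
      then obtain e where e: "e \<in> E" "x = \<pi> e" using ex by blast
      then have "e \<in> tt f" using f'(2)[OF e(1)] x by (simp add: tt_def)
      then show "x \<in> \<pi> ` tt f" using e by simp
    qed
  qed
  ultimately show "\<pi> ` S \<in> Ts" unfolding f1(2) Ts_def by (metis imageI)
qed

lemma swp_conj:
  assumes p: "\<pi> \<in> AutT" and s: "swp e f \<in> AutT"
  shows "swp (\<pi> e) (\<pi> f) \<in> AutT"
proof -
  have inj: "inj \<pi>" by (rule AutT_inj[OF p])
  have "surj \<pi>" using AutT_permutes[OF p] by (rule permutes_surj)
  have "swp (\<pi> e) (\<pi> f) x = (\<pi> \<circ> (swp e f \<circ> inv_into UNIV \<pi>)) x" for x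
  proof -
    obtain y where y: "x = \<pi> y" using \<open>surj \<pi>\<close> by (auto simp: surj_def)
    show ?thesis using inj by (simp add: y swp_def inj_eq)
  qed
  then have "swp (\<pi> e) (\<pi> f) = \<pi> \<circ> (swp e f \<circ> inv_into UNIV \<pi>)" by (rule ext)
  then show ?thesis using AutT_comp[OF p AutT_comp[OF s AutT_inv[OF p]]] by simp
qed

text \<open>The indices of outer corners of \<open>Q\<close> that stay outer corners of
  \<open>H\<close>: if the first difference were 1, the cell below the corner would be
  \<open>mk k\<close>, and if the second were 1, the cell to its right would be
  \<open>mk (Suc k)\<close>.\<close>

definition Kset :: "nat set"
  where "Kset = {k \<in> {1..m - 1}. s (k - 1) + 2 \<le> s k \<and> s k + 2 \<le> s (Suc k)}"

definition ck :: "nat \<Rightarrow> nat \<times> nat"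
  where "ck k = (t k - 1, s k - 1)"

definition cells :: "(nat \<times> nat) set"
  where "cells = insert (0, 0) (ck ` Kset)"

lemma t_pos: "k < m \<Longrightarrow> 0 < t k"
  using t_less_iff[of m k] by simp

lemma s_pos: "0 < k \<Longrightarrow> k \<le> m \<Longrightarrow> 0 < s k"
  using s_less_iff[of 0 k] by simp

lemma t_Suc: "k < m \<Longrightarrow> t k - t (Suc k) = s (Suc k) - s k"
  using s_plus_t[of k] s_plus_t[of "Suc k"] s_less_iff[of k "Suc k"] by simp

lemma outer_corner:
  assumes "(r, c) \<in> Q" "(Suc r, c) \<notin> H" "(r, Suc c) \<notin> H"
  shows "\<exists>k\<in>Kset. (r, c) = ck k"
proof -
  obtain k where k: "k \<in> {1..m - 1}" "r < t k" "c < s k" using assms by (auto simp: Q_def)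
  have nQ: "(Suc r, c) \<notin> Q" "(r, Suc c) \<notin> Q" using assms by (auto simp: H_def)
  have "\<not> Suc r < t k" "\<not> Suc c < s k" using nQ k unfolding Q_def by blast+
  then have rc: "Suc r = t k" "Suc c = s k" using k by auto
  have less: "s (k - 1) < s k" "s k < s (Suc k)" using k s_less[of "k - 1" k] s_Suc[of k] by auto
  have "s (k - 1) + 2 \<le> s k"
  proof (rule ccontr)
    assume "\<not> ?thesis"
    then have "(Suc r, c) = mk k" using less rc by (auto simp: mk_def)
    then show False using assms(2) mk_in_H[of k] k by auto
  qed
  moreover have "s k + 2 \<le> s (Suc k)"
  proof (rule ccontr)
    assume "\<not> ?thesis"
    then have "t k - t (Suc k) = 1" using less t_Suc[of k] k by auto
    then have "(r, Suc c) = mk (Suc k)" using rc by (auto simp: mk_def)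
    then show False using assms(3) mk_in_H[of "Suc k"] k by auto
  qed
  ultimately have "k \<in> Kset" using k by (simp add: Kset_def)
  moreover have "(r, c) = ck k" using rc by (auto simp: ck_def)
  ultimately show ?thesis by blast
qed

lemma ckD:
  assumes k: "k \<in> Kset" and rc: "ck k = (r, c)"
  shows "(r, c) \<in> Q" "(Suc r, c) \<notin> H" "(r, Suc c) \<notin> H" "0 < r" "0 < c" "Suc r = t k" "Suc c = s k"
proof -
  have k': "k \<in> {1..m - 1}" "s (k - 1) + 2 \<le> s k" "s k + 2 \<le> s (Suc k)" using k by (auto simp: Kset_def)
  have km: "0 < k" "k < m" using k' by auto
  have tt: "t (Suc k) + 2 \<le> t k" using t_Suc[of k] k' km by simp
  have eq: "Suc r = t k" "Suc c = s k" using rc t_pos[of k] s_pos[of k] km by (auto simp: ck_def)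
  then show "Suc r = t k" "Suc c = s k" by auto
  show "0 < r" "0 < c" using eq tt k' by auto
  show "(r, c) \<in> Q" using eq k' unfolding Q_def by (auto intro!: bexI[of _ k])
  have no: "(t k, c) \<notin> H"
  proof
    assume "(t k, c) \<in> H"
    then consider l where "l \<in> {1..m - 1}" "t k < t l" "c < s l" | l where "l \<in> {1..m}" "(t k, c) = mk l"
      by (auto simp: H_def Q_def)
    then show False
    proof cases
      case 1
      then have "l \<le> m" by auto
      then have "l < k" "k \<le> l" using 1 t_less_iff[of k l] s_le_iff[of k l] km eq by auto
      then show False by simp
    next
      case 2
      then have "l = k" using t_eq_iff[of k l] km by (auto simp: mk_def)
      then show False using 2 k' eq by (auto simp: mk_def)
    qed
  qed
  then show "(Suc r, c) \<notin> H" by (simp add: eq)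
  have "(r, s k) \<notin> H"
  proof
    assume "(r, s k) \<in> H"
    then consider l where "l \<in> {1..m - 1}" "r < t l" "s k < s l" | l where "l \<in> {1..m}" "(r, s k) = mk l"
      by (auto simp: H_def Q_def)
    then show False
    proof cases
      case 1
      then have "l \<le> m" by auto
      then have "k < l" "l \<le> k" using 1 t_le_iff[of k l] s_less_iff[of k l] km eq by auto
      then show False by simp
    next
      case 2
      then have "k = l - 1" using s_eq_iff[of k "l - 1"] km by (auto simp: mk_def)
      then have "r = t (Suc k)" using 2 by (auto simp: mk_def)
      then show False using tt eq by simp
    qed
  qed
  then show "(r, Suc c) \<notin> H" by (simp add: eq)
qed

lemma ck_inj: "inj_on ck Kset"
proof (rule inj_onI)
  fix k l assume kl: "k \<in> Kset" "l \<in> Kset" "ck k = ck l"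
  obtain r c where rc: "ck k = (r, c)" by (cases "ck k")
  have "s k = s l" using ckD(7)[OF kl(1) rc] ckD(7)[OF kl(2), of r c] rc kl(3) by simp
  moreover have "k \<le> m" "l \<le> m" using kl by (auto simp: Kset_def)
  ultimately show "k = l" by (simp add: s_eq_iff)
qed

lemma cells_cases:
  assumes "p \<in> cells"
  obtains "p = (0, 0)"
  | r c where "p = (r, c)" "(r, c) \<in> Q" "(Suc r, c) \<notin> H" "(r, Suc c) \<notin> H" "0 < r" "0 < c"
proof -
  consider "p = (0, 0)" | k where "k \<in> Kset" "p = ck k" using assms by (auto simp: cells_def)
  then show thesis
  proof cases
    case 2
    then show thesis using ckD[of k "fst p" "snd p"] that(2)[of "fst p" "snd p"] by auto
  qed (rule that(1))
qed

text \<open>If \<open>s 1 \<ge> 2\<close>, the first rectangle contains the cell since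
  \<open>t 1 > t 2 > 0\<close>. If \<open>s 1 = 1\<close>, the inner mark \<open>mk 2\<close> lies
  in column 1 and not in row 0. Both use \<open>m \<ge> 3\<close>.\<close>

lemma H_11: "(1, 1) \<in> H"
proof (cases "2 \<le> s 1")
  case True
  have "1 < t 1" using t_less_iff[of 2 1] t_pos[of 2] m3 by simp
  moreover have "1 \<in> {1..m - 1}" using m3 by auto
  ultimately have "(1, 1) \<in> Q" using True unfolding Q_def by (auto intro!: bexI[of _ 1])
  then show ?thesis by (simp add: H_def)
next
  case False
  then have s1: "s 1 = 1" using s_pos[of 1] m3 by simp
  have "1 \<le> t 2" using t_pos[of 2] m3 by simp
  moreover have "mk 2 = (t 2, 1)" using s1 by (simp add: mk_def)
  ultimately show ?thesis using H_down[of "t 2" 1 1 1] mk_in_H[of 2] m3 by auto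
qed

lemma D_00: "(0, 0) \<in> D"
  using H_11 by (simp add: D_def)

text \<open>An outer corner is entered by its \<open>Ho\<close> edge and left by its
  \<open>Ve\<close> edge, the cell \<open>(0, 0)\<close> the other way round. Handling a set of
  cells at once turns composition into symmetric difference (\<open>flip_flip\<close>).\<close>

definition flip :: "(nat \<times> nat) set \<Rightarrow> edge \<Rightarrow> edge"
  where "flip C e = (case e of
      Ho r c \<Rightarrow> if r = 0 \<and> c = 0 \<and> (0, 0) \<in> C then Ve 0 0
        else if (r, Suc c) \<in> C then Ve (r - 1) (Suc c) else Ho r c
    | Ve r c \<Rightarrow> if r = 0 \<and> c = 0 \<and> (0, 0) \<in> C then Ho 0 0
        else if (Suc r, c) \<in> C then Ho (Suc r) (c - 1) else Ve r c)"

lemma cells_H: "p \<in> cells \<Longrightarrow> p \<in> H"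
  by (erule cells_cases) (use H_down[OF H_11] in \<open>auto simp: H_def\<close>)

lemma cells_pos: "(r, c) \<in> cells \<Longrightarrow> (r, c) \<noteq> (0, 0) \<Longrightarrow>
    0 < r \<and> 0 < c \<and> (Suc r, c) \<notin> H \<and> (r, Suc c) \<notin> H"
  by (erule cells_cases) auto

lemma cells_not_mk: "k \<in> {1..m} \<Longrightarrow> mk k \<notin> cells"
proof
  assume k: "k \<in> {1..m}" and "mk k \<in> cells"
  from this(2) show False
  proof (cases rule: cells_cases)
    case 1
    then have "t k = t m" "s (k - 1) = s 0" by (auto simp: mk_def)
    then have "k = m" "k - 1 = 0" using k t_eq_iff[of k m] s_eq_iff[of "k - 1" 0] by auto
    then show False using m3 by simp
  next
    case (2 r c)
    then show False using mk_notin_Q[OF k] by simp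
  qed
qed

lemma flip_flip: "C \<subseteq> cells \<Longrightarrow> C' \<subseteq> cells \<Longrightarrow> flip C (flip C' e) = flip ((C - C') \<union> (C' - C)) e"
proof -
  assume C: "C \<subseteq> cells" "C' \<subseteq> cells"
  have pos: "0 < r \<and> 0 < c" if "(r, c) \<in> C \<union> C'" "(r, c) \<noteq> (0, 0)" for r c
    using that C cells_pos[of r c] by blast
  show ?thesis
  proof (cases e)
    case (Ho r c)
    show ?thesis
      using pos[of r "Suc c"] pos[of "Suc 0" 0] pos[of 0 "Suc 0"]
      by (cases "r = 0") (auto simp: flip_def Ho)
  next
    case (Ve r c)
    show ?thesis
      using pos[of "Suc r" c] pos[of "Suc 0" 0] pos[of 0 "Suc 0"]
      by (cases "c = 0") (auto simp: flip_def Ve)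
  qed
qed

lemma flip_empty: "flip {} e = e"
  by (cases e) (auto simp: flip_def)

lemma flip_E: "C \<subseteq> cells \<Longrightarrow> e \<in> E \<Longrightarrow> flip C e \<in> E"
proof -
  assume C: "C \<subseteq> cells" and e: "e \<in> E"
  have H: "(Suc 0, 0) \<in> H" "(0, Suc 0) \<in> H" using H_down[OF H_11] by auto
  have CH: "p \<in> C \<Longrightarrow> p \<in> H" for p using C cells_H by blast
  have pos: "0 < r \<and> 0 < c" if "(r, c) \<in> C" "(r, c) \<noteq> (0, 0)" for r c
    using that C cells_pos[of r c] by blast
  show ?thesis
  proof (cases e)
    case (Ho r c)
    then show ?thesis using e H CH[of "(r, Suc c)"] pos[of r "Suc c"]
      by (auto simp: flip_def Ho_in_E Ve_in_E)
  next
    case (Ve r c)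
    then show ?thesis using e H CH[of "(Suc r, c)"] pos[of "Suc r" c]
      by (auto simp: flip_def Ho_in_E Ve_in_E)
  qed
qed

lemma flip_notin: "C \<subseteq> cells \<Longrightarrow> e \<notin> E \<Longrightarrow> flip C e = e"
proof -
  assume C: "C \<subseteq> cells" and e: "e \<notin> E"
  have H: "(Suc 0, 0) \<in> H" "(0, Suc 0) \<in> H" using H_down[OF H_11] by auto
  have CH: "p \<in> C \<Longrightarrow> p \<in> H" for p using C cells_H by blast
  show ?thesis
    using e H CH by (cases e) (auto simp: flip_def Ho_in_E Ve_in_E)
qed

lemma flip_permutes: "C \<subseteq> cells \<Longrightarrow> flip C permutes E"
  by (rule bij_imp_permutes, rule bij_betw_byWitness[where f' = "flip C"])
    (auto simp: flip_flip flip_empty flip_E flip_notin)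

text \<open>Each cell of \<open>C\<close> lies in exactly two edges; reflecting its entry between the two neighbouring
  entries exchanges them.\<close>

lemma flip_AutT:
  assumes C: "C \<subseteq> cells"
  shows "flip C \<in> AutT"
proof (rule AutT_gapI[OF flip_permutes[OF C]])
  fix f assume f: "f \<in> pts"
  define f' where "f' p = (if p \<in> C then
      (if p = (0, 0) then f (1, 0) + f (0, 1) else f (fst p, snd p - 1) + f (fst p - 1, snd p)) - f p
    else f p)" for p
  \<comment> \<open>No two chosen cells are adjacent, so the neighbours used in a reflection keep
    their values.\<close>
  have nadj: "(Suc r, c) \<notin> C \<and> (r, Suc c) \<notin> C" if "(r, c) \<in> C" for r c
  proof (cases "(r, c) = (0, 0)")
    case True
    then show ?thesis using cells_pos[of 1 0] cells_pos[of 0 1] C by auto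
  next
    case False
    then show ?thesis using cells_pos[of r c] C cells_H that by blast
  qed
  have pos: "0 < r \<and> 0 < c \<and> (Suc r, c) \<notin> H \<and> (r, Suc c) \<notin> H" if "(r, c) \<in> C" "(r, c) \<noteq> (0, 0)" for r c
    using that C cells_pos[of r c] by blast
  have "f' (mk k) = real k" if "k \<in> {1..m}" for k
    using cells_not_mk[OF that] C f that by (auto simp: f'_def pts_def)
  moreover have "f' (tgt (flip C e)) - f' (src (flip C e)) = f (tgt e) - f (src e)" if e: "e \<in> E" for e
  proof (cases e)
    case (Ho r c)
    have H: "(r, Suc c) \<in> H" using e by (simp add: Ho Ho_in_E)
    consider "r = 0" "c = 0" "(0, 0) \<in> C" | "(r, Suc c) \<in> C"
      | "(r, Suc c) \<notin> C" "\<not> (r = 0 \<and> c = 0 \<and> (0, 0) \<in> C)" by blast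
    then show ?thesis
    proof cases
      case 1
      then show ?thesis using nadj[of 0 0] by (auto simp: Ho flip_def f'_def)
    next
      case 2
      then obtain u where u: "r = Suc u" using pos[of r "Suc c"] by (cases r) auto
      have "(u, Suc c) \<notin> C" using nadj[of u "Suc c"] 2 u by blast
      then show ?thesis using 2 u by (auto simp: Ho flip_def f'_def)
    next
      case 3
      have "(r, c) \<notin> C" using 3 pos[of r c] H by blast
      then show ?thesis using 3 by (auto simp: Ho flip_def f'_def)
    qed
  next
    case (Ve r c)
    have H: "(Suc r, c) \<in> H" using e by (simp add: Ve Ve_in_E)
    consider "r = 0" "c = 0" "(0, 0) \<in> C" | "(Suc r, c) \<in> C"
      | "(Suc r, c) \<notin> C" "\<not> (r = 0 \<and> c = 0 \<and> (0, 0) \<in> C)" by blast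
    then show ?thesis
    proof cases
      case 1
      then show ?thesis using nadj[of 0 0] by (auto simp: Ve flip_def f'_def)
    next
      case 2
      then obtain u where u: "c = Suc u" using pos[of "Suc r" c] by (cases c) auto
      have "(Suc r, u) \<notin> C" using nadj[of "Suc r" u] 2 u by blast
      then show ?thesis using 2 u by (auto simp: Ve flip_def f'_def)
    next
      case 3
      have "(r, c) \<notin> C" using 3 pos[of r c] H by blast
      then show ?thesis using 3 by (auto simp: Ve flip_def f'_def)
    qed
  qed
  ultimately show "\<exists>f'. (\<forall>k\<in>{1..m}. f' (mk k) = real k) \<and>
      (\<forall>e\<in>E. f' (tgt (flip C e)) - f' (src (flip C e)) = f (tgt e) - f (src e))" by blast
qed

lemma corner_swappable: "swp (Ve 0 0) (Ho 0 0) \<in> AutT"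
proof -
  have "flip {(0, 0)} e = swp (Ve 0 0) (Ho 0 0) e" for e
    by (cases e) (auto simp: flip_def swp_def)
  then have "flip {(0, 0)} = swp (Ve 0 0) (Ho 0 0)" by (rule ext)
  then show ?thesis using flip_AutT[of "{(0, 0)}"] by (simp add: cells_def)
qed

lemma ck_swappable:
  assumes "k \<in> Kset" "ck k = (Suc r, Suc c)"
  shows "swp (Ho (Suc r) c) (Ve r (Suc c)) \<in> AutT"
proof -
  have "flip {(Suc r, Suc c)} e = swp (Ho (Suc r) c) (Ve r (Suc c)) e" for e
    by (cases e) (auto simp: flip_def swp_def)
  then have "flip {(Suc r, Suc c)} = swp (Ho (Suc r) c) (Ve r (Suc c))" by (rule ext)
  moreover have "(Suc r, Suc c) \<in> cells" using assms unfolding cells_def by (metis image_eqI insertI2)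
  ultimately show ?thesis using flip_AutT[of "{(Suc r, Suc c)}"] by simp
qed

section \<open>The action on squares\<close>

definition Xp :: "nat \<Rightarrow> edge set"
  where "Xp k = {Ve r (s (k - 1)) | r. t (Suc k) \<le> r \<and> r < t k}
    \<union> {Ho (t (Suc k)) c | c. s (k - 1) \<le> c \<and> c < s k}"

lemma Xp_E:
  assumes "1 \<le> k" "k < m"
  shows "Xp k \<subseteq> E"
proof
  fix e assume "e \<in> Xp k"
  then consider r where "e = Ve r (s (k - 1))" "r < t k"
    | c where "e = Ho (t (Suc k)) c" "c < s k" by (auto simp: Xp_def)
  then show "e \<in> E"
  proof cases
    case 1
    then show ?thesis using H_down[of "t k" "s (k - 1)"] mk_in_H[of k] assms
      by (auto simp: Ve_in_E mk_def)
  next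
    case 2
    then show ?thesis using H_down[of "t (Suc k)" "s k"] mk_in_H[of "Suc k"] assms
      by (auto simp: Ho_in_E mk_def)
  qed
qed

text \<open>The edges of \<open>Xp k\<close> form a path from \<open>mk k\<close> to \<open>mk (Suc k)\<close>, and these two entries have
  different values.\<close>

lemma Xp_inconsistent:
  assumes k: "1 \<le> k" "k < m" and S: "S \<in> Ts"
  shows "\<not> Xp k \<subseteq> S"
proof
  assume X: "Xp k \<subseteq> S"
  obtain f where f: "f \<in> pts" "S = tt f" using S by (auto simp: Ts_def)
  have le: "t (Suc k) \<le> t k" "s (k - 1) \<le> s k"
    using t_le_iff[of "Suc k" k] s_le_iff[of "k - 1" k] k by auto
  have 1: "f (t k - i, s (k - 1)) = real k" if "i \<le> t k - t (Suc k)" for i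
    using that
  proof (induction i)
    case 0
    then show ?case using f(1) k by (auto simp: pts_def mk_def)
  next
    case (Suc i)
    then have "Ve (t k - Suc i) (s (k - 1)) \<in> Xp k" using le by (auto simp: Xp_def)
    then have "Ve (t k - Suc i) (s (k - 1)) \<in> tt f" using X f by auto
    moreover have "Suc (t k - Suc i) = t k - i" using Suc.prems le by simp
    ultimately have "f (t k - i, s (k - 1)) = f (t k - Suc i, s (k - 1))" by (simp add: tt_def)
    then show ?case using Suc by simp
  qed
  have 2: "f (t (Suc k), s (k - 1) + j) = real k" if "j \<le> s k - s (k - 1)" for j
    using that
  proof (induction j)
    case 0
    then show ?case using 1[of "t k - t (Suc k)"] le by simp
  next
    case (Suc j)
    then have "Ho (t (Suc k)) (s (k - 1) + j) \<in> Xp k" using le by (auto simp: Xp_def)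
    then have "Ho (t (Suc k)) (s (k - 1) + j) \<in> tt f" using X f by auto
    then show ?case using Suc by (simp add: tt_def)
  qed
  have "f (mk (Suc k)) = real k" using 2[of "s k - s (k - 1)"] le by (simp add: mk_def)
  then show False using f(1) k by (auto simp: pts_def)
qed

text \<open>The common scheme of refutation: the preimage of \<open>S\<close> would be a tight set
  containing the whole path.\<close>

lemma Xp_image:
  assumes p: "\<pi> \<in> AutT" and k: "1 \<le> k" "k < m" and S: "S \<in> Ts"
    and all: "\<And>x. x \<in> Xp k \<Longrightarrow> \<pi> x \<in> S"
  shows False
proof -
  obtain S' where S': "S' \<in> Ts" "S = \<pi> ` S'" by (rule AutT_preimage[OF p S])
  have "x \<in> S'" if "x \<in> Xp k" for x
    using all[OF that] AutT_inj[OF p] by (simp add: S'(2) inj_image_mem_iff)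
  then show False using Xp_inconsistent[OF k S'(1)] by blast
qed

lemma Rb_block: "k < m \<Longrightarrow> t (Suc k) \<le> r \<Longrightarrow> r < t k \<Longrightarrow> Rb r = Suc k"
  by (rule Rb_eq) auto

text \<open>For \<open>2 \<le> k\<close> this edge enters \<open>mk k\<close> from the left, and for
  \<open>k < m\<close> the edge \<open>outE k\<close> leaves it upwards. Each end mark keeps only
  one of the two, \<open>outE 1\<close> and \<open>inE m\<close>, and these are pendant.\<close>

definition inE :: "nat \<Rightarrow> edge"
  where "inE k = Ho (t k) (s (k - 1) - 1)"

definition outE :: "nat \<Rightarrow> edge"
  where "outE k = Ve (t k - 1) (s (k - 1))"

definition qk :: "nat \<Rightarrow> nat \<times> nat"
  where "qk k = (t k - 1, s (k - 1) - 1)"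

lemma qk_D:
  assumes "2 \<le> k" "k < m"
  shows "qk k \<in> D" "Up (qk k) = {inE k, outE k}" "(Suc (t k - 1), Suc (s (k - 1) - 1)) = mk k"
proof -
  have pos: "0 < t k" "0 < s (k - 1)" using assms t_pos[of k] s_pos[of "k - 1"] by auto
  then show "(Suc (t k - 1), Suc (s (k - 1) - 1)) = mk k" by (simp add: mk_def)
  then show "qk k \<in> D" "Up (qk k) = {inE k, outE k}"
    using assms pos mk_in_H[of k] by (auto simp: qk_def D_def Up_def inE_def outE_def)
qed

lemma in_out_E:
  assumes "2 \<le> k" "k < m"
  shows "inE k \<in> E" "outE k \<in> E" "inE k \<noteq> outE k"
  using qk_D[OF assms] Up_D[of "qk k"] by (auto simp: inE_def outE_def)

lemma antimono_Rb: "antimono Rb"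
  by (simp add: antimono_def Rb_anti)

lemma Xp_cases:
  assumes "x \<in> Xp k"
  obtains "x = outE k" | r where "x = Ve r (s (k - 1))" "t (Suc k) \<le> r" "Suc r < t k"
    | c where "x = Ho (t (Suc k)) c" "s (k - 1) \<le> c" "c < s k"
proof -
  consider r where "x = Ve r (s (k - 1))" "t (Suc k) \<le> r" "r < t k"
    | c where "x = Ho (t (Suc k)) c" "s (k - 1) \<le> c" "c < s k"
    using assms by (auto simp: Xp_def)
  then show thesis
  proof cases
    case (1 r)
    show thesis
    proof (cases "Suc r = t k")
      case True
      then have "x = outE k" using 1 by (simp add: outE_def flip: True)
      then show thesis by (rule that(1))
    next
      case False
      then show thesis using that(2) 1 by simp
    qed
  qed (rule that(3))
qed

text \<open>At \<open>rowpt Rb\<close> every edge of \<open>Xp k\<close> other than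
  \<open>outE k\<close> is tight, and so is \<open>inE k\<close>. Exchanging the two would carry the
  whole path into one tight set.\<close>

lemma mk_not_swappable:
  assumes k: "2 \<le> k" "k < m"
  shows "swp (inE k) (outE k) \<notin> AutT"
proof
  assume sw: "swp (inE k) (outE k) \<in> AutT"
  have S: "tt (rowpt Rb) \<in> Ts" by (rule rowpt_Ts) (simp_all add: antimono_Rb)
  show False
  proof (rule Xp_image[OF sw _ _ S])
    show "1 \<le> k" "k < m" using k by auto
    fix x assume x: "x \<in> Xp k"
    then have xE: "x \<in> E" using Xp_E[of k] k by auto
    have "t (Suc k) < t k" using t_less_iff[of "Suc k" k] k by simp
    then have ne: "Ho (t (Suc k)) c \<noteq> inE k" for c by (simp add: inE_def)
    consider "x = outE k" | r where "x = Ve r (s (k - 1))" "t (Suc k) \<le> r" "Suc r < t k"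
      | c where "x = Ho (t (Suc k)) c"
      by (rule Xp_cases[OF x])
    then show "swp (inE k) (outE k) x \<in> tt (rowpt Rb)"
    proof cases
      case 1
      have "inE k \<in> tt (rowpt Rb)" using in_out_E(1)[OF k] by (auto simp: inE_def intro: rowpt_Ho_Rb)
      then show ?thesis using 1 in_out_E(3)[OF k] by (simp add: swp_def)
    next
      case 2
      then have "Rb (Suc r) = Rb r" using Rb_block[of k r] Rb_block[of k "Suc r"] k by simp
      then have "x \<in> tt (rowpt Rb)" using 2 xE by (auto intro: rowpt_Ve)
      moreover have "x \<noteq> inE k" "x \<noteq> outE k" using 2 by (auto simp: inE_def outE_def)
      ultimately show ?thesis by (simp add: swp_def)
    next
      case 3
      then have "x \<in> tt (rowpt Rb)" using xE by (auto intro: rowpt_Ho_Rb)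
      moreover have "x \<noteq> inE k" "x \<noteq> outE k" using 3 ne by (auto simp: outE_def)
      ultimately show ?thesis by (simp add: swp_def)
    qed
  qed
qed

lemma swp_pair:
  assumes p: "\<pi> \<in> AutT" and s: "swp e f \<in> AutT" and img: "\<pi> ` {e, f} = {e', f'}"
  shows "swp e' f' \<in> AutT"
proof -
  have "\<pi> e = e' \<and> \<pi> f = f' \<or> \<pi> e = f' \<and> \<pi> f = e'"
    using img unfolding image_insert image_empty by (simp only: doubleton_eq_iff)
  moreover have "swp f' e' = swp e' f'" by (auto simp: swp_def)
  ultimately show ?thesis using swp_conj[OF p s] by auto
qed

lemma lower_neighbour:
  assumes "q \<in> D" "q \<noteq> (0, 0)"
  shows "\<exists>p\<in>D. fst p + snd p < fst q + snd q \<and> Up p \<inter> Lp q \<noteq> {}"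
proof -
  obtain r c where rc: "q = (r, c)" by (cases q)
  show ?thesis
  proof (cases r)
    case 0
    then obtain d where d: "c = Suc d" using assms rc by (cases c) auto
    have "(0, d) \<in> D" using assms H_down[of "Suc r" "Suc c" 1 "Suc d"] by (auto simp: D_def rc 0 d)
    then show ?thesis by (intro bexI[of _ "(0, d)"]) (auto simp: rc 0 d Up_def Lp_def)
  next
    case (Suc u)
    have "(u, c) \<in> D" using assms H_down[of "Suc r" "Suc c" "Suc u" "Suc c"] by (auto simp: D_def rc Suc)
    then show ?thesis by (intro bexI[of _ "(u, c)"]) (auto simp: rc Suc Up_def Lp_def)
  qed
qed

text \<open>An automorphism respects or reverses the distinction between \<open>Lp\<close> and \<open>Up\<close> on all squares
  simultaneously. A reversal would carry the pair at an inner mark, which cannot be exchanged, to the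
  pair at the corner \<open>(0, 0)\<close>, which can.\<close>

lemma AutT_orientation:
  assumes p: "\<pi> \<in> AutT" and q: "q \<in> D"
  shows "\<exists>q'\<in>D. \<pi> ` Lp q = Lp q' \<and> \<pi> ` Up q = Up q'"
proof -
  define P where "P q \<longleftrightarrow> (\<exists>q'\<in>D. \<pi> ` Lp q = Lp q' \<and> \<pi> ` Up q = Up q')" for q
  define N where "N q \<longleftrightarrow> (\<exists>q'\<in>D. \<pi> ` Lp q = Up q' \<and> \<pi> ` Up q = Lp q')" for q
  have img: "\<pi> ` V \<noteq> \<pi> ` W" if "V \<noteq> W" for V W
    using that inj_image_eq_iff[OF AutT_inj[OF p]] by simp
  have PN: "P q \<or> N q" if "q \<in> D" for q
    using AutT_square[OF p that] unfolding P_def N_def bex_disj_distrib .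
  \<comment> \<open>Neighbouring squares have the same orientation: otherwise their common edge
    would be mapped into two chains of the same type, which then coincide although they come from
    different chains.\<close>
  have no1: "\<not> (P x \<and> N y)" if xy: "Up x \<inter> Lp y \<noteq> {}" for x y
  proof
    assume "P x \<and> N y"
    then obtain x' y' where x': "\<pi> ` Up x = Up x'" and y': "\<pi> ` Lp y = Up y'"
      unfolding P_def N_def by (elim conjE bexE)
    obtain e where "e \<in> Up x" "e \<in> Lp y" using xy by auto
    then have "\<pi> e \<in> Up x'" "\<pi> e \<in> Up y'" unfolding x'[symmetric] y'[symmetric] by simp_all
    then have "x' = y'" by (rule Up_unique)
    then show False using img[of "Up x" "Lp y"] x' y' Lp_ne_Up[of y x] by simp
  qed
  have no2: "\<not> (N x \<and> P y)" if xy: "Up x \<inter> Lp y \<noteq> {}" for x y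
  proof
    assume "N x \<and> P y"
    then obtain x' y' where x': "\<pi> ` Up x = Lp x'" and y': "\<pi> ` Lp y = Lp y'"
      unfolding P_def N_def by (elim conjE bexE)
    obtain e where "e \<in> Up x" "e \<in> Lp y" using xy by auto
    then have "\<pi> e \<in> Lp x'" "\<pi> e \<in> Lp y'" unfolding x'[symmetric] y'[symmetric] by simp_all
    then have "x' = y'" by (rule Lp_unique)
    then show False using img[of "Up x" "Lp y"] x' y' Lp_ne_Up[of y x] by simp
  qed
  have same: "(P x \<longrightarrow> P (0, 0)) \<and> (N x \<longrightarrow> N (0, 0))" if "x \<in> D" for x
    using that
  proof (induction "fst x + snd x" arbitrary: x rule: less_induct)
    case less
    show ?case
    proof (cases "x = (0, 0)")
      case False
      obtain y where y: "y \<in> D" "fst y + snd y < fst x + snd x" "Up y \<inter> Lp x \<noteq> {}"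
        using lower_neighbour[OF less.prems False] by (elim bexE conjE)
      then show ?thesis using less.hyps[OF y(2,1)] PN[OF y(1)] no1[OF y(3)] no2[OF y(3)] by argo
    qed simp
  qed
  have notPN: "\<not> (P x \<and> N x)" for x
  proof
    assume "P x \<and> N x"
    then obtain x' y' where "\<pi> ` Lp x = Lp x'" "\<pi> ` Lp x = Up y'"
      unfolding P_def N_def by (elim conjE bexE)
    then show False using Lp_ne_Up[of x' y'] by simp
  qed
  have "P (0, 0)"
  proof (rule ccontr)
    assume "\<not> P (0, 0)"
    then have allN: "N x" if "x \<in> D" for x using same[OF that] PN[OF that] by blast
    have two: "2 \<le> (2::nat)" "2 < m" using m3 by auto
    obtain q' where q': "q' \<in> D" "\<pi> ` Lp (qk 2) = Up q'" "\<pi> ` Up (qk 2) = Lp q'"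
      using allN[OF qk_D(1)[OF two]] unfolding N_def by (elim bexE conjE)
    \<comment> \<open>Otherwise \<open>Lp q'\<close> meets the upper chain of a lower neighbour.
      Pulled back, this is a lower chain meeting \<open>Up (qk 2)\<close>, so some square would lie
      beyond the mark \<open>mk 2\<close>.\<close>
    have "q' = (0, 0)"
    proof (rule ccontr)
      assume n: "q' \<noteq> (0, 0)"
      obtain y where y: "y \<in> D" "fst y + snd y < fst q' + snd q'" "Up y \<inter> Lp q' \<noteq> {}"
        using lower_neighbour[OF q'(1) n] by (elim bexE conjE)
      from y(3) obtain e where e: "e \<in> Up y" "e \<in> Lp q'" by auto
      obtain x where x: "x \<in> Up (qk 2)" "e = \<pi> x" using e(2) unfolding q'(3)[symmetric] by auto
      have xE: "x \<in> E" using x(1) Up_D[OF qk_D(1)[OF two]] by auto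
      obtain z where z: "z \<in> D"
        "inv_into UNIV \<pi> ` Lp y = Lp z \<and> inv_into UNIV \<pi> ` Up y = Up z \<or>
         inv_into UNIV \<pi> ` Lp y = Up z \<and> inv_into UNIV \<pi> ` Up y = Lp z"
        using AutT_square[OF AutT_inv[OF p] y(1)] by (elim bexE)
      have bk: "\<pi> ` inv_into UNIV \<pi> ` Up y = Up y"
        using AutT_permutes[OF p] by (simp add: image_image permutes_inverses)
      have "inv_into UNIV \<pi> ` Up y \<noteq> Up z"
      proof
        assume eq: "inv_into UNIV \<pi> ` Up y = Up z"
        then have "\<pi> ` Up z = Up y" using bk by simp
        moreover obtain z' where "\<pi> ` Up z = Lp z'" using allN[OF z(1)] unfolding N_def by (elim bexE conjE)
        ultimately show False using Lp_ne_Up[of z' y] by simp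
      qed
      then have "inv_into UNIV \<pi> ` Up y = Lp z" using z(2) by argo
      moreover have "inv_into UNIV \<pi> e = x" using x(2) AutT_inj[OF p] by simp
      ultimately have "x \<in> Lp z" using e(1) by (metis imageI)
      then have "z = (t 2, s 1 - 1) \<or> z = (t 2 - 1, s 1)"
        using x(1) unfolding qk_D(2)[OF two] by (cases z) (auto simp: inE_def outE_def Lp_def)
      then have "(Suc (t 2), s (2 - 1)) \<in> H \<or> (t 2, Suc (s (2 - 1))) \<in> H"
        using z(1) t_pos[of 2] s_pos[of 1] m3 by (auto simp: D_def)
      then show False using mk_corner[of 2] m3 by auto
    qed
    then have eq: "\<pi> ` {inE 2, outE 2} = {Ve 0 0, Ho 0 0}"
      using q'(3) unfolding qk_D(2)[OF two] by (simp add: Lp_def)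
    have "inv_into UNIV \<pi> ` {Ve 0 0, Ho 0 0} = {inE 2, outE 2}"
      unfolding eq[symmetric] using AutT_inj[OF p] by (simp only: image_inv_f_f)
    then have "swp (inE 2) (outE 2) \<in> AutT"
      by (rule swp_pair[OF AutT_inv[OF p] corner_swappable])
    then show False using mk_not_swappable[OF two] by simp
  qed
  then have "P q" using same[OF q] PN[OF q] notPN[of "(0, 0)"] by blast
  then show ?thesis unfolding P_def .
qed

section \<open>Rigidity of the arrangement of squares\<close>

lemma cover_iff:
  "Up p \<inter> Lp q \<noteq> {} \<longleftrightarrow> q = (Suc (fst p), snd p) \<or> q = (fst p, Suc (snd p))"
  by (cases p; cases q) (auto simp: Up_def Lp_def)

lemma D_down: "(r, c) \<in> D \<Longrightarrow> r' \<le> r \<Longrightarrow> c' \<le> c \<Longrightarrow> (r', c') \<in> D"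
  using H_down[of "Suc r" "Suc c" "Suc r'" "Suc c'"] by (simp add: D_def)

lemma finite_D: "finite D"
proof (rule finite_subset)
  show "D \<subseteq> H" using H_down by (auto simp: D_def)
qed (rule finite_H)

text \<open>The induced permutation of \<open>D\<close> preserves covers, hence fixes the least
  square, and it fixes or exchanges the squares next to it. Accordingly
  \<open>order_ideal_id\<close> applies to it or to its composition with the transposition.\<close>

lemma AutT_id_or_transpose:
  assumes p: "\<pi> \<in> AutT"
  shows "(\<forall>q\<in>D. \<pi> ` Lp q = Lp q \<and> \<pi> ` Up q = Up q) \<or>
    (\<forall>q\<in>D. prod.swap q \<in> D \<and> \<pi> ` Lp q = Lp (prod.swap q) \<and> \<pi> ` Up q = Up (prod.swap q))"
proof -
  obtain \<sigma> where \<sigma>: "\<And>q. q \<in> D \<Longrightarrow> \<sigma> q \<in> D \<and> \<pi> ` Lp q = Lp (\<sigma> q) \<and> \<pi> ` Up q = Up (\<sigma> q)"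
    using AutT_orientation[OF p] by metis
  have inj: "inj_on \<sigma> D"
  proof (rule inj_onI)
    fix x y assume xy: "x \<in> D" "y \<in> D" "\<sigma> x = \<sigma> y"
    then have "\<pi> ` Lp x = \<pi> ` Lp y" using \<sigma> by simp
    then have "Lp x = Lp y" using inj_image_eq_iff[OF AutT_inj[OF p]] by simp
    moreover obtain e where "e \<in> Lp x" using Lp_ex by blast
    ultimately show "x = y" using Lp_unique[of e x y] by simp
  qed
  have bij: "bij_betw \<sigma> D D"
  proof (rule bij_betw_imageI[OF inj])
    have "\<sigma> ` D \<subseteq> D" using \<sigma> by (auto simp del: split_paired_All)
    then show "\<sigma> ` D = D" by (rule endo_inj_surj[OF finite_D _ inj])
  qed
  have cov: "(\<sigma> q = (Suc (fst (\<sigma> p)), snd (\<sigma> p)) \<or> \<sigma> q = (fst (\<sigma> p), Suc (snd (\<sigma> p)))) \<longleftrightarrow>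
      (q = (Suc (fst p), snd p) \<or> q = (fst p, Suc (snd p)))" if "p \<in> D" "q \<in> D" for p q
  proof -
    have "Up (\<sigma> p) \<inter> Lp (\<sigma> q) = \<pi> ` (Up p \<inter> Lp q)"
      using \<sigma> that AutT_inj[OF p] by (simp add: image_Int)
    then show ?thesis unfolding cover_iff[symmetric] by simp
  qed
  have s00: "\<sigma> (0, 0) = (0, 0)"
  proof (rule ccontr)
    assume n: "\<sigma> (0, 0) \<noteq> (0, 0)"
    have d: "\<sigma> (0, 0) \<in> D" using \<sigma>[OF D_00] by simp
    obtain y where y: "y \<in> D" "fst y + snd y < fst (\<sigma> (0, 0)) + snd (\<sigma> (0, 0))"
        "Up y \<inter> Lp (\<sigma> (0, 0)) \<noteq> {}"
      using lower_neighbour[OF d n] by (elim bexE conjE)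
    obtain x where "x \<in> D" "\<sigma> x = y" using bij y(1) unfolding bij_betw_def by (metis imageE)
    then show False using cov[OF _ D_00, of x] y(3) unfolding cover_iff by auto
  qed
  have lev: "\<sigma> q = (1, 0) \<or> \<sigma> q = (0, 1)" if "q \<in> D" "q = (1, 0) \<or> q = (0, 1)" for q
    using cov[OF D_00 that(1)] that(2) s00 by auto
  have ne: "\<sigma> (1, 0) \<noteq> \<sigma> (0, 1)" if "(1, 0) \<in> D" "(0, 1) \<in> D"
    using inj_onD[OF inj _ that] by auto
  show ?thesis
  proof (cases "(1, 0) \<in> D \<and> \<sigma> (1, 0) = (0, 1)")
    case False
    then have a: "(1, 0) \<in> D \<Longrightarrow> \<sigma> (1, 0) = (1, 0)" using lev[of "(1, 0)"] by blast
    have b: "\<sigma> (0, 1) = (0, 1)" if d: "(0, 1) \<in> D"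
    proof (rule ccontr)
      assume "\<sigma> (0, 1) \<noteq> (0, 1)"
      then have e: "\<sigma> (0, 1) = (1, 0)" using lev[OF d] by simp
      then have "(1, 0) \<in> D" using \<sigma>[OF d] by simp
      then show False using a ne[OF _ d] e by simp
    qed
    have "\<sigma> q = q" if "q \<in> D" for q
      by (rule order_ideal_id[OF D_down D_down bij cov a b that])
    then show ?thesis using \<sigma> by simp
  next
    case True
    then have d10: "(1, 0) \<in> D" and e: "\<sigma> (1, 0) = (0, 1)" by auto
    then have d01: "(0, 1) \<in> D" using \<sigma>[OF d10] by simp
    have e': "\<sigma> (0, 1) = (1, 0)" using lev[OF d01] ne[OF d10 d01] e by auto
    define \<sigma>' where "\<sigma>' q = prod.swap (\<sigma> q)" for q
    have bij': "bij_betw \<sigma>' D (prod.swap ` D)"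
    proof -
      have "bij_betw prod.swap D (prod.swap ` D)" by (rule bij_betw_imageI) auto
      then have "bij_betw (prod.swap \<circ> \<sigma>) D (prod.swap ` D)" using bij by (rule bij_betw_trans[rotated])
      moreover have "\<sigma>' = prod.swap \<circ> \<sigma>" by (simp add: fun_eq_iff \<sigma>'_def)
      ultimately show ?thesis by (simp only:)
    qed
    have "\<sigma>' q = q" if q: "q \<in> D" for q
    proof (rule order_ideal_id[OF D_down _ bij' _ _ _ q])
      fix r c r' c' :: nat
      assume "(r, c) \<in> prod.swap ` D" "r' \<le> r" "c' \<le> c"
      then show "(r', c') \<in> prod.swap ` D"
        using D_down[of c r c' r'] by (auto intro!: image_eqI[of _ _ "(c', r')"])
    next
      fix x y assume "x \<in> D" "y \<in> D"
      then show "(\<sigma>' y = (Suc (fst (\<sigma>' x)), snd (\<sigma>' x)) \<or> \<sigma>' y = (fst (\<sigma>' x), Suc (snd (\<sigma>' x)))) \<longleftrightarrow>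
          (y = (Suc (fst x), snd x) \<or> y = (fst x, Suc (snd x)))"
        using cov[of x y] by (auto simp: \<sigma>'_def prod_eq_iff)
    qed (use e e' in \<open>auto simp: \<sigma>'_def\<close>)
    then have "\<sigma> q = prod.swap q" if "q \<in> D" for q
      using that by (metis \<sigma>'_def swap_swap)
    then show ?thesis using \<sigma> by metis
  qed
qed

end

section \<open>Duality\<close>

lemma strict_self_map:
  fixes h :: "nat \<Rightarrow> nat"
  assumes into: "\<And>i. 1 \<le> i \<Longrightarrow> i \<le> N \<Longrightarrow> 1 \<le> h i \<and> h i \<le> N"
    and mono: "\<And>i j. 1 \<le> i \<Longrightarrow> i < j \<Longrightarrow> j \<le> N \<Longrightarrow> h i < h j"
    and i: "1 \<le> i" "i \<le> N"
  shows "h i = i"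
proof (rule antisym)
  have "1 \<le> i \<longrightarrow> i \<le> N \<longrightarrow> i \<le> h i" for i
  proof (induction i)
    case (Suc i)
    then show ?case using mono[of i "Suc i"] into[of "Suc i"] by (cases "i = 0") auto
  qed simp
  then show "i \<le> h i" using i by blast
  have "d < N \<longrightarrow> h (N - d) \<le> N - d" for d
  proof (induction d)
    case 0
    then show ?case using into[of N] by auto
  next
    case (Suc d)
    show ?case
    proof
      assume d: "Suc d < N"
      then have "h (N - Suc d) < h (N - d)" by (intro mono) auto
      then show "h (N - Suc d) \<le> N - Suc d" using Suc d by auto
    qed
  qed
  from this[of "N - i"] show "h i \<le> i" using i by auto
qed

fun tau :: "edge \<Rightarrow> edge"
  where "tau (Ho r c) = Ve c r" | "tau (Ve r c) = Ho c r"

lemma tau_tau [simp]: "tau (tau e) = e"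
  by (cases e) auto

lemma src_tau [simp]: "src (tau e) = prod.swap (tgt e)"
  and tgt_tau [simp]: "tgt (tau e) = prod.swap (src e)"
  by (cases e; simp)+

lemma inj_tau: "inj tau"
  by (metis injI tau_tau)

context shape begin

definition symmetric :: bool
  where "symmetric \<longleftrightarrow> (\<forall>k\<le>m. s k = t (m - k))"

text \<open>The transposed position of an inner mark is an outer corner of \<open>H\<close>. It is
  again a mark: at any other outer corner the two edges can be exchanged, and conjugation would
  exchange the edges at the original mark. The resulting map of indices is strictly monotone, hence
  the expected one by \<open>strict_self_map\<close>.\<close>

lemma transpose_symmetric:
  assumes p: "\<pi> \<in> AutT"
    and sw: "\<And>q. q \<in> D \<Longrightarrow> prod.swap q \<in> D \<and> \<pi> ` Up q = Up (prod.swap q)"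
  shows symmetric
proof -
  have D_sw: "(c, r) \<in> D" if "(r, c) \<in> D" for r c using sw[OF that] by simp
  have ex: "\<exists>l. 2 \<le> l \<and> l < m \<and> s (k - 1) = t l \<and> t k = s (l - 1)" if k: "2 \<le> k" "k < m" for k
  proof -
    have pos: "0 < t k" "0 < s (k - 1)" using k t_pos[of k] s_pos[of "k - 1"] by auto
    then obtain u v where uv: "s (k - 1) = Suc u" "t k = Suc v" by (auto simp: gr0_conv_Suc)
    have qk: "qk k = (v, u)" using uv by (simp add: qk_def)
    have D: "(u, v) \<in> D" using D_sw[of v u] qk_D(1)[OF k] qk by simp
    have no1: "(Suc (Suc u), Suc v) \<notin> H"
    proof
      assume "(Suc (Suc u), Suc v) \<in> H"
      then have "(Suc u, v) \<in> D" by (simp add: D_def)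
      then have "(v, Suc u) \<in> D" by (rule D_sw)
      then have "(t k, Suc (s (k - 1))) \<in> H" unfolding D_def uv by simp
      then show False using mk_corner(2)[of k] k by auto
    qed
    have no2: "(Suc u, Suc (Suc v)) \<notin> H"
    proof
      assume "(Suc u, Suc (Suc v)) \<in> H"
      then have "(u, Suc v) \<in> D" by (simp add: D_def)
      then have "(Suc v, u) \<in> D" by (rule D_sw)
      then have "(Suc (t k), s (k - 1)) \<in> H" unfolding D_def uv by simp
      then show False using mk_corner(1)[of k] k by auto
    qed
    have "(Suc u, Suc v) \<notin> Q"
    proof
      assume "(Suc u, Suc v) \<in> Q"
      then obtain k' where k': "k' \<in> Kset" "(Suc u, Suc v) = ck k'" using outer_corner no1 no2 by blast
      have s1: "swp (Ho (Suc u) v) (Ve u (Suc v)) \<in> AutT"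
        by (rule ck_swappable[OF k'(1) k'(2)[symmetric]])
      have "\<pi> ` Up (v, u) = Up (u, v)" using sw[of "(v, u)"] qk_D(1)[OF k] qk by simp
      then have img: "\<pi> ` {inE k, outE k} = {Ho (Suc u) v, Ve u (Suc v)}"
        unfolding qk_D(2)[OF k, unfolded qk] by (simp add: Up_def)
      have "inv_into UNIV \<pi> ` {Ho (Suc u) v, Ve u (Suc v)} = {inE k, outE k}"
        unfolding img[symmetric] using AutT_inj[OF p] by (simp only: image_inv_f_f)
      then have "swp (inE k) (outE k) \<in> AutT" by (rule swp_pair[OF AutT_inv[OF p] s1])
      then show False using mk_not_swappable[OF k] by simp
    qed
    then obtain l where l: "l \<in> {1..m}" "(Suc u, Suc v) = mk l" using D by (auto simp: H_def D_def)
    then have eq: "t l = Suc u" "s (l - 1) = Suc v" by (auto simp: mk_def)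
    have "l \<noteq> m" "l \<noteq> 1" using eq by (metis t_m nat.distinct(1), metis diff_self_eq_0 s_0 nat.distinct(1))
    then show ?thesis using l eq uv by (intro exI[of _ l]) auto
  qed
  define N where "N = m - 2"
  have "\<exists>l. 2 \<le> l \<and> l < m \<and> s j = t l" if "1 \<le> j" "j \<le> N" for j
  proof -
    have k: "2 \<le> Suc j" "Suc j < m" using that m3 by (auto simp: N_def)
    show ?thesis using ex[OF k] by auto
  qed
  then obtain l where l: "\<And>j. 1 \<le> j \<Longrightarrow> j \<le> N \<Longrightarrow> 2 \<le> l j \<and> l j < m \<and> s j = t (l j)"
    by metis
  have h: "m - l j = j" if j: "1 \<le> j" "j \<le> N" for j
  proof (rule strict_self_map[of N "\<lambda>j. m - l j", OF _ _ j])
    show "1 \<le> m - l i \<and> m - l i \<le> N" if "1 \<le> i" "i \<le> N" for i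
      using l[OF that] by (auto simp: N_def)
    fix i j assume ij: "1 \<le> i" "i < j" "j \<le> N"
    then have "s i < s j" by (intro s_less) (auto simp: N_def)
    then have "t (l i) < t (l j)" using l[of i] l[of j] ij by simp
    then have "l j < l i" using t_less_iff[of "l i" "l j"] l[of i] l[of j] ij by simp
    moreover have "l i < m" using l[of i] ij by auto
    ultimately show "m - l i < m - l j" by linarith
  qed
  have main: "s j = t (m - j)" if "1 \<le> j" "j \<le> N" for j
  proof -
    have "l j = m - j" using h[OF that] l[OF that] by linarith
    then show ?thesis using l[OF that] by simp
  qed
  \<comment> \<open>The index \<open>m - 1\<close> lies outside the range of \<open>main\<close>;
    the equality for index 1 yields it on passing to complements in \<open>s m\<close>.\<close>
  have last: "s (m - 1) = t 1"
    using main[of 1] s_plus_t[of 1] s_plus_t[of "m - 1"] m3 by (simp add: N_def)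
  have "s k = t (m - k)" if k: "k \<le> m" for k
  proof -
    consider "k = 0" | "1 \<le> k" "k \<le> N" | "k = m - 1" | "k = m"
      using k m3 unfolding N_def by linarith
    then show ?thesis using main last m3 by cases auto
  qed
  then show ?thesis by (simp add: symmetric_def)
qed

end

text \<open>The shape with the parts read in reverse order. It carries results from the first mark
  over to the last one and, for \<open>s' = s\<close>, provides the symmetry of the shape
  itself.\<close>

locale dual_pair = A: shape m s + B: shape m s' for m s s' +
  assumes dual: "k \<le> m \<Longrightarrow> s' k = A.t (m - k)"
begin

lemma Bt: "k \<le> m \<Longrightarrow> B.t k = s (m - k)"
  using A.s_plus_t[of "m - k"] by (simp add: B.t_def dual)

lemma Bmk: "1 \<le> k \<Longrightarrow> k \<le> m \<Longrightarrow> B.mk k = prod.swap (A.mk (Suc m - k))"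
  using dual[of "k - 1"] by (simp add: B.mk_def A.mk_def Bt Suc_diff_le)

lemma flip_dual: "dual_pair m s' s"
  by unfold_locales (simp add: Bt)

lemma BQ: "(r, c) \<in> B.Q \<longleftrightarrow> (c, r) \<in> A.Q"
proof
  assume "(r, c) \<in> B.Q"
  then obtain k where k: "k \<in> {1..m - 1}" "r < B.t k" "c < s' k" by (auto simp: B.Q_def)
  then have "m - k \<in> {1..m - 1} \<and> c < A.t (m - k) \<and> r < s (m - k)" using Bt[of k] dual[of k] by auto
  then show "(c, r) \<in> A.Q" unfolding A.Q_def by blast
next
  assume "(c, r) \<in> A.Q"
  then obtain k where k: "k \<in> {1..m - 1}" "c < A.t k" "r < s k" by (auto simp: A.Q_def)
  then have "m - k \<in> {1..m - 1} \<and> r < B.t (m - k) \<and> c < s' (m - k)"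
    using Bt[of "m - k"] dual[of "m - k"] by auto
  then show "(r, c) \<in> B.Q" unfolding B.Q_def by blast
qed

lemma BH: "(r, c) \<in> B.H \<longleftrightarrow> (c, r) \<in> A.H"
proof -
  have "(\<exists>k\<in>{1..m}. (r, c) = B.mk k) \<longleftrightarrow> (\<exists>k\<in>{1..m}. (c, r) = A.mk k)"
  proof
    assume "\<exists>k\<in>{1..m}. (r, c) = B.mk k"
    then obtain k where k: "k \<in> {1..m}" "(r, c) = B.mk k" by blast
    then have "prod.swap (r, c) = prod.swap (prod.swap (A.mk (Suc m - k)))" using Bmk[of k] by simp
    then have "(c, r) = A.mk (Suc m - k)" by simp
    then show "\<exists>k\<in>{1..m}. (c, r) = A.mk k" using k by (intro bexI[of _ "Suc m - k"]) auto
  next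
    assume "\<exists>k\<in>{1..m}. (c, r) = A.mk k"
    then obtain k where k: "k \<in> {1..m}" "(c, r) = A.mk k" by blast
    have "1 \<le> Suc m - k" "Suc m - k \<le> m" "Suc m - (Suc m - k) = k" using k(1) by auto
    then have "B.mk (Suc m - k) = prod.swap (A.mk k)" using Bmk[of "Suc m - k"] by simp
    then have "(r, c) = B.mk (Suc m - k)" using k(2)[symmetric] by simp
    then show "\<exists>k\<in>{1..m}. (r, c) = B.mk k" using k by (intro bexI[of _ "Suc m - k"]) auto
  qed
  then show ?thesis using BQ by (auto simp: A.H_def B.H_def)
qed

lemma BE: "tau e \<in> B.E \<longleftrightarrow> e \<in> A.E"
  by (cases e) (simp_all add: A.Ho_in_E A.Ve_in_E B.Ho_in_E B.Ve_in_E BH)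

text \<open>Transposition reverses every edge; replacing a value \<open>v\<close> by
  \<open>m + 1 - v\<close> restores monotonicity and the values at the marks, whose order is
  reversed.\<close>

lemma tau_Ts:
  assumes S: "S \<in> A.Ts"
  shows "tau ` S \<in> B.Ts"
proof -
  obtain f where f: "f \<in> A.pts" "S = A.tt f" using S by (auto simp: A.Ts_def)
  define f' where "f' p = real (Suc m) - f (prod.swap p)" for p
  have "f' (B.mk k) = real k" if k: "k \<in> {1..m}" for k
  proof -
    have "Suc m - k \<in> {1..m}" using k by auto
    then have "f (A.mk (Suc m - k)) = real (Suc m - k)" using f(1) unfolding A.pts_def by blast
    then show ?thesis using k by (simp add: f'_def Bmk of_nat_diff)
  qed
  moreover have "f' (src e) \<le> f' (tgt e)" if "e \<in> B.E" for e
  proof -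
    have "tau e \<in> A.E" using BE[of "tau e"] that by simp
    then have "f (src (tau e)) \<le> f (tgt (tau e))" using f(1) unfolding A.pts_def by blast
    then show ?thesis by (simp add: f'_def)
  qed
  ultimately have "f' \<in> B.pts" by (simp add: B.pts_def)
  moreover have "B.tt f' = tau ` S"
  proof -
    have mem: "e \<in> B.tt f' \<longleftrightarrow> tau e \<in> S" for e
      using BE[of "tau e"] by (auto simp: B.tt_def A.tt_def f f'_def)
    show ?thesis
    proof (rule equalityI; rule subsetI)
      fix e assume "e \<in> B.tt f'"
      then have "tau (tau e) \<in> tau ` S" using mem by (intro imageI) simp
      then show "e \<in> tau ` S" by simp
    next
      fix e assume "e \<in> tau ` S"
      then obtain x where "x \<in> S" "e = tau x" by auto
      then show "e \<in> B.tt f'" using mem by simp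
    qed
  qed
  ultimately show ?thesis unfolding B.Ts_def by (metis imageI)
qed

lemma tau_AutT:
  assumes p: "\<pi> \<in> A.AutT"
  shows "tau \<circ> \<pi> \<circ> tau \<in> B.AutT"
proof (rule B.AutT_I)
  interpret dual: dual_pair m s' s by (rule flip_dual)
  have inj: "inj \<pi>" by (rule A.AutT_inj[OF p])
  show "tau \<circ> \<pi> \<circ> tau permutes B.E"
  proof (rule bij_imp_permutes)
    show "bij_betw (tau \<circ> \<pi> \<circ> tau) B.E B.E"
    proof (rule bij_betw_byWitness[where f' = "tau \<circ> inv_into UNIV \<pi> \<circ> tau"])
      have "\<pi> (inv_into UNIV \<pi> e) = e" "inv_into UNIV \<pi> (\<pi> e) = e" for e
        using A.AutT_permutes[OF p] by (auto simp: permutes_inverses)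
      then show "\<forall>a\<in>B.E. (tau \<circ> inv_into UNIV \<pi> \<circ> tau) ((tau \<circ> \<pi> \<circ> tau) a) = a"
        "\<forall>a\<in>B.E. (tau \<circ> \<pi> \<circ> tau) ((tau \<circ> inv_into UNIV \<pi> \<circ> tau) a) = a" by auto
      show "(tau \<circ> \<pi> \<circ> tau) ` B.E \<subseteq> B.E" "(tau \<circ> inv_into UNIV \<pi> \<circ> tau) ` B.E \<subseteq> B.E"
        using A.AutT_E[OF p] A.AutT_E[OF A.AutT_inv[OF p]] BE dual.BE by auto
    qed
    fix e assume "e \<notin> B.E"
    then have "tau e \<notin> A.E" using dual.BE by simp
    then have "\<pi> (tau e) = tau e" using A.AutT_permutes[OF p] by (simp add: permutes_not_in)
    then show "(tau \<circ> \<pi> \<circ> tau) e = e" by simp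
  qed
  fix S assume "S \<in> B.Ts"
  then have "tau ` \<pi> ` tau ` S \<in> B.Ts" by (intro tau_Ts A.AutT_Ts[OF p] dual.tau_Ts)
  then show "(tau \<circ> \<pi> \<circ> tau) ` S \<in> B.Ts" by (simp add: image_comp)
qed

end

context shape begin

lemma dual_pair_dual: "dual_pair m s (\<lambda>k. t (m - k))"
proof unfold_locales
  show "t (m - k) < t (m - Suc k)" if "k < m" for k
    using t_less_iff[of "m - k" "m - Suc k"] that by simp
qed (use m3 in auto)

text \<open>Restricted to \<open>E\<close> because a permutation of \<open>E\<close> is the identity
  elsewhere.\<close>

definition tauE :: "edge \<Rightarrow> edge"
  where "tauE e = (if e \<in> E then tau e else e)"

lemma symmetric_dual_pair: "symmetric \<Longrightarrow> dual_pair m s s"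
  by unfold_locales (simp add: symmetric_def)

lemma tauE_AutT:
  assumes sym: symmetric
  shows "tauE \<in> AutT"
proof (rule AutT_I)
  interpret dual_pair m s s by (rule symmetric_dual_pair[OF sym])
  show "tauE permutes E"
    by (rule bij_imp_permutes, rule bij_betw_byWitness[where f' = tauE]) (auto simp: tauE_def BE)
  fix S assume S: "S \<in> Ts"
  then have "tauE ` S = tau ` S" using Ts_sub[OF S] by (intro image_cong) (auto simp: tauE_def)
  then show "tauE ` S \<in> Ts" using tau_Ts[OF S] by simp
qed

lemma tauE_tauE: "symmetric \<Longrightarrow> tauE (tauE e) = e"
proof -
  assume symmetric
  then interpret dual_pair m s s by (rule symmetric_dual_pair)
  show ?thesis by (simp add: tauE_def BE)
qed

lemma tauE_Lp: "q \<in> D \<Longrightarrow> tauE ` Lp q = Lp (prod.swap q)"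
  and tauE_Up: "q \<in> D \<Longrightarrow> tauE ` Up q = Up (prod.swap q)"
proof -
  assume q: "q \<in> D"
  have "tauE ` Lp q = tau ` Lp q" "tauE ` Up q = tau ` Up q"
    using Lp_D[OF q] Up_D[OF q] by (auto simp: tauE_def intro!: image_cong)
  moreover have "tau ` Lp q = Lp (prod.swap q)" "tau ` Up q = Up (prod.swap q)"
    by (cases q; auto simp: Lp_def Up_def)+
  ultimately show "tauE ` Lp q = Lp (prod.swap q)" "tauE ` Up q = Up (prod.swap q)" by simp_all
qed

section \<open>Automorphisms fixing the squares\<close>

text \<open>Edges of the first column that border no square. By \<open>pendant_iff\<close>,
  \<open>P1\<close> and \<open>Pm\<close> together are all edges outside every square.\<close>

definition P1 :: "edge set"
  where "P1 = {Ve r 0 | r. (Suc r, 0) \<in> H \<and> (Suc r, 1) \<notin> H}"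

definition Pm :: "edge set"
  where "Pm = {Ho 0 c | c. (0, Suc c) \<in> H \<and> (1, Suc c) \<notin> H}"

definition fixes_squares :: "(edge \<Rightarrow> edge) \<Rightarrow> bool"
  where "fixes_squares \<pi> \<longleftrightarrow> \<pi> \<in> AutT \<and> (\<forall>q\<in>D. \<pi> ` Lp q = Lp q \<and> \<pi> ` Up q = Up q)"

text \<open>An upper and a lower chain have at most one edge in common.\<close>

lemma shared_fixed:
  assumes p: "fixes_squares \<pi>" and e: "p \<in> D" "q \<in> D" "e \<in> Up p" "e \<in> Lp q"
  shows "\<pi> e = e"
proof -
  have "\<pi> ` Up p = Up p" "\<pi> ` Lp q = Lp q" using p e by (auto simp: fixes_squares_def)
  then have "\<pi> e \<in> Up p" "\<pi> e \<in> Lp q" using e by blast+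
  then show ?thesis using e by (cases p; cases q) (auto simp: Up_def Lp_def)
qed

lemma partner_fixed:
  assumes p: "fixes_squares \<pi>" and q: "q \<in> D" and xy: "{x, y} = Lp q \<or> {x, y} = Up q" and x: "\<pi> x = x"
  shows "\<pi> y = y"
proof -
  have "\<pi> ` Lp q = Lp q" "\<pi> ` Up q = Up q" using p q by (auto simp: fixes_squares_def)
  then have "\<pi> ` {x, y} = {x, y}" using xy by (elim disjE) (simp_all only:)
  then have "{x, \<pi> y} = {x, y}" using x by simp
  then have "\<pi> y = y \<or> x = y \<and> \<pi> y = x" by (simp only: doubleton_eq_iff simp_thms)
  then show ?thesis by auto
qed

text \<open>A square other than the least one shares an edge of its lower chain with a lower
  neighbour; that edge is fixed, and so is its partner in the chain.\<close>

lemma fix_Lp: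
  assumes p: "fixes_squares \<pi>" and q: "(r, c) \<in> D" "(r, c) \<noteq> (0, 0)"
  shows "\<pi> (Ve r c) = Ve r c" "\<pi> (Ho r c) = Ho r c"
proof -
  have L: "{Ve r c, Ho r c} = Lp (r, c)" "{Ho r c, Ve r c} = Lp (r, c)" by (auto simp: Lp_def)
  have *: "\<pi> (Ve r c) = Ve r c \<or> \<pi> (Ho r c) = Ho r c"
  proof (cases r)
    case 0
    then obtain d where d: "c = Suc d" using q by (cases c) auto
    have "(r, d) \<in> D" using D_down[OF q(1)] d by simp
    then have "\<pi> (Ve r c) = Ve r c"
      by (rule shared_fixed[OF p _ q(1)]) (auto simp: Up_def Lp_def d)
    then show ?thesis ..
  next
    case (Suc u)
    have "(u, c) \<in> D" using D_down[OF q(1)] Suc by simp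
    then have "\<pi> (Ho r c) = Ho r c"
      by (rule shared_fixed[OF p _ q(1)]) (auto simp: Up_def Lp_def Suc)
    then show ?thesis ..
  qed
  show "\<pi> (Ve r c) = Ve r c" using * partner_fixed[OF p q(1) disjI1[OF L(2)]] by blast
  show "\<pi> (Ho r c) = Ho r c" using * partner_fixed[OF p q(1) disjI1[OF L(1)]] by blast
qed

lemma fix_Up:
  assumes p: "fixes_squares \<pi>" and q: "(r, c) \<in> D" "(Suc r, c) \<in> D \<or> (r, Suc c) \<in> D"
  shows "\<pi> (Ho (Suc r) c) = Ho (Suc r) c" "\<pi> (Ve r (Suc c)) = Ve r (Suc c)"
proof -
  have U: "{Ho (Suc r) c, Ve r (Suc c)} = Up (r, c)" "{Ve r (Suc c), Ho (Suc r) c} = Up (r, c)"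
    by (auto simp: Up_def)
  have *: "\<pi> (Ho (Suc r) c) = Ho (Suc r) c \<or> \<pi> (Ve r (Suc c)) = Ve r (Suc c)"
    using q(2)
  proof
    assume "(Suc r, c) \<in> D"
    then have "\<pi> (Ho (Suc r) c) = Ho (Suc r) c"
      by (rule shared_fixed[OF p q(1)]) (auto simp: Up_def Lp_def)
    then show ?thesis ..
  next
    assume "(r, Suc c) \<in> D"
    then have "\<pi> (Ve r (Suc c)) = Ve r (Suc c)"
      by (rule shared_fixed[OF p q(1)]) (auto simp: Up_def Lp_def)
    then show ?thesis ..
  qed
  show "\<pi> (Ho (Suc r) c) = Ho (Suc r) c" using * partner_fixed[OF p q(1) disjI2[OF U(2)]] by blast
  show "\<pi> (Ve r (Suc c)) = Ve r (Suc c)" using * partner_fixed[OF p q(1) disjI2[OF U(1)]] by blast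
qed

lemma pendant_iff:
  "e \<in> P1 \<union> Pm \<longleftrightarrow> e \<in> E \<and> (\<forall>q\<in>D. e \<notin> Lp q \<and> e \<notin> Up q)"
proof (cases e)
  case (Ho r c)
  have L: "e \<in> Lp q \<longleftrightarrow> q = (r, c)" for q by (cases q) (auto simp: Ho Lp_def)
  have U: "e \<in> Up q \<longleftrightarrow> r = Suc (fst q) \<and> c = snd q" for q by (cases q) (auto simp: Ho Up_def)
  have "e \<in> P1 \<union> Pm \<longleftrightarrow> r = 0 \<and> (0, Suc c) \<in> H \<and> (1, Suc c) \<notin> H" by (auto simp: Ho P1_def Pm_def)
  moreover have "e \<in> E \<longleftrightarrow> (r, Suc c) \<in> H" by (simp add: Ho Ho_in_E)
  moreover have "(\<forall>q\<in>D. e \<notin> Lp q \<and> e \<notin> Up q) \<longleftrightarrow> (Suc r, Suc c) \<notin> H \<and> (r = 0 \<or> (r, Suc c) \<notin> H)"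
    unfolding L U by (cases r) (auto simp: D_def)
  ultimately show ?thesis by (cases r) auto
next
  case (Ve r c)
  have L: "e \<in> Lp q \<longleftrightarrow> q = (r, c)" for q by (cases q) (auto simp: Ve Lp_def)
  have U: "e \<in> Up q \<longleftrightarrow> r = fst q \<and> c = Suc (snd q)" for q by (cases q) (auto simp: Ve Up_def)
  have "e \<in> P1 \<union> Pm \<longleftrightarrow> c = 0 \<and> (Suc r, 0) \<in> H \<and> (Suc r, 1) \<notin> H" by (auto simp: Ve P1_def Pm_def)
  moreover have "e \<in> E \<longleftrightarrow> (Suc r, c) \<in> H" by (simp add: Ve Ve_in_E)
  moreover have "(\<forall>q\<in>D. e \<notin> Lp q \<and> e \<notin> Up q) \<longleftrightarrow> (Suc r, Suc c) \<notin> H \<and> (c = 0 \<or> (Suc r, c) \<notin> H)"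
    unfolding L U by (cases c) (auto simp: D_def intro!: gr0I)
  ultimately show ?thesis by (cases c) auto
qed

lemma pendant_image:
  assumes p: "fixes_squares \<pi>" and e: "e \<in> P1 \<union> Pm"
  shows "\<pi> e \<in> P1 \<union> Pm"
proof -
  have A: "\<pi> \<in> AutT" and L: "\<And>q. q \<in> D \<Longrightarrow> \<pi> ` Lp q = Lp q" and U: "\<And>q. q \<in> D \<Longrightarrow> \<pi> ` Up q = Up q"
    using p by (auto simp: fixes_squares_def)
  have "\<pi> e \<notin> Lp q \<and> \<pi> e \<notin> Up q" if q: "q \<in> D" for q
  proof -
    have "e \<notin> Lp q" "e \<notin> Up q" using e q unfolding pendant_iff by auto
    then have "\<pi> e \<notin> \<pi> ` Lp q" "\<pi> e \<notin> \<pi> ` Up q" using AutT_inj[OF A] by (simp_all add: inj_image_mem_iff)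
    then show ?thesis using L[OF q] U[OF q] by simp
  qed
  then show ?thesis using e AutT_E[OF A] unfolding pendant_iff by auto
qed

lemma P1_E: "P1 \<subseteq> E" and Pm_E: "Pm \<subseteq> E"
  by (auto simp: P1_def Pm_def Ve_in_E Ho_in_E)

lemma P1_bounds:
  assumes "Ve r c \<in> P1"
  shows "c = 0" "t 2 \<le> r" "r < t 1"
proof -
  have rc: "c = 0" "(Suc r, 0) \<in> H" "(Suc r, 1) \<notin> H" using assms by (auto simp: P1_def)
  then show "c = 0" by simp
  have "below (mk 1) (Suc r, 0)" by (rule mk_first[OF rc(2)])
  then show "r < t 1" by (simp add: below_def mk_def)
  show "t 2 \<le> r"
  proof (rule ccontr)
    assume "\<not> t 2 \<le> r"
    then have "(Suc r, 1) \<in> H"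
      using H_down[of "t 2" "s 1" "Suc r" 1] mk_in_H[of 2] s_pos[of 1] m3 by (simp add: mk_def)
    then show False using rc by simp
  qed
qed

lemma outE_1_P1: "outE 1 \<in> P1"
proof -
  have "0 < t 1" using t_pos[of 1] m3 by simp
  then have "(Suc (t 1 - 1), 0) = mk 1" by (simp add: mk_def)
  moreover have "mk 1 \<in> H" "(Suc (t 1 - 1), 1) \<notin> H" using mk_corner(2)[of 1] \<open>0 < t 1\<close> m3 by auto
  ultimately show ?thesis by (auto simp: outE_def P1_def)
qed

lemma inE_m_Pm: "inE m \<in> Pm"
proof -
  have "0 < s (m - 1)" using s_pos[of "m - 1"] m3 by simp
  then have "(0, Suc (s (m - 1) - 1)) = mk m" by (simp add: mk_def)
  moreover have "mk m \<in> H" "(1, Suc (s (m - 1) - 1)) \<notin> H" using mk_corner(1)[of m] \<open>0 < s (m - 1)\<close> m3 by auto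
  ultimately show ?thesis by (auto simp: inE_def Pm_def)
qed

lemma P1_Pm_disjoint: "P1 \<inter> Pm = {}"
  by (auto simp: P1_def Pm_def)

section \<open>Test points against the paths between marks\<close>

lemma Rb_Suc:
  assumes "Suc r \<notin> t ` {1..m - 1}"
  shows "Rb (Suc r) = Rb r"
proof -
  have "{l \<in> {1..m - 1}. r < t l} = {l \<in> {1..m - 1}. Suc r < t l}"
  proof -
    have "r < t l \<longleftrightarrow> Suc r < t l" if "l \<in> {1..m - 1}" for l
    proof -
      have "Suc r \<noteq> t l" using assms that by auto
      then show ?thesis by auto
    qed
    then show ?thesis by auto
  qed
  then show ?thesis by (simp add: Rb_def)
qed

lemma Rb_pos: "1 \<le> Rb r"
  by (simp add: Rb_def)

lemma Rb_0: "Rb 0 = m"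
  using Rb_mk[of m] m3 by simp

lemma Rb_le: "Rb r \<le> m"
  using Rb_anti[of 0 r] by (simp add: Rb_0)

text \<open>A point separating the values along the column of \<open>mk 1\<close> exactly at a given pendant edge.\<close>

lemma pendant_cut:
  assumes e0: "e0 \<in> P1"
  obtains S where "S \<in> Ts" "\<And>e. e \<in> E \<Longrightarrow> e \<noteq> e0 \<Longrightarrow>
    e \<in> P1 \<or> (\<exists>r c. e = Ho r c) \<or> (\<exists>r c. e = Ve r c \<and> Suc r \<notin> t ` {1..m - 1}) \<Longrightarrow> e \<in> S"
proof -
  obtain r0 where r0: "e0 = Ve r0 0" "(Suc r0, 0) \<in> H" "(Suc r0, 1) \<notin> H" using e0 by (auto simp: P1_def)
  have b: "t 2 \<le> r0" "r0 < t 1" using P1_bounds[of r0 0] e0 r0 by auto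
  \<comment> \<open>Rows beyond \<open>r0\<close> are held down to the value 1 of
    \<open>mk 1\<close>, all others are raised as far as possible. In the first column this moves
    the jump above the value 1 to \<open>e0\<close>.\<close>
  define w where "w r = (if r0 < r then 1 else Rb r)" for r
  have S: "tt (rowpt w) \<in> Ts"
    by (rule rowpt_Ts) (use Rb_anti Rb_pos in \<open>auto simp: w_def antimono_def\<close>)
  have "e \<in> tt (rowpt w)" if e: "e \<in> E" "e \<noteq> e0" and h: "e \<in> P1 \<or> (\<exists>r c. e = Ho r c) \<or> (\<exists>r c. e = Ve r c \<and> Suc r \<notin> t ` {1..m - 1})" for e
  proof (cases e)
    case (Ho r c)
    have "\<not> r0 < r"
    proof
      assume "r0 < r"
      then have "(Suc r0, 1) \<in> H" using H_down[of r "Suc c" "Suc r0" 1] e(1) by (simp add: Ho Ho_in_E)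
      then show False using r0 by simp
    qed
    then show ?thesis using e(1) by (auto simp: Ho w_def intro: rowpt_Ho_Rb)
  next
    case (Ve r c)
    have H: "(Suc r, c) \<in> H" using e(1) by (simp add: Ve Ve_in_E)
    consider "r0 < r" | "r = r0" | "r < r0" by linarith
    then show ?thesis
    proof cases
      case 1
      then have "w (Suc r) = w r" by (simp add: w_def)
      then show ?thesis using e(1) unfolding Ve by (intro rowpt_Ve) auto
    next
      case 2
      have "c \<noteq> 0" using e(2) 2 r0(1) Ve by auto
      then have "(Suc r0, 1) \<in> H" using H_down[OF H, of "Suc r0" 1] 2 by simp
      then show ?thesis using r0 by simp
    next
      case 3
      have "Suc r \<notin> t ` {1..m - 1}"
      proof (cases "e \<in> P1")
        case True
        then have r: "t 2 \<le> r" using P1_bounds[of r c] Ve by simp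
        show ?thesis
        proof
          assume "Suc r \<in> t ` {1..m - 1}"
          then obtain l where l: "l \<in> {1..m - 1}" "Suc r = t l" by auto
          then have "l \<le> m" by auto
          then have "1 < l" "l < 2" using l r 3 b t_less_iff[of 2 l] t_less_iff[of l 1] m3 by auto
          then show False by simp
        qed
      next
        case False
        then show ?thesis using h Ve by auto
      qed
      then have "w (Suc r) = w r" using 3 Rb_Suc by (simp add: w_def)
      then show ?thesis using e(1) unfolding Ve by (intro rowpt_Ve) auto
    qed
  qed
  then show thesis by (rule that[OF S])
qed

text \<open>A point in which \<open>mk m\<close> is separated from \<open>mk (m - 1)\<close> below the first row.\<close>

lemma last_row_cut:
  assumes "2 \<le> t (m - 1)"
  obtains S where "S \<in> Ts" "\<And>e. e \<in> E \<Longrightarrow>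
    (\<exists>r c. e = Ho r c) \<or> (\<exists>r c. e = Ve r c \<and> r \<noteq> 0 \<and> Suc r \<notin> t ` {1..m - 2}) \<Longrightarrow> e \<in> S"
proof -
  \<comment> \<open>Capping all rows but the first at \<open>m - 1\<close> moves the jump to the
    value \<open>m\<close> up to the vertical edges between rows 0 and 1.\<close>
  define w where "w r = (if r = 0 then m else min (Rb r) (m - 1))" for r
  have S: "tt (rowpt w) \<in> Ts"
  proof (rule rowpt_Ts)
    show "antimono w"
      using Rb_anti by (fastforce simp: w_def antimono_def min_def)
    show "w r \<le> Rb r" for r by (simp add: w_def Rb_0)
  qed
  have "e \<in> tt (rowpt w)" if e: "e \<in> E" and h: "(\<exists>r c. e = Ho r c) \<or> (\<exists>r c. e = Ve r c \<and> r \<noteq> 0 \<and> Suc r \<notin> t ` {1..m - 2})" for e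
  proof (cases e)
    case (Ho r c)
    have H: "(r, Suc c) \<in> H" using e by (simp add: Ho Ho_in_E)
    have "Bb (Suc c) \<le> w r"
    proof (cases "r = 0")
      case True
      then show ?thesis using H_Bb_le_Rb[OF H] by (simp add: w_def Rb_0)
    next
      case False
      have "Bb (Suc c) \<noteq> m"
      proof
        assume m: "Bb (Suc c) = m"
        then have "(r, Suc c) \<notin> Q" using Q_iff[of r "Suc c"] Rb_le[of r] by simp
        then obtain l where l: "l \<in> {1..m}" "(r, Suc c) = mk l" using H by (auto simp: H_def)
        then have "l = m" using Bb_mk[of l] m by (simp add: mk_def)
        then show False using l False by (simp add: mk_def)
      qed
      then show ?thesis using H_Bb_le_Rb[OF H] Rb_le[of r] False by (simp add: w_def)
    qed
    then show ?thesis using e by (simp add: Ho rowpt_Ho)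
  next
    case (Ve r c)
    then have r: "r \<noteq> 0" "Suc r \<notin> t ` {1..m - 2}" using h by auto
    have "w (Suc r) = w r"
    proof (cases "Suc r = t (m - 1)")
      case True
      have "Rb (Suc r) = m - 1" using True Rb_mk[of "m - 1"] m3 by simp
      then show ?thesis using Rb_anti[of r "Suc r"] r by (simp add: w_def)
    next
      case False
      have "{1..m - 1} = insert (m - 1) {1..m - 2}" using m3 by auto
      then have "Suc r \<notin> t ` {1..m - 1}" using r False by simp
      then show ?thesis using Rb_Suc r by (simp add: w_def)
    qed
    then show ?thesis using e unfolding Ve by (intro rowpt_Ve) auto
  qed
  then show thesis by (rule that[OF S])
qed

lemma Xp_noncrossing:
  assumes k: "1 \<le> k" "k < m" and r: "t (Suc k) \<le> r" "Suc r < t k"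
  shows "Suc r \<notin> t ` {1..m - 1}"
proof
  assume "Suc r \<in> t ` {1..m - 1}"
  then obtain l where l: "l \<in> {1..m - 1}" "Suc r = t l" by auto
  then have "l \<le> m" by auto
  then have "k < l" "l < Suc k" using l r k t_less_iff[of l k] t_less_iff[of "Suc k" l] by auto
  then show False by simp
qed

text \<open>Away from the marks, an edge of the path is pendant, lies in the lower chain of a square
  other than the least one, or lies in an upper chain with another square beyond it; in the last two
  cases \<open>fix_Lp\<close> or \<open>fix_Up\<close> applies.\<close>

lemma Xp_fixed:
  assumes p: "fixes_squares \<pi>" and k: "1 \<le> k" "k < m" and x: "x \<in> Xp k"
  shows "x = outE k \<or> x = inE (Suc k) \<or> x \<in> P1 \<union> Pm \<or> \<pi> x = x"
  using x
proof (cases rule: Xp_cases)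
  case (2 r)
  have H: "(Suc (Suc r), s (k - 1)) \<in> H"
    using H_down[of "t k" "s (k - 1)"] mk_in_H[of k] k 2 by (auto simp: mk_def)
  show ?thesis
  proof (cases "s (k - 1)")
    case (Suc u)
    have "(Suc r, u) \<in> D" using H unfolding Suc by (simp add: D_def)
    moreover from this have "(r, u) \<in> D" by (rule D_down) auto
    ultimately show ?thesis using fix_Up(2)[OF p, of r u] 2 Suc by simp
  next
    case 0
    have "k - 1 \<le> m" using k by simp
    then have "k - 1 = 0" using 0 s_pos[of "k - 1"] by (cases "k - 1 = 0") auto
    \<comment> \<open>This keeps the edge away from the exchangeable pair at
      \<open>(0, 0)\<close>.\<close>
    then have r: "0 < r" using 2 t_pos[of 2] k m3 by (auto simp: numeral_2_eq_2)
    show ?thesis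
    proof (cases "(Suc r, 1) \<in> H")
      case True
      then have "\<pi> x = x" using fix_Lp(1)[OF p, of r 0] r 2 0 by (simp add: D_def)
      then show ?thesis by simp
    next
      case False
      have "(Suc r, 0) \<in> H" using H_down[OF H] by simp
      then have "x \<in> P1" using False 2 0 by (auto simp: P1_def)
      then show ?thesis by simp
    qed
  qed
next
  case (3 c)
  show ?thesis
  proof (cases "Suc c = s k")
    case True
    then show ?thesis using 3 by (simp add: inE_def flip: True)
  next
    case False
    then have H: "(t (Suc k), Suc (Suc c)) \<in> H"
      using H_down[of "t (Suc k)" "s k"] mk_in_H[of "Suc k"] k 3 by (auto simp: mk_def)
    show ?thesis
    proof (cases "t (Suc k)")
      case (Suc u)
      have "(u, Suc c) \<in> D" using H by (simp add: D_def Suc)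
      moreover from this have "(u, c) \<in> D" by (rule D_down) auto
      ultimately show ?thesis using fix_Up(1)[OF p, of u c] 3 Suc by simp
    next
      case 0
      have "Suc k = m" using 0 t_pos[of "Suc k"] k by (cases "Suc k = m") auto
      then have "0 < k - 1" "k - 1 \<le> m" using k m3 by auto
      then have c: "0 < c" using 3 s_pos[of "k - 1"] by auto
      show ?thesis
      proof (cases "(1, Suc c) \<in> H")
        case True
        then have "\<pi> x = x" using fix_Lp(2)[OF p, of 0 c] c 3 0 by (simp add: D_def)
        then show ?thesis by simp
      next
        case False
        have "(0, Suc c) \<in> H" using H_down[OF H] 0 by simp
        then have "x \<in> Pm" using False 3 0 by (auto simp: Pm_def)
        then show ?thesis by simp
      qed
    qed
  qed
qed simp

lemma Xp_P1:
  assumes "2 \<le> k" "k \<le> m"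
  shows "Xp k \<inter> P1 = {}"
proof -
  have "0 < k - 1" "k - 1 \<le> m" using assms by auto
  then have "0 < s (k - 1)" by (rule s_pos)
  then show ?thesis by (auto simp: Xp_def P1_def)
qed

lemma Xp_Pm:
  assumes "Suc k < m"
  shows "Xp k \<inter> Pm = {}"
  using t_pos[of "Suc k"] assms by (auto simp: Xp_def Pm_def)

text \<open>\<open>Xp_image\<close> as a checklist. The inner edges of the path are fixed, so it
  remains to locate the images of its pendant edges and of its edges at inner marks in one tight
  set.\<close>

lemma Xp_refute:
  assumes p: "fixes_squares \<pi>" and k: "1 \<le> k" "k < m" and S: "S \<in> Ts"
    and pend: "\<And>x. x \<in> Xp k \<Longrightarrow> x \<in> P1 \<union> Pm \<Longrightarrow> \<pi> x \<in> S"
    and outE: "2 \<le> k \<Longrightarrow> \<pi> (outE k) \<in> S" and inE: "Suc k < m \<Longrightarrow> \<pi> (inE (Suc k)) \<in> S"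
    and Ve: "\<And>r. Ve r (s (k - 1)) \<in> E - P1 \<Longrightarrow> t (Suc k) \<le> r \<Longrightarrow> Suc r \<notin> t ` {1..m - 1} \<Longrightarrow>
      Ve r (s (k - 1)) \<in> S"
    and Ho: "\<And>c. Ho (t (Suc k)) c \<in> E - Pm \<Longrightarrow> s (k - 1) \<le> c \<Longrightarrow> Suc c < s k \<Longrightarrow>
      Ho (t (Suc k)) c \<in> S"
  shows False
proof (rule Xp_image[OF _ k S])
  show "\<pi> \<in> AutT" using p by (simp add: fixes_squares_def)
  fix x assume x: "x \<in> Xp k"
  have xE: "x \<in> E" using Xp_E[OF k] x by auto
  consider "x \<in> P1 \<union> Pm" | "x = outE k" "x \<notin> P1 \<union> Pm" | "x = inE (Suc k)" "x \<notin> P1 \<union> Pm"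
    | "\<pi> x = x" "x \<notin> P1 \<union> Pm" "x \<noteq> outE k" "x \<noteq> inE (Suc k)"
    using Xp_fixed[OF p k x] by argo
  then show "\<pi> x \<in> S"
  proof cases
    case 1
    then show ?thesis using pend x by simp
  next
    case 2
    then have "k \<noteq> 1" using outE_1_P1 by (intro notI) simp
    then show ?thesis using 2 outE k by simp
  next
    case 3
    then have "Suc k \<noteq> m" using inE_m_Pm by (intro notI) simp
    then show ?thesis using 3 inE k by simp
  next
    case 4
    from x have "x \<in> S"
    proof (cases rule: Xp_cases)
      case (2 r)
      then show ?thesis using Ve[of r] Xp_noncrossing[OF k] 4(2) xE by simp
    next
      case (3 c)
      then have "Suc c \<noteq> s k" using 4(4) by (auto simp: inE_def)
      then show ?thesis using Ho[of c] 3 4(2) xE by simp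
    qed (use 4 in simp)
    then show ?thesis using 4(1) by simp
  qed
qed

lemma mark_pair_image:
  assumes p: "fixes_squares \<pi>" and k: "2 \<le> k" "k < m"
  shows "\<pi> (inE k) = inE k \<and> \<pi> (outE k) = outE k \<or> \<pi> (inE k) = outE k \<and> \<pi> (outE k) = inE k"
proof -
  have "\<pi> ` Up (qk k) = Up (qk k)" using p qk_D(1)[OF k] by (simp add: fixes_squares_def)
  then have "{\<pi> (inE k), \<pi> (outE k)} = {inE k, outE k}" unfolding qk_D(2)[OF k] by simp
  then show ?thesis by (simp only: doubleton_eq_iff)
qed

text \<open>The threshold follows \<open>Rb\<close> up to the value \<open>q\<close> and stays one
  behind it beyond. Hence the jump at an inner mark \<open>k\<close> happens on
  \<open>outE k\<close> for \<open>k < q\<close> and on \<open>inE k\<close> for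
  \<open>k > q\<close>, while at the mark \<open>q\<close> both edges are tight.\<close>

lemma block_point:
  fixes q :: nat
  defines "w \<equiv> \<lambda>r. if Rb r \<le> q then Rb r else Rb r - 1"
  assumes q: "1 \<le> q"
  shows "tt (rowpt w) \<in> Ts"
    and "2 \<le> k \<Longrightarrow> k < m \<Longrightarrow> k \<le> q \<Longrightarrow> inE k \<in> tt (rowpt w)"
    and "2 \<le> k \<Longrightarrow> k < m \<Longrightarrow> q \<le> k \<Longrightarrow> outE k \<in> tt (rowpt w)"
    and "Ve r c \<in> E \<Longrightarrow> Suc r \<notin> t ` {1..m - 1} \<Longrightarrow> Ve r c \<in> tt (rowpt w)"
    and "(r, Suc c) \<in> Q \<Longrightarrow> Ho r c \<in> tt (rowpt w)"
proof -
  have anti: "w r' \<le> w r" if "r \<le> r'" for r r'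
    using Rb_anti[OF that] by (auto simp: w_def)
  show "tt (rowpt w) \<in> Ts"
    by (rule rowpt_Ts) (use anti in \<open>auto simp: antimono_def w_def\<close>)
  show "inE k \<in> tt (rowpt w)" if k: "2 \<le> k" "k < m" "k \<le> q"
    using in_out_E(1)[OF k(1,2)] Rb_mk[of k] k by (auto simp: inE_def w_def intro!: rowpt_Ho_Rb)
  show "outE k \<in> tt (rowpt w)" if k: "2 \<le> k" "k < m" "q \<le> k"
  proof -
    have "t (Suc k) < t k" using t_less_iff[of "Suc k" k] k by simp
    then have "Rb (t k - 1) = Suc k" using Rb_block[of k "t k - 1"] k by simp
    then have "w (t k - 1) \<le> Bb (s (k - 1))" using k Bb_mk[of k] by (simp add: w_def)
    moreover have "w (Suc (t k - 1)) \<le> w (t k - 1)" by (rule anti) simp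
    ultimately show ?thesis using in_out_E(2)[OF k(1,2)] unfolding outE_def by (intro rowpt_Ve) auto
  qed
  show "Ve r c \<in> tt (rowpt w)" if "Ve r c \<in> E" "Suc r \<notin> t ` {1..m - 1}"
    using that Rb_Suc by (intro rowpt_Ve) (auto simp: w_def)
  show "Ho r c \<in> tt (rowpt w)" if "(r, Suc c) \<in> Q"
    by (rule rowpt_Ho_Q[OF that]) (auto simp: w_def)
qed

lemma Xp_Ho_Q: "1 \<le> k \<Longrightarrow> k < m \<Longrightarrow> Suc c < s k \<Longrightarrow> (t (Suc k), Suc c) \<in> Q"
  by (rule below_mk_Q[of "Suc k"]) (auto simp: mk_def)

text \<open>Choose the block point for \<open>q = Suc k\<close>: the supposed image
  \<open>inE k\<close> of the first edge of the path is tight, and the last edge is sent to a tight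
  edge whether or not the pair at \<open>mk (Suc k)\<close> is exchanged.\<close>

lemma no_flip_lower:
  assumes p: "fixes_squares \<pi>" and k: "2 \<le> k" "Suc k < m"
  shows "\<pi> (outE k) = outE k"
proof (rule ccontr)
  assume "\<pi> (outE k) \<noteq> outE k"
  then have fl: "\<pi> (outE k) = inE k" using mark_pair_image[OF p, of k] k by auto
  have q: "1 \<le> Suc k" and k': "1 \<le> k" "k < m" using k by auto
  note bp = block_point[OF q]
  show False
  proof (rule Xp_refute[OF p k' bp(1)], goal_cases)
    case (1 x)
    then show ?case using Xp_P1[of k] Xp_Pm[of k] k by auto
  next
    case 2
    then show ?case using fl bp(2)[of k] k by simp
  next
    case 3
    then show ?case using bp(2,3)[of "Suc k"] mark_pair_image[OF p, of "Suc k"] k by auto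
  qed (use bp(4,5) Xp_Ho_Q[OF k'] in auto)
qed

text \<open>The mirror image with \<open>q = k\<close>: the first edge of the path may go to either
  edge at \<open>mk k\<close>, and the last one is supposed to go to the tight edge
  \<open>outE (Suc k)\<close>.\<close>

lemma no_flip_upper:
  assumes p: "fixes_squares \<pi>" and k: "2 \<le> k" "Suc k < m"
  shows "\<pi> (inE (Suc k)) = inE (Suc k)"
proof (rule ccontr)
  assume "\<pi> (inE (Suc k)) \<noteq> inE (Suc k)"
  then have fl: "\<pi> (inE (Suc k)) = outE (Suc k)" using mark_pair_image[OF p, of "Suc k"] k by auto
  have k': "1 \<le> k" "k < m" using k by auto
  note bp = block_point[OF k'(1)]
  show False
  proof (rule Xp_refute[OF p k' bp(1)], goal_cases)
    case (1 x)
    then show ?case using Xp_P1[of k] Xp_Pm[of k] k by auto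
  next
    case 2
    then show ?case using bp(2,3)[of k] mark_pair_image[OF p, of k] k by auto
  next
    case 3
    then show ?case using fl bp(3)[of "Suc k"] k by simp
  qed (use bp(4,5) Xp_Ho_Q[OF k'] in auto)
qed

definition fixes_marks :: "(edge \<Rightarrow> edge) \<Rightarrow> bool"
  where "fixes_marks \<pi> \<longleftrightarrow> (\<forall>k. 2 \<le> k \<and> k < m \<longrightarrow> \<pi> (inE k) = inE k \<and> \<pi> (outE k) = outE k)"

text \<open>For \<open>m \<ge> 4\<close> every inner mark has another inner mark next to it, so one
  of the two preceding arguments applies to it.\<close>

lemma fixes_marks_ge4:
  assumes p: "fixes_squares \<pi>" and m4: "4 \<le> m"
  shows "fixes_marks \<pi>"
  unfolding fixes_marks_def
proof (intro allI impI, elim conjE)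
  fix k assume k: "2 \<le> k" "k < m"
  have "\<pi> (outE k) = outE k \<or> \<pi> (inE k) = inE k"
  proof (cases "Suc k < m")
    case True
    then show ?thesis using no_flip_lower[OF p k(1)] by simp
  next
    case False
    then show ?thesis using no_flip_upper[OF p, of "k - 1"] k m4 by simp
  qed
  then show "\<pi> (inE k) = inE k \<and> \<pi> (outE k) = outE k"
    using mark_pair_image[OF p k] in_out_E(3)[OF k] by auto
qed

lemma finite_pendants: "finite P1" "finite Pm"
  using finite_subset[OF P1_E finite_E] finite_subset[OF Pm_E finite_E] by auto

lemma pendant_cut_image:
  assumes p: "fixes_squares \<pi>" and x: "x \<in> P \<inter> (P1 \<union> Pm)" and e0: "e0 \<notin> \<pi> ` P"
  shows "\<pi> x \<in> E" "\<pi> x \<noteq> e0" "\<pi> x \<in> P1 \<union> Pm"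
  using pendant_image[OF p, of x] x e0 P1_E Pm_E by auto

text \<open>If \<open>e0\<close> in \<open>P1\<close> were missed by the image, the point cut at
  \<open>e0\<close> would have the image of all of \<open>Xp 1\<close> tight; \<open>inE 2\<close>
  is fixed and horizontal, hence tight there. Counting turns the inclusion into equality.\<close>

lemma fixes_P1:
  assumes p: "fixes_squares \<pi>" and fm: "fixes_marks \<pi>"
  shows "\<pi> ` P1 = P1"
proof -
  have A: "\<pi> \<in> AutT" using p by (simp add: fixes_squares_def)
  have k: "1 \<le> (1::nat)" "1 < m" using m3 by auto
  have "P1 \<subseteq> \<pi> ` P1"
  proof (rule ccontr)
    assume "\<not> P1 \<subseteq> \<pi> ` P1"
    then obtain e0 where e0: "e0 \<in> P1" "e0 \<notin> \<pi> ` P1" by auto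
    then obtain r0 where r0: "e0 = Ve r0 0" by (auto simp: P1_def)
    show False
    proof (rule pendant_cut[OF e0(1)])
      fix S
      assume S: "S \<in> Ts" "\<And>e. e \<in> E \<Longrightarrow> e \<noteq> e0 \<Longrightarrow>
        e \<in> P1 \<or> (\<exists>r c. e = Ho r c) \<or> (\<exists>r c. e = Ve r c \<and> Suc r \<notin> t ` {1..m - 1}) \<Longrightarrow> e \<in> S"
      show False
      proof (rule Xp_refute[OF p k S(1)], goal_cases)
        case (1 x)
        then have "x \<in> P1 \<inter> (P1 \<union> Pm)" using Xp_Pm[of 1] m3 by auto
        from pendant_cut_image[OF p this e0(2)] show ?case using S(2)[of "\<pi> x"] by (auto simp: Pm_def)
      next
        case 3
        have "2 \<le> (2::nat)" "2 < m" using m3 by auto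
        then show ?case using S(2)[of "inE 2"] fm in_out_E[of 2] r0
          by (auto simp: fixes_marks_def numeral_2_eq_2 inE_def)
      next
        case (4 r)
        then show ?case using S(2)[of "Ve r (s (1 - 1))"] e0(1) by auto
      next
        case (5 c)
        then show ?case using S(2)[of "Ho (t (Suc 1)) c"] r0 by auto
      qed simp
    qed
  qed
  moreover have "card (\<pi> ` P1) = card P1" using AutT_inj[OF A] by (simp add: card_image inj_on_subset)
  ultimately show ?thesis using finite_pendants card_subset_eq[of "\<pi> ` P1" P1] by simp
qed

lemma fixes_Pm:
  assumes p: "fixes_squares \<pi>" and P1: "\<pi> ` P1 = P1"
  shows "\<pi> ` Pm = Pm"
proof -
  have A: "\<pi> \<in> AutT" using p by (simp add: fixes_squares_def)
  have "\<pi> ` Pm \<subseteq> Pm"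
  proof
    fix y assume "y \<in> \<pi> ` Pm"
    then obtain x where x: "x \<in> Pm" "y = \<pi> x" by auto
    then have "y \<in> P1 \<union> Pm" using pendant_image[OF p, of x] by simp
    moreover have "y \<notin> \<pi> ` P1" using x AutT_inj[OF A] P1_Pm_disjoint by (auto simp: inj_image_mem_iff)
    ultimately show "y \<in> Pm" using P1 by simp
  qed
  moreover have "card (\<pi> ` Pm) = card Pm" using AutT_inj[OF A] by (simp add: card_image inj_on_subset)
  ultimately show ?thesis using finite_pendants card_subset_eq[of Pm "\<pi> ` Pm"] by simp
qed

end

section \<open>Transfer of the test points to the last mark\<close>

context dual_pair begin

lemma BP1: "e \<in> A.Pm \<Longrightarrow> tau e \<in> B.P1"
  by (auto simp: A.Pm_def B.P1_def BH)

lemma Bt_image: "j \<le> m \<Longrightarrow> B.t ` {1..j} = s ` {m - j..m - 1}"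
proof
  assume j: "j \<le> m"
  show "B.t ` {1..j} \<subseteq> s ` {m - j..m - 1}" using j by (auto simp: Bt intro!: imageI)
  show "s ` {m - j..m - 1} \<subseteq> B.t ` {1..j}"
  proof
    fix y assume "y \<in> s ` {m - j..m - 1}"
    then obtain i where i: "i \<in> {m - j..m - 1}" "y = s i" by auto
    then have "y = B.t (m - i)" "m - i \<in> {1..j}" using j A.m3 by (auto simp: Bt)
    then show "y \<in> B.t ` {1..j}" by blast
  qed
qed

lemma pull_back:
  assumes "S \<in> B.Ts"
  shows "tau ` S \<in> A.Ts" "e \<in> tau ` S \<longleftrightarrow> tau e \<in> S"
proof -
  interpret dual: dual_pair m s' s by (rule flip_dual)
  show "tau ` S \<in> A.Ts" by (rule dual.tau_Ts[OF assms])
  show "e \<in> tau ` S \<longleftrightarrow> tau e \<in> S"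
    using inj_image_mem_iff[OF inj_tau, of "tau e" S] by simp
qed

end

context shape begin

lemma pendant_cut_dual:
  assumes e0: "e0 \<in> Pm"
  obtains S where "S \<in> Ts" "\<And>e. e \<in> E \<Longrightarrow> e \<noteq> e0 \<Longrightarrow>
    e \<in> Pm \<or> (\<exists>r c. e = Ve r c) \<or> (\<exists>r c. e = Ho r c \<and> Suc c \<notin> s ` {1..m - 1}) \<Longrightarrow> e \<in> S"
proof -
  interpret dp: dual_pair m s "\<lambda>k. t (m - k)" by (rule dual_pair_dual)
  show thesis
  proof (rule dp.B.pendant_cut[OF dp.BP1[OF e0]])
    fix S
    assume S: "S \<in> dp.B.Ts" "\<And>e. e \<in> dp.B.E \<Longrightarrow> e \<noteq> tau e0 \<Longrightarrow> e \<in> dp.B.P1 \<or> (\<exists>r c. e = Ho r c) \<or>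
        (\<exists>r c. e = Ve r c \<and> Suc r \<notin> dp.B.t ` {1..m - 1}) \<Longrightarrow> e \<in> S"
    have "e \<in> tau ` S" if e: "e \<in> E" "e \<noteq> e0"
      and h: "e \<in> Pm \<or> (\<exists>r c. e = Ve r c) \<or> (\<exists>r c. e = Ho r c \<and> Suc c \<notin> s ` {1..m - 1})" for e
    proof -
      have "tau e \<noteq> tau e0" using e(2) inj_tau by (simp add: inj_eq)
      moreover have "dp.B.t ` {1..m - 1} = s ` {1..m - 1}" using dp.Bt_image[of "m - 1"] m3 by simp
      then have "tau e \<in> dp.B.P1 \<or> (\<exists>r c. tau e = Ho r c) \<or>
          (\<exists>r c. tau e = Ve r c \<and> Suc r \<notin> dp.B.t ` {1..m - 1})"
        using h dp.BP1[of e] by auto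
      ultimately have "tau e \<in> S" using S(2)[of "tau e"] dp.BE e(1) by simp
      then show ?thesis using dp.pull_back(2)[OF S(1)] by simp
    qed
    then show thesis by (rule that[OF dp.pull_back(1)[OF S(1)]])
  qed
qed

lemma last_row_cut_dual:
  assumes "2 \<le> s 1"
  obtains S where "S \<in> Ts" "\<And>e. e \<in> E \<Longrightarrow>
    (\<exists>r c. e = Ve r c) \<or> (\<exists>r c. e = Ho r c \<and> c \<noteq> 0 \<and> Suc c \<notin> s ` {2..m - 1}) \<Longrightarrow> e \<in> S"
proof -
  interpret dp: dual_pair m s "\<lambda>k. t (m - k)" by (rule dual_pair_dual)
  have "2 \<le> dp.B.t (m - 1)" using assms dp.Bt[of "m - 1"] m3 by simp
  then show thesis
  proof (rule dp.B.last_row_cut)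
    fix S
    assume S: "S \<in> dp.B.Ts" "\<And>e. e \<in> dp.B.E \<Longrightarrow> (\<exists>r c. e = Ho r c) \<or>
        (\<exists>r c. e = Ve r c \<and> r \<noteq> 0 \<and> Suc r \<notin> dp.B.t ` {1..m - 2}) \<Longrightarrow> e \<in> S"
    have "e \<in> tau ` S" if e: "e \<in> E"
      and h: "(\<exists>r c. e = Ve r c) \<or> (\<exists>r c. e = Ho r c \<and> c \<noteq> 0 \<and> Suc c \<notin> s ` {2..m - 1})" for e
    proof -
      have "dp.B.t ` {1..m - 2} = s ` {2..m - 1}" using dp.Bt_image[of "m - 2"] m3 by simp
      then have "(\<exists>r c. tau e = Ho r c) \<or> (\<exists>r c. tau e = Ve r c \<and> r \<noteq> 0 \<and> Suc r \<notin> dp.B.t ` {1..m - 2})"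
        using h by auto
      then have "tau e \<in> S" using S(2)[of "tau e"] dp.BE e by simp
      then show ?thesis using dp.pull_back(2)[OF S(1)] by simp
    qed
    then show thesis by (rule that[OF dp.pull_back(1)[OF S(1)]])
  qed
qed

text \<open>If the two edges at the only inner mark are exchanged, then the single square is symmetric, and
  the exchange is undone by the transposition.\<close>

lemma flipped_mark:
  assumes p: "fixes_squares \<pi>" and m: "m = 3" and nf: "\<not> fixes_marks \<pi>"
  shows "symmetric" "fixes_squares (tauE \<circ> \<pi>)" "fixes_marks (tauE \<circ> \<pi>)"
proof -
  have A: "\<pi> \<in> AutT" using p by (simp add: fixes_squares_def)
  have two: "2 \<le> (2::nat)" "2 < m" using m by auto
  have only2: "k = 2" if "2 \<le> k" "k < m" for k using that m by simp
  have fl: "\<pi> (inE 2) = outE 2" "\<pi> (outE 2) = inE 2"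
    using nf mark_pair_image[OF p two] only2 unfolding fixes_marks_def by auto
  have HoPm: "\<exists>r c. e = Ho r c" if "e \<in> Pm" for e using that by (auto simp: Pm_def)
  have VeP1: "\<exists>r c. e = Ve r c" if "e \<in> P1" for e using that by (auto simp: P1_def)
  have k1: "1 \<le> (1::nat)" "1 < m" and k2: "1 \<le> (2::nat)" "2 < m" using m by auto
  have spos: "0 < s 1" "0 < t 2" using s_pos[of 1] t_pos[of 2] m by auto
  note ioE = in_out_E(1,2)[OF two]
  have X1: "Xp 1 \<inter> Pm = {}" and X2: "Xp 2 \<inter> P1 = {}" using Xp_Pm[of 1] Xp_P1[of 2] m by auto
  have s_ge: "Suc c \<notin> s ` {1..m - 1}" if "Suc c < s 1" for c
  proof
    assume "Suc c \<in> s ` {1..m - 1}"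
    then obtain l where l: "l \<in> {1..m - 1}" "Suc c = s l" by auto
    then have "s 1 \<le> s l" using s_le_iff[of 1 l] m by auto
    then show False using that l by simp
  qed
  \<comment> \<open>The last edge \<open>inE 2\<close> of \<open>Xp 1\<close> now goes to a vertical
    edge, which stays tight under a cut through \<open>Pm\<close>. The path is therefore
    contradictory unless the image of \<open>P1\<close> hits every edge of
    \<open>Pm\<close>.\<close>
  have Pm_sub: "Pm \<subseteq> \<pi> ` P1"
  proof (rule ccontr)
    assume "\<not> Pm \<subseteq> \<pi> ` P1"
    then obtain e0 where e0: "e0 \<in> Pm" "e0 \<notin> \<pi> ` P1" by auto
    obtain c0 where c0: "e0 = Ho 0 c0" using e0 by (auto simp: Pm_def)
    show False
    proof (rule pendant_cut_dual[OF e0(1)])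
      fix S
      assume S: "S \<in> Ts" "\<And>e. e \<in> E \<Longrightarrow> e \<noteq> e0 \<Longrightarrow>
        e \<in> Pm \<or> (\<exists>r c. e = Ve r c) \<or> (\<exists>r c. e = Ho r c \<and> Suc c \<notin> s ` {1..m - 1}) \<Longrightarrow> e \<in> S"
      show False
      proof (rule Xp_refute[OF p k1 S(1)], goal_cases)
        case (1 x)
        then have "x \<in> P1 \<inter> (P1 \<union> Pm)" using X1 by auto
        from pendant_cut_image[OF p this e0(2)] show ?case using S(2)[of "\<pi> x"] VeP1[of "\<pi> x"] by blast
      next
        case 3
        then show ?case using S(2)[of "outE 2"] fl ioE c0 by (auto simp: outE_def numeral_2_eq_2)
      next
        case (4 r)
        then show ?case using S(2)[of "Ve r (s (1 - 1))"] c0 by auto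
      next
        case (5 c)
        then show ?case using S(2)[of "Ho (t (Suc 1)) c"] s_ge[of c] e0(1) by auto
      qed simp
    qed
  qed
  have P1_sub: "P1 \<subseteq> \<pi> ` Pm"
  proof (rule ccontr)
    assume "\<not> P1 \<subseteq> \<pi> ` Pm"
    then obtain e0 where e0: "e0 \<in> P1" "e0 \<notin> \<pi> ` Pm" by auto
    obtain r0 where r0: "e0 = Ve r0 0" using e0 by (auto simp: P1_def)
    show False
    proof (rule pendant_cut[OF e0(1)])
      fix S
      assume S: "S \<in> Ts" "\<And>e. e \<in> E \<Longrightarrow> e \<noteq> e0 \<Longrightarrow>
        e \<in> P1 \<or> (\<exists>r c. e = Ho r c) \<or> (\<exists>r c. e = Ve r c \<and> Suc r \<notin> t ` {1..m - 1}) \<Longrightarrow> e \<in> S"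
      show False
      proof (rule Xp_refute[OF p k2 S(1)], goal_cases)
        case (1 x)
        then have "x \<in> Pm \<inter> (P1 \<union> Pm)" using X2 by auto
        from pendant_cut_image[OF p this e0(2)] show ?case using S(2)[of "\<pi> x"] HoPm[of "\<pi> x"] by blast
      next
        case 2
        then show ?case using S(2)[of "inE 2"] fl ioE r0 by (auto simp: inE_def)
      next
        case (4 r)
        then show ?case using S(2)[of "Ve r (s (2 - 1))"] e0(1) by auto
      next
        case (5 c)
        then show ?case using S(2)[of "Ho (t (Suc 2)) c"] r0 by auto
      qed (use m in simp)
    qed
  qed
  have card: "card (\<pi> ` P1) = card P1" "card (\<pi> ` Pm) = card Pm"
    using AutT_inj[OF A] by (simp_all add: card_image inj_on_subset)
  have "card P1 \<le> card Pm" using card_mono[OF _ P1_sub] finite_pendants card by simp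
  then have P1_img: "\<pi> ` P1 = Pm"
    using card_seteq[OF _ Pm_sub] finite_pendants card by simp
  have "card Pm \<le> card P1" using card_mono[OF _ Pm_sub] finite_pendants card by simp
  then have Pm_img: "\<pi> ` Pm = P1"
    using card_seteq[OF _ P1_sub] finite_pendants card by simp
  \<comment> \<open>If \<open>s 1 \<ge> 2\<close>, then \<open>inE 2\<close> does not start in
    column 0. The dual last-row cut then contains the image of all of \<open>Xp 2\<close>: pendant
    edges become vertical, and \<open>outE 2\<close> goes to \<open>inE 2\<close>.\<close>
  have s1: "s 1 = 1"
  proof (rule ccontr)
    assume "s 1 \<noteq> 1"
    then have "2 \<le> s 1" using spos by simp
    then show False
    proof (rule last_row_cut_dual)
      fix S
      assume S: "S \<in> Ts" "\<And>e. e \<in> E \<Longrightarrow>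
        (\<exists>r c. e = Ve r c) \<or> (\<exists>r c. e = Ho r c \<and> c \<noteq> 0 \<and> Suc c \<notin> s ` {2..m - 1}) \<Longrightarrow> e \<in> S"
      have img2: "s ` {2..m - 1} = {s 2}" using m by simp
      have s12: "s 1 < s 2" using s_less[of 1 2] m by simp
      show False
      proof (rule Xp_refute[OF p k2 S(1)], goal_cases)
        case (1 x)
        then have "\<pi> x \<in> P1" using X2 Pm_img by auto
        then show ?case using S(2)[of "\<pi> x"] VeP1 P1_E by blast
      next
        case 2
        show ?case using S(2)[of "inE 2"] fl ioE \<open>2 \<le> s 1\<close> s12 unfolding img2 by (auto simp: inE_def)
      next
        case (4 r)
        then show ?case using S(2)[of "Ve r (s (2 - 1))"] by auto
      next
        case (5 c)
        then show ?case using S(2)[of "Ho (t (Suc 2)) c"] spos unfolding img2 by auto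
      qed (use m in simp)
    qed
  qed
  have t2: "t 2 = 1"
  proof (rule ccontr)
    assume "t 2 \<noteq> 1"
    then have t2: "2 \<le> t 2" using spos by simp
    then have "2 \<le> t (m - 1)" using m by simp
    then show False
    proof (rule last_row_cut)
      fix S
      assume S: "S \<in> Ts" "\<And>e. e \<in> E \<Longrightarrow>
        (\<exists>r c. e = Ho r c) \<or> (\<exists>r c. e = Ve r c \<and> r \<noteq> 0 \<and> Suc r \<notin> t ` {1..m - 2}) \<Longrightarrow> e \<in> S"
      have img2: "t ` {1..m - 2} = {t 1}" using m by simp
      have t12: "t 2 < t 1" using t_less_iff[of 2 1] m by simp
      show False
      proof (rule Xp_refute[OF p k1 S(1)], goal_cases)
        case (1 x)
        then have "\<pi> x \<in> Pm" using X1 P1_img by auto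
        then show ?case using S(2)[of "\<pi> x"] HoPm Pm_E by blast
      next
        case 3
        show ?case using S(2)[of "outE 2"] fl ioE t2 t12 unfolding img2
          by (auto simp: outE_def numeral_2_eq_2)
      next
        case (4 r)
        then have "r \<noteq> 0" "Suc r \<noteq> t 1" using t2 m by (auto simp: numeral_2_eq_2)
        then show ?case using S(2)[of "Ve r (s (1 - 1))"] 4 unfolding img2 by auto
      next
        case (5 c)
        then show ?case using S(2)[of "Ho (t (Suc 1)) c"] by auto
      qed simp
    qed
  qed
  show sym: symmetric
    unfolding symmetric_def
  proof (intro allI impI)
    fix k assume "k \<le> m"
    then have "k = 0 \<or> k = 1 \<or> k = 2 \<or> k = 3" using m by auto
    moreover have "s 2 + t 2 = s 3" "s 1 + t 1 = s 3" "t 3 = 0" "t 0 = s 3"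
      using s_plus_t[of 2] s_plus_t[of 1] m t_m t_0 by auto
    ultimately show "s k = t (m - k)" using m s1 t2 by (auto simp: numeral_2_eq_2 numeral_3_eq_3)
  qed
  have D0: "q = (0, 0)" if q: "q \<in> D" for q
  proof -
    obtain r c where rc: "q = (r, c)" "(Suc r, Suc c) \<in> H" using q by (auto simp: D_def)
    have "(Suc r, Suc c) \<notin> Q"
    proof
      assume "(Suc r, Suc c) \<in> Q"
      then obtain k where k: "k \<in> {1..m - 1}" "Suc r < t k" "Suc c < s k" by (auto simp: Q_def)
      then have "k = 1 \<or> k = 2" using m by auto
      then show False using k s1 t2 by auto
    qed
    then obtain l where l: "l \<in> {1..m}" "(Suc r, Suc c) = mk l" using rc by (auto simp: H_def)
    then have "l = 1 \<or> l = 2 \<or> l = 3" using m by auto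
    moreover have "mk 1 = (t 1, 0)" "mk m = (0, s (m - 1))" by (simp_all add: mk_def)
    then have "l \<noteq> 1" "l \<noteq> m" using l(2) by auto
    then have "l \<noteq> 1" "l \<noteq> 3" using m by auto
    ultimately have "l = 2" by simp
    then show ?thesis using l s1 t2 rc by (simp add: mk_def)
  qed
  have "tauE \<circ> \<pi> \<in> AutT" by (rule AutT_comp[OF tauE_AutT[OF sym] A])
  moreover have "(tauE \<circ> \<pi>) ` Lp q = Lp q \<and> (tauE \<circ> \<pi>) ` Up q = Up q" if q: "q \<in> D" for q
  proof -
    have "\<pi> ` Lp q = Lp q" "\<pi> ` Up q = Up q" using p q by (auto simp: fixes_squares_def)
    then show ?thesis unfolding image_comp[symmetric] using tauE_Lp[OF q] tauE_Up[OF q] D0[OF q] by simp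
  qed
  ultimately show "fixes_squares (tauE \<circ> \<pi>)" by (simp add: fixes_squares_def)
  have io: "inE 2 = Ho 1 0" "outE 2 = Ve 0 1" using s1 t2 by (auto simp: inE_def outE_def)
  show "fixes_marks (tauE \<circ> \<pi>)"
    unfolding fixes_marks_def
  proof (intro allI impI)
    fix k assume "2 \<le> k \<and> k < m"
    then have "k = 2" using only2 by simp
    then show "(tauE \<circ> \<pi>) (inE k) = inE k \<and> (tauE \<circ> \<pi>) (outE k) = outE k"
      using fl in_out_E[OF two] by (simp add: tauE_def io)
  qed
qed

text \<open>For a transposing \<pi> with \<open>m = 3\<close>, composition with \<open>tauE\<close>
  may still exchange the pair at the mark. Then \<open>flipped_mark\<close> allows a second
  composition with \<open>tauE\<close>, which gives back \<pi> itself in the first form.\<close>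

lemma AutT_normal_form:
  assumes p: "\<pi> \<in> AutT"
  shows "fixes_squares \<pi> \<and> fixes_marks \<pi> \<or>
    symmetric \<and> fixes_squares (tauE \<circ> \<pi>) \<and> fixes_marks (tauE \<circ> \<pi>)"
  using AutT_id_or_transpose[OF p]
proof
  assume "\<forall>q\<in>D. \<pi> ` Lp q = Lp q \<and> \<pi> ` Up q = Up q"
  then have fs: "fixes_squares \<pi>" using p by (simp add: fixes_squares_def)
  show ?thesis
  proof (cases "m = 3")
    case True
    then show ?thesis using flipped_mark[OF fs] fs by blast
  next
    case False
    then show ?thesis using fixes_marks_ge4[OF fs] fs m3 by simp
  qed
next
  assume tr: "\<forall>q\<in>D. prod.swap q \<in> D \<and> \<pi> ` Lp q = Lp (prod.swap q) \<and> \<pi> ` Up q = Up (prod.swap q)"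
  have sym: symmetric by (rule transpose_symmetric[OF p]) (use tr in simp)
  have "(tauE \<circ> \<pi>) ` Lp q = Lp q \<and> (tauE \<circ> \<pi>) ` Up q = Up q" if q: "q \<in> D" for q
  proof -
    have "prod.swap q \<in> D" "\<pi> ` Lp q = Lp (prod.swap q)" "\<pi> ` Up q = Up (prod.swap q)" using tr q by auto
    then show ?thesis unfolding image_comp[symmetric]
      using tauE_Lp[of "prod.swap q"] tauE_Up[of "prod.swap q"] by simp
  qed
  then have fs: "fixes_squares (tauE \<circ> \<pi>)"
    using AutT_comp[OF tauE_AutT[OF sym] p] by (simp add: fixes_squares_def)
  show ?thesis
  proof (cases "fixes_marks (tauE \<circ> \<pi>)")
    case True
    then show ?thesis using sym fs by simp
  next
    case False
    then have "m = 3" using fixes_marks_ge4[OF fs] m3 by linarith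
    then have "fixes_squares (tauE \<circ> (tauE \<circ> \<pi>))" "fixes_marks (tauE \<circ> (tauE \<circ> \<pi>))"
      using flipped_mark[OF fs _ False] by auto
    moreover have "tauE \<circ> (tauE \<circ> \<pi>) = \<pi>" using tauE_tauE[OF sym] by (simp add: fun_eq_iff)
    ultimately show ?thesis by simp
  qed
qed

declare One_nat_def [simp del]

section \<open>The explicit group of automorphisms\<close>

text \<open>The chain is numbered from the mark upwards: position \<open>i\<close> is
  \<open>Ve (t 1 - i) 0\<close>, so \<open>i = 1\<close> is \<open>outE 1\<close>, and there are
  \<open>s 2 - s 1\<close> positions.\<close>

definition alpha :: "(nat \<Rightarrow> nat) \<Rightarrow> edge \<Rightarrow> edge"
  where "alpha \<sigma> e = (case e of
      Ve r c \<Rightarrow> if c = 0 \<and> t 2 \<le> r \<and> r < t 1 then Ve (t 1 - \<sigma> (t 1 - r)) 0 else e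
    | Ho r c \<Rightarrow> e)"

definition beta :: "(nat \<Rightarrow> nat) \<Rightarrow> edge \<Rightarrow> edge"
  where "beta \<sigma> e = (case e of
      Ho r c \<Rightarrow> if r = 0 \<and> s (m - 2) \<le> c \<and> c < s (m - 1) then Ho 0 (s (m - 1) - \<sigma> (s (m - 1) - c)) else e
    | Ve r c \<Rightarrow> e)"

lemma perm_range:
  assumes "\<sigma> permutes {1..n}" "1 \<le> i" "i \<le> n"
  shows "1 \<le> \<sigma> i" "\<sigma> i \<le> n"
  using permutes_in_image[OF assms(1), of i] assms(2,3) by auto

lemma t1_t2: "t 1 - t 2 = s 2 - s 1" "t 2 < t 1"
  using t_Suc[of 1] t_less_iff[of 2 1] m3 by (auto simp: numeral_2_eq_2)

lemma sm_less: "s (m - 2) < s (m - 1)"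
  using s_less[of "m - 2" "m - 1"] m3 by simp

lemma alpha_comp:
  assumes "\<sigma> permutes {1..s 2 - s 1}" "\<sigma>' permutes {1..s 2 - s 1}"
  shows "alpha \<sigma> (alpha \<sigma>' e) = alpha (\<sigma> \<circ> \<sigma>') e"
proof (cases e)
  case (Ve r c)
  show ?thesis
  proof (cases "c = 0 \<and> t 2 \<le> r \<and> r < t 1")
    case True
    have "1 \<le> \<sigma>' (t 1 - r)" "\<sigma>' (t 1 - r) \<le> t 1 - t 2"
      using perm_range[OF assms(2), of "t 1 - r"] True t1_t2 by auto
    then show ?thesis using True t1_t2 by (simp add: alpha_def Ve)
  next
    case False
    then have "alpha \<sigma>'' e = e" for \<sigma>'' by (auto simp: alpha_def Ve)
    then show ?thesis by simp
  qed
qed (simp add: alpha_def)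

lemma beta_comp:
  assumes "\<sigma> permutes {1..s (m - 1) - s (m - 2)}" "\<sigma>' permutes {1..s (m - 1) - s (m - 2)}"
  shows "beta \<sigma> (beta \<sigma>' e) = beta (\<sigma> \<circ> \<sigma>') e"
proof (cases e)
  case (Ho r c)
  show ?thesis
  proof (cases "r = 0 \<and> s (m - 2) \<le> c \<and> c < s (m - 1)")
    case True
    have "1 \<le> \<sigma>' (s (m - 1) - c)" "\<sigma>' (s (m - 1) - c) \<le> s (m - 1) - s (m - 2)"
      using perm_range[OF assms(2), of "s (m - 1) - c"] True by auto
    moreover from this have "s (m - 2) \<le> s (m - 1) - \<sigma>' (s (m - 1) - c)" using sm_less by linarith
    moreover have "s (m - 1) - (s (m - 1) - \<sigma>' (s (m - 1) - c)) = \<sigma>' (s (m - 1) - c)"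
      using calculation sm_less by linarith
    ultimately show ?thesis using True by (simp add: beta_def Ho)
  next
    case False
    then have "beta \<sigma>'' e = e" for \<sigma>'' by (auto simp: beta_def Ho)
    then show ?thesis by simp
  qed
qed (simp add: beta_def)

lemma alpha_id: "alpha id e = e" and beta_id: "beta id e = e"
  by (cases e; simp add: alpha_def beta_def)+

lemma mk_2_corner: "(Suc (t 2), s 1) \<notin> H"
  using mk_corner(1)[of 2] m3 by (simp add: numeral_2_eq_2 One_nat_def)

lemma P1_eq:
  assumes "s 1 = 1"
  shows "P1 = {Ve r 0 | r. t 2 \<le> r \<and> r < t 1}"
proof
  show "P1 \<subseteq> {Ve r 0 | r. t 2 \<le> r \<and> r < t 1}"
  proof
    fix e assume e: "e \<in> P1"
    then obtain r where "e = Ve r 0" by (auto simp: P1_def)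
    then show "e \<in> {Ve r 0 | r. t 2 \<le> r \<and> r < t 1}" using P1_bounds[of r 0] e by auto
  qed
  show "{Ve r 0 | r. t 2 \<le> r \<and> r < t 1} \<subseteq> P1"
  proof
    fix e assume "e \<in> {Ve r 0 | r. t 2 \<le> r \<and> r < t 1}"
    then obtain r where r: "e = Ve r 0" "t 2 \<le> r" "r < t 1" by auto
    have "(Suc r, 0) \<in> H" using H_down[of "t 1" 0 "Suc r" 0] mk_in_H[of 1] r m3 by (simp add: mk_def)
    moreover have "(Suc r, 1) \<notin> H"
    proof
      assume "(Suc r, 1) \<in> H"
      then have "(Suc (t 2), 1) \<in> H" by (rule H_down) (use r in auto)
      then show False using mk_2_corner assms by simp
    qed
    ultimately show "e \<in> P1" using r by (simp add: P1_def)
  qed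
qed

lemma alpha_permutes:
  assumes s1: "s 1 = 1" and \<sigma>: "\<sigma> permutes {1..s 2 - s 1}"
  shows "alpha \<sigma> permutes E"
proof -
  have inv: "inv_into UNIV \<sigma> permutes {1..s 2 - s 1}" by (rule permutes_inv[OF \<sigma>])
  have id: "\<sigma> \<circ> inv_into UNIV \<sigma> = id" "inv_into UNIV \<sigma> \<circ> \<sigma> = id"
    using permutes_inv_o[OF \<sigma>] by auto
  have outside: "alpha \<sigma>' e = e" if "e \<notin> P1" for \<sigma>' e
    using that unfolding P1_eq[OF s1] by (cases e) (auto simp: alpha_def)
  have inside: "alpha \<sigma>' e \<in> P1" if "e \<in> P1" "\<sigma>' permutes {1..s 2 - s 1}" for \<sigma>' e
  proof -
    obtain r where r: "e = Ve r 0" "t 2 \<le> r" "r < t 1" using \<open>e \<in> P1\<close> unfolding P1_eq[OF s1] by auto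
    have "1 \<le> \<sigma>' (t 1 - r)" "\<sigma>' (t 1 - r) \<le> t 1 - t 2"
      using perm_range[OF that(2), of "t 1 - r"] r t1_t2 by auto
    then show ?thesis using r t1_t2 unfolding P1_eq[OF s1] by (auto simp: alpha_def)
  qed
  have "alpha \<sigma> permutes P1"
  proof (rule bij_imp_permutes)
    show "bij_betw (alpha \<sigma>) P1 P1"
      by (rule bij_betw_byWitness[where f' = "alpha (inv_into UNIV \<sigma>)"])
        (use inside[OF _ \<sigma>] inside[OF _ inv] in
          \<open>auto simp: alpha_comp[OF \<sigma> inv] alpha_comp[OF inv \<sigma>] id alpha_id\<close>)
  qed (rule outside)
  then show ?thesis by (rule permutes_subset) (rule P1_E)
qed

text \<open>The pendant chain is a simplex whose barycentric coordinates are the successive differences;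
  \<open>alpha\<close> permutes all of them but the last one.\<close>

lemma alpha_AutT:
  assumes s1: "s 1 = 1" and \<sigma>: "\<sigma> permutes {1..s 2 - s 1}"
  shows "alpha \<sigma> \<in> AutT"
proof (rule AutT_gapI[OF alpha_permutes[OF s1 \<sigma>]])
  fix f assume f: "f \<in> pts"
  define \<sigma>i where "\<sigma>i = inv_into UNIV \<sigma>"
  define g where "g i = f (t 1 - i, 0)" for i
  define d where "d i = g i - g (i - 1)" for i
  \<comment> \<open>The inverse appears because the edge in position \<open>\<sigma> i\<close> has
    to receive the difference \<open>d i\<close>.\<close>
  define G where "G j = g 0 + (\<Sum>l\<in>{1..j}. d (\<sigma>i l))" for j
  define f' where "f' p = (if snd p = 0 \<and> t 2 \<le> fst p \<and> fst p \<le> t 1 then G (t 1 - fst p) else f p)" for p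
  \<comment> \<open>The differences are only rearranged, so the upper end of the chain keeps its
    value and the rest of the array can stay unchanged.\<close>
  have Gn: "G (t 1 - t 2) = g (t 1 - t 2)"
  proof -
    have "(\<Sum>l\<in>{1..s 2 - s 1}. d (\<sigma>i l)) = (\<Sum>l\<in>{1..s 2 - s 1}. d l)"
      using sum.permute[OF permutes_inv[OF \<sigma>], of d] by (simp add: \<sigma>i_def comp_def)
    also have "\<dots> = g (s 2 - s 1) - g 0"
      using sum_telescope''[of 0 "s 2 - s 1" g] by (simp add: d_def One_nat_def)
    finally show ?thesis by (simp add: G_def t1_t2)
  qed
  have same: "f' (r, c) = f (r, c)" if "c \<noteq> 0 \<or> r \<le> t 2 \<or> t 1 \<le> r" for r c
  proof (cases "c = 0 \<and> t 2 \<le> r \<and> r \<le> t 1")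
    case True
    then have "r = t 2 \<or> r = t 1" using that by auto
    then show ?thesis
    proof
      assume r: "r = t 2"
      have "f' (r, c) = g (t 1 - t 2)" using True r Gn by (simp add: f'_def)
      also have "\<dots> = f (t 1 - (t 1 - t 2), 0)" by (simp only: g_def)
      also have "t 1 - (t 1 - t 2) = t 2" using t1_t2(2) by simp
      finally show ?thesis using True r by simp
    next
      assume "r = t 1"
      then show ?thesis using True by (simp add: f'_def g_def G_def)
    qed
  next
    case False
    then show ?thesis by (auto simp: f'_def)
  qed
  have "f' (mk k) = real k" if k: "k \<in> {1..m}" for k
  proof -
    have "s (k - 1) \<noteq> 0 \<or> t 1 \<le> t k"
    proof (cases "k = 1")
      case False
      then show ?thesis using s_pos[of "k - 1"] k by auto
    qed simp
    then have "f' (mk k) = f (mk k)" unfolding mk_def by (intro same) auto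
    then show ?thesis using f k by (simp add: pts_def)
  qed
  moreover have "f' (tgt (alpha \<sigma> e)) - f' (src (alpha \<sigma> e)) = f (tgt e) - f (src e)" if e: "e \<in> E" for e
  proof (cases "e \<in> P1")
    case True
    then obtain r where r: "e = Ve r 0" "t 2 \<le> r" "r < t 1" unfolding P1_eq[OF s1] by auto
    define i where "i = t 1 - r"
    have i: "1 \<le> i" "i \<le> s 2 - s 1" "r = t 1 - i" "Suc r = t 1 - (i - 1)"
      using r t1_t2 by (auto simp: i_def)
    obtain j where j: "\<sigma> i = Suc j" using perm_range(1)[OF \<sigma> i(1,2)] by (cases "\<sigma> i") auto
    have jn: "Suc j \<le> t 1 - t 2" using perm_range(2)[OF \<sigma> i(1,2)] j t1_t2 by simp
    have "alpha \<sigma> e = Ve (t 1 - Suc j) 0" using r j by (simp add: alpha_def i_def[symmetric])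
    moreover have "Suc (t 1 - Suc j) = t 1 - j" using jn t1_t2 by simp
    ultimately have "f' (tgt (alpha \<sigma> e)) - f' (src (alpha \<sigma> e)) = G (Suc j) - G j"
      using jn t1_t2 by (auto simp: f'_def)
    also have "\<dots> = d (\<sigma>i (\<sigma> i))" by (simp add: G_def j)
    also have "\<dots> = d i" using permutes_inverses(2)[OF \<sigma>] by (simp add: \<sigma>i_def)
    also have "\<dots> = f (tgt e) - f (src e)" using i r by (simp add: d_def g_def)
    finally show ?thesis .
  next
    case False
    have ae: "alpha \<sigma> e = e" using False unfolding P1_eq[OF s1] by (cases e) (auto simp: alpha_def)
    have "f' (tgt e) = f (tgt e) \<and> f' (src e) = f (src e)"
    proof (cases e)
      case (Ho r c)
      have "c \<noteq> 0 \<or> r \<le> t 2"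
      proof (rule ccontr)
        assume "\<not> ?thesis"
        then have "(Suc (t 2), s 1) \<in> H" using H_down[of r "Suc c" "Suc (t 2)" 1] e s1 by (simp add: Ho Ho_in_E)
        then show False using mk_2_corner by simp
      qed
      then show ?thesis using same[of c r] same[of "Suc c" r] by (auto simp: Ho)
    next
      case (Ve r c)
      have "below (mk 1) (Suc r, c)" using mk_first e by (simp add: Ve Ve_in_E)
      then have "c \<noteq> 0 \<or> r < t 2" using False Ve unfolding P1_eq[OF s1] by (auto simp: below_def mk_def)
      then show ?thesis using same[of c r] same[of c "Suc r"] by (auto simp: Ve)
    qed
    then show ?thesis by (simp add: ae)
  qed
  ultimately show "\<exists>f'. (\<forall>k\<in>{1..m}. f' (mk k) = real k) \<and>
      (\<forall>e\<in>E. f' (tgt (alpha \<sigma> e)) - f' (src (alpha \<sigma> e)) = f (tgt e) - f (src e))" by blast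
qed

text \<open>Lets membership in \<open>AutT\<close>, injectivity and surjectivity for
  \<open>beta\<close> be inherited from \<open>alpha\<close> of the transposed shape.\<close>

lemma beta_dual:
  defines "s' \<equiv> \<lambda>k. t (m - k)"
  shows "beta \<sigma> = tau \<circ> shape.alpha m s' \<sigma> \<circ> tau"
proof -
  interpret dp: dual_pair m s s' unfolding s'_def by (rule dual_pair_dual)
  have "dp.B.t 1 = s (m - 1)" "dp.B.t 2 = s (m - 2)" using dp.Bt[of 1] dp.Bt[of 2] m3 by auto
  then have "beta \<sigma> e = tau (dp.B.alpha \<sigma> (tau e))" for e
    by (cases e) (auto simp: beta_def dp.B.alpha_def)
  then show ?thesis by (simp add: fun_eq_iff)
qed

lemma beta_AutT:
  assumes tm: "t (m - 1) = 1" and \<sigma>: "\<sigma> permutes {1..s (m - 1) - s (m - 2)}"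
  shows "beta \<sigma> \<in> AutT"
proof -
  define s' where "s' = (\<lambda>k. t (m - k))"
  interpret dp: dual_pair m s s' unfolding s'_def by (rule dual_pair_dual)
  have "s (m - 1) - s (m - 2) = s' 2 - s' 1"
    using s_plus_t[of "m - 1"] s_plus_t[of "m - 2"] unfolding s'_def by linarith
  then have "dp.B.alpha \<sigma> \<in> dp.B.AutT" using dp.B.alpha_AutT \<sigma> tm by (simp add: s'_def)
  then have "tau \<circ> dp.B.alpha \<sigma> \<circ> tau \<in> AutT"
    by (rule dual_pair.tau_AutT[OF dp.flip_dual])
  then show ?thesis unfolding beta_dual s'_def .
qed

lemma Pm_eq:
  assumes tm: "t (m - 1) = 1"
  shows "Pm = {Ho 0 c | c. s (m - 2) \<le> c \<and> c < s (m - 1)}"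
proof -
  define s' where "s' = (\<lambda>k. t (m - k))"
  interpret dp: dual_pair m s s' unfolding s'_def by (rule dual_pair_dual)
  have P: "dp.B.P1 = {Ve r 0 | r. s (m - 2) \<le> r \<and> r < s (m - 1)}"
    using dp.B.P1_eq tm dp.Bt[of 1] dp.Bt[of 2] m3 by (simp add: s'_def)
  have "Ho 0 c \<in> Pm \<longleftrightarrow> Ve c 0 \<in> dp.B.P1" for c by (simp add: Pm_def dp.B.P1_def dp.BH)
  then show ?thesis unfolding P by (auto simp: Pm_def)
qed

text \<open>With \<open>s 1 \<ge> 2\<close>, the second column of the first rectangle extends down
  to the row just above \<open>mk 1\<close>, so only the lowest edge of the first column borders no
  square.\<close>

lemma P1_single:
  assumes "s 1 \<noteq> 1"
  shows "P1 = {outE 1}"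
proof -
  have s1: "2 \<le> s 1" using s_pos[of 1] m3 assms by simp
  have "P1 \<subseteq> {outE 1}"
  proof
    fix e assume e: "e \<in> P1"
    then obtain r where r: "e = Ve r 0" "(Suc r, 1) \<notin> H" by (auto simp: P1_def)
    have "r < t 1" using P1_bounds[of r 0] e r by simp
    moreover have "\<not> Suc r < t 1"
    proof
      assume "Suc r < t 1"
      then have "(Suc r, 1) \<in> Q" using s1 m3 unfolding Q_def by (auto intro!: bexI[of _ 1])
      then show False using r by (simp add: H_def)
    qed
    ultimately have "Suc r = t 1" by simp
    then show "e \<in> {outE 1}" using r by (simp add: outE_def flip: \<open>Suc r = t 1\<close>)
  qed
  then show ?thesis using outE_1_P1 by auto
qed

lemma Pm_single:
  assumes "t (m - 1) \<noteq> 1"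
  shows "\<exists>e. Pm = {e}"
proof -
  define s' where "s' = (\<lambda>k. t (m - k))"
  interpret dp: dual_pair m s s' unfolding s'_def by (rule dual_pair_dual)
  have P: "dp.B.P1 = {dp.B.outE 1}" using dp.B.P1_single assms by (simp add: s'_def)
  have "Ho 0 c \<in> Pm \<longleftrightarrow> Ve c 0 \<in> dp.B.P1" for c by (simp add: Pm_def dp.B.P1_def dp.BH)
  then have mem: "e \<in> Pm \<longleftrightarrow> tau e = dp.B.outE 1" for e
    unfolding P by (cases e) (auto simp: Pm_def dp.B.outE_def)
  have "Pm = {tau (dp.B.outE 1)}"
  proof (rule equalityI; rule subsetI)
    fix e assume "e \<in> Pm"
    then have "tau (tau e) = tau (dp.B.outE 1)" by (simp only: mem)
    then show "e \<in> {tau (dp.B.outE 1)}" by simp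
  next
    fix e assume "e \<in> {tau (dp.B.outE 1)}"
    then show "e \<in> Pm" unfolding mem by simp
  qed
  then show ?thesis by (rule exI)
qed

section \<open>Indexing the exchangeable corners\<close>

definition kap :: "nat \<Rightarrow> nat"
  where "kap i = sorted_list_of_set Kset ! (i - 1)"

definition rr :: nat
  where "rr = card Kset"

text \<open>Outer corners come in increasing order of \<open>k\<close>, the cell
  \<open>(0, 0)\<close> comes last. In this numbering the transposition reverses the first
  \<open>rr\<close> components and fixes the last one, as \<open>swap_hom\<close>
  prescribes.\<close>

definition mid :: "nat \<Rightarrow> nat \<times> nat"
  where "mid i = (if i \<le> rr then ck (kap i) else (0, 0))"

definition Cz :: "(nat \<Rightarrow> int) \<Rightarrow> (nat \<times> nat) set"
  where "Cz z = mid ` {i \<in> {1..rr + 1}. z i = 1}"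

lemma finite_Kset: "finite Kset"
  by (simp add: Kset_def)

lemma kap_less: "1 \<le> i \<Longrightarrow> i < j \<Longrightarrow> j \<le> rr \<Longrightarrow> kap i < kap j"
  unfolding kap_def rr_def
  using sorted_wrt_nth_less[OF strict_sorted_list_of_set[of Kset], of "i - 1" "j - 1"] by simp

lemma kap_bij: "bij_betw kap {1..rr} Kset"
proof (rule bij_betw_imageI)
  show "inj_on kap {1..rr}"
    by (rule linorder_inj_onI) (use kap_less in force)+
  have "kap ` {1..rr} = (!) (sorted_list_of_set Kset) ` {..<rr}"
  proof
    show "kap ` {1..rr} \<subseteq> (!) (sorted_list_of_set Kset) ` {..<rr}" by (force simp: kap_def)
    show "(!) (sorted_list_of_set Kset) ` {..<rr} \<subseteq> kap ` {1..rr}"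
    proof
      fix y assume "y \<in> (!) (sorted_list_of_set Kset) ` {..<rr}"
      then obtain i where "i < rr" "y = sorted_list_of_set Kset ! i" by auto
      then show "y \<in> kap ` {1..rr}" by (intro image_eqI[of _ _ "Suc i"]) (auto simp: kap_def)
    qed
  qed
  also have "\<dots> = set (sorted_list_of_set Kset)"
    using nth_image[of rr "sorted_list_of_set Kset"] by (simp add: rr_def lessThan_atLeast0)
  finally show "kap ` {1..rr} = Kset" using finite_Kset by simp
qed

lemma mid_bij: "bij_betw mid {1..rr + 1} cells"
proof (rule bij_betw_imageI)
  have K: "kap i \<in> Kset" if "1 \<le> i" "i \<le> rr" for i
    using kap_bij that by (auto simp: bij_betw_def)
  have ck0: "ck k \<noteq> (0, 0)" if "k \<in> Kset" for k
    using ckD(4)[OF that, of "fst (ck k)" "snd (ck k)"] by (auto simp: prod_eq_iff)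
  show "inj_on mid {1..rr + 1}"
  proof (rule inj_onI)
    fix i j assume ij: "i \<in> {1..rr + 1}" "j \<in> {1..rr + 1}" "mid i = mid j"
    show "i = j"
    proof (cases "i \<le> rr \<and> j \<le> rr")
      case True
      then have "kap i = kap j" using ij inj_onD[OF ck_inj _ K K, of i j] by (auto simp: mid_def)
      then show ?thesis using kap_bij ij True by (auto simp: bij_betw_def dest: inj_onD)
    next
      case False
      then show ?thesis using ij ck0[OF K, of i] ck0[OF K, of j] by (auto simp: mid_def split: if_splits)
    qed
  qed
  have "{1..rr + 1} = insert (rr + 1) {1..rr}" by auto
  then have "mid ` {1..rr + 1} = insert (mid (rr + 1)) (mid ` {1..rr})" by simp
  also have "mid ` {1..rr} = ck ` kap ` {1..rr}" unfolding image_image by (rule image_cong) (auto simp: mid_def)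
  finally have "mid ` {1..rr + 1} = insert (0, 0) (ck ` kap ` {1..rr})" by (simp add: mid_def)
  then show "mid ` {1..rr + 1} = cells" using kap_bij by (simp add: cells_def bij_betw_def)
qed

lemma Cz_cells: "Cz z \<subseteq> cells"
  using mid_bij by (auto simp: Cz_def bij_betw_def)

lemma mid_in_Cz: "i \<in> {1..rr + 1} \<Longrightarrow> mid i \<in> Cz z \<longleftrightarrow> z i = 1"
  using mid_bij unfolding Cz_def bij_betw_def by (auto dest: inj_onD)

lemma Cz_mult:
  assumes z: "z \<in> {1..rr + 1} \<rightarrow>\<^sub>E {0, 1}" "z' \<in> {1..rr + 1} \<rightarrow>\<^sub>E {0, 1}"
  shows "Cz (\<lambda>i\<in>{1..rr + 1}. (z i + z' i) mod 2) = (Cz z - Cz z') \<union> (Cz z' - Cz z)"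
proof -
  have ex: "\<exists>i\<in>{1..rr + 1}. p = mid i" if "p \<in> cells" for p
    using mid_bij that by (auto simp: bij_betw_def)
  have iff: "p \<in> Cz (\<lambda>i\<in>{1..rr + 1}. (z i + z' i) mod 2) \<longleftrightarrow> p \<in> (Cz z - Cz z') \<union> (Cz z' - Cz z)"
    if p: "p \<in> cells" for p
  proof -
    obtain i where i: "i \<in> {1..rr + 1}" "p = mid i" using ex[OF p] by blast
    have "z i = 0 \<or> z i = 1" "z' i = 0 \<or> z' i = 1" using z i by (auto simp: PiE_iff)
    then show ?thesis unfolding i(2) Un_iff Diff_iff mid_in_Cz[OF i(1)] restrict_apply'[OF i(1)]
      by (elim disjE) simp_all
  qed
  show ?thesis
  proof (rule equalityI; rule subsetI)
    fix p assume "p \<in> Cz (\<lambda>i\<in>{1..rr + 1}. (z i + z' i) mod 2)"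
    then show "p \<in> (Cz z - Cz z') \<union> (Cz z' - Cz z)" using iff Cz_cells by blast
  next
    fix p assume "p \<in> (Cz z - Cz z') \<union> (Cz z' - Cz z)"
    then show "p \<in> Cz (\<lambda>i\<in>{1..rr + 1}. (z i + z' i) mod 2)" using iff Cz_cells by blast
  qed
qed

definition nu :: "(nat \<Rightarrow> nat) \<times> (nat \<Rightarrow> nat) \<times> (nat \<Rightarrow> int) \<Rightarrow> edge \<Rightarrow> edge"
  where "nu = (\<lambda>(\<sigma>\<^sub>1, \<sigma>\<^sub>2, z). alpha \<sigma>\<^sub>1 \<circ> beta \<sigma>\<^sub>2 \<circ> flip (Cz z))"

text \<open>The carrier of \<open>GT_normal_part\<close> in terms of \<open>s\<close>; an exponent 0
  becomes the condition that the permutation is \<open>id\<close> (see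
  \<open>NC_carrier\<close>).\<close>

definition NC :: "((nat \<Rightarrow> nat) \<times> (nat \<Rightarrow> nat) \<times> (nat \<Rightarrow> int)) set"
  where "NC = {(\<sigma>\<^sub>1, \<sigma>\<^sub>2, z). \<sigma>\<^sub>1 permutes {1..s 2 - s 1} \<and> (s 1 \<noteq> 1 \<longrightarrow> \<sigma>\<^sub>1 = id)
    \<and> \<sigma>\<^sub>2 permutes {1..s (m - 1) - s (m - 2)} \<and> (t (m - 1) \<noteq> 1 \<longrightarrow> \<sigma>\<^sub>2 = id)
    \<and> z \<in> {1..rr + 1} \<rightarrow>\<^sub>E {0, 1}}"

lemma nu_AutT:
  assumes "n \<in> NC"
  shows "nu n \<in> AutT"
proof -
  obtain \<sigma>\<^sub>1 \<sigma>\<^sub>2 z where n: "n = (\<sigma>\<^sub>1, \<sigma>\<^sub>2, z)" by (cases n)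
  have idA: "id \<in> AutT" by (rule AutT_I) (auto simp: permutes_id)
  have "alpha \<sigma>\<^sub>1 \<in> AutT"
  proof (cases "s 1 = 1")
    case True
    then show ?thesis using alpha_AutT assms by (simp add: n NC_def)
  next
    case False
    then have "alpha \<sigma>\<^sub>1 = id" using assms by (auto simp: n NC_def alpha_id)
    then show ?thesis using idA by simp
  qed
  moreover have "beta \<sigma>\<^sub>2 \<in> AutT"
  proof (cases "t (m - 1) = 1")
    case True
    then show ?thesis using beta_AutT assms by (simp add: n NC_def)
  next
    case False
    then have "beta \<sigma>\<^sub>2 = id" using assms by (auto simp: n NC_def beta_id)
    then show ?thesis using idA by simp
  qed
  ultimately show ?thesis unfolding n nu_def using flip_AutT[OF Cz_cells] AutT_comp by simp
qed

lemma alpha_beta: "alpha \<sigma> (beta \<sigma>' e) = beta \<sigma>' (alpha \<sigma> e)"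
  by (cases e) (auto simp: alpha_def beta_def)

text \<open>Among the edges of column 0, flips move at most \<open>Ve 0 0\<close>, which lies above
  the range permuted by \<open>alpha\<close> because \<open>t 2 > 0\<close>.\<close>

lemma alpha_flip:
  assumes C: "C \<subseteq> cells" and \<sigma>: "\<sigma> permutes {1..s 2 - s 1}"
  shows "alpha \<sigma> (flip C e) = flip C (alpha \<sigma> e)"
proof -
  have pos: "0 < r \<and> 0 < c" if "(r, c) \<in> C" "(r, c) \<noteq> (0, 0)" for r c
    using that C cells_pos[of r c] by blast
  have t2: "0 < t 2" using t_pos[of 2] m3 by simp
  show ?thesis
  proof (cases e)
    case (Ho r c)
    then show ?thesis using pos[of r "Suc c"] t2 by (auto simp: alpha_def flip_def)
  next
    case (Ve r c)
    show ?thesis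
    proof (cases "c = 0 \<and> t 2 \<le> r \<and> r < t 1")
      case True
      define i where "i = \<sigma> (t 1 - r)"
      have "1 \<le> i" "i \<le> t 1 - t 2"
        using perm_range[OF \<sigma>, of "t 1 - r"] True t1_t2 by (auto simp: i_def)
      then have r': "t 2 \<le> t 1 - i" using t1_t2 by simp
      have f0: "flip C (Ve r' 0) = Ve r' 0" if "t 2 \<le> r'" for r'
        using that t2 pos[of "Suc r'" 0] by (auto simp: flip_def)
      have "alpha \<sigma> e = Ve (t 1 - i) 0" using True by (simp add: alpha_def Ve i_def)
      then show ?thesis using True f0[OF r'] f0[of r] by (simp add: Ve)
    next
      case False
      then have "alpha \<sigma> e = e" by (auto simp: Ve alpha_def)
      moreover have "alpha \<sigma> (flip C e) = flip C e"
        using False t2 pos[of "Suc r" c] by (auto simp: Ve alpha_def flip_def)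
      ultimately show ?thesis by simp
    qed
  qed
qed

lemma beta_flip:
  assumes C: "C \<subseteq> cells" and \<sigma>: "\<sigma> permutes {1..s (m - 1) - s (m - 2)}"
  shows "beta \<sigma> (flip C e) = flip C (beta \<sigma> e)"
proof -
  have pos: "0 < r \<and> 0 < c" if "(r, c) \<in> C" "(r, c) \<noteq> (0, 0)" for r c
    using that C cells_pos[of r c] by blast
  have s2: "0 < s (m - 2)" using s_pos[of "m - 2"] m3 by simp
  show ?thesis
  proof (cases e)
    case (Ve r c)
    then show ?thesis using pos[of "Suc r" c] s2 by (auto simp: beta_def flip_def)
  next
    case (Ho r c)
    show ?thesis
    proof (cases "r = 0 \<and> s (m - 2) \<le> c \<and> c < s (m - 1)")
      case True
      define i where "i = \<sigma> (s (m - 1) - c)"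
      have "1 \<le> i" "i \<le> s (m - 1) - s (m - 2)"
        using perm_range[OF \<sigma>, of "s (m - 1) - c"] True by (auto simp: i_def)
      then have r': "s (m - 2) \<le> s (m - 1) - i" using sm_less by simp
      have f0: "flip C (Ho 0 c') = Ho 0 c'" if "s (m - 2) \<le> c'" for c'
        using that s2 pos[of 0 "Suc c'"] by (auto simp: flip_def)
      have "beta \<sigma> e = Ho 0 (s (m - 1) - i)" using True by (simp add: beta_def Ho i_def)
      then show ?thesis using True f0[OF r'] f0[of c] by (simp add: Ho)
    next
      case False
      then have "beta \<sigma> e = e" by (auto simp: Ho beta_def)
      moreover have "beta \<sigma> (flip C e) = flip C e"
        using False s2 pos[of r "Suc c"] by (auto simp: Ho beta_def flip_def)
      ultimately show ?thesis by simp
    qed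
  qed
qed

text \<open>\<open>alpha\<close>, \<open>beta\<close> and \<open>flip\<close> commute pairwise, and
  each of them is multiplicative.\<close>

lemma nu_mult:
  assumes "(\<sigma>\<^sub>1, \<sigma>\<^sub>2, z) \<in> NC" "(\<sigma>\<^sub>1', \<sigma>\<^sub>2', z') \<in> NC"
  shows "nu (\<sigma>\<^sub>1 \<circ> \<sigma>\<^sub>1', \<sigma>\<^sub>2 \<circ> \<sigma>\<^sub>2', \<lambda>i\<in>{1..rr + 1}. (z i + z' i) mod 2) =
    nu (\<sigma>\<^sub>1, \<sigma>\<^sub>2, z) \<circ> nu (\<sigma>\<^sub>1', \<sigma>\<^sub>2', z')"
proof
  fix e
  have p: "\<sigma>\<^sub>1 permutes {1..s 2 - s 1}" "\<sigma>\<^sub>1' permutes {1..s 2 - s 1}"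
    "\<sigma>\<^sub>2 permutes {1..s (m - 1) - s (m - 2)}" "\<sigma>\<^sub>2' permutes {1..s (m - 1) - s (m - 2)}"
    "z \<in> {1..rr + 1} \<rightarrow>\<^sub>E {0, 1}" "z' \<in> {1..rr + 1} \<rightarrow>\<^sub>E {0, 1}"
    using assms by (auto simp: NC_def)
  have "(nu (\<sigma>\<^sub>1, \<sigma>\<^sub>2, z) \<circ> nu (\<sigma>\<^sub>1', \<sigma>\<^sub>2', z')) e =
      alpha \<sigma>\<^sub>1 (beta \<sigma>\<^sub>2 (flip (Cz z) (alpha \<sigma>\<^sub>1' (beta \<sigma>\<^sub>2' (flip (Cz z') e)))))"
    by (simp add: nu_def)
  also have "\<dots> = alpha \<sigma>\<^sub>1 (alpha \<sigma>\<^sub>1' (beta \<sigma>\<^sub>2 (beta \<sigma>\<^sub>2' (flip (Cz z) (flip (Cz z') e)))))"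
    by (simp only: alpha_flip[OF Cz_cells p(2), symmetric] beta_flip[OF Cz_cells p(4), symmetric] alpha_beta)
  also have "\<dots> = nu (\<sigma>\<^sub>1 \<circ> \<sigma>\<^sub>1', \<sigma>\<^sub>2 \<circ> \<sigma>\<^sub>2', \<lambda>i\<in>{1..rr + 1}. (z i + z' i) mod 2) e"
    by (simp add: nu_def Cz_mult[OF p(5,6)] alpha_comp[OF p(1,2)] beta_comp[OF p(3,4)] flip_flip[OF Cz_cells Cz_cells])
  finally show "nu (\<sigma>\<^sub>1 \<circ> \<sigma>\<^sub>1', \<sigma>\<^sub>2 \<circ> \<sigma>\<^sub>2', \<lambda>i\<in>{1..rr + 1}. (z i + z' i) mod 2) e =
    (nu (\<sigma>\<^sub>1, \<sigma>\<^sub>2, z) \<circ> nu (\<sigma>\<^sub>1', \<sigma>\<^sub>2', z')) e" ..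
qed

section \<open>Action on corner pairs and pendant edges: injectivity and surjectivity\<close>

definition ein :: "nat \<times> nat \<Rightarrow> edge"
  where "ein p = (if p = (0, 0) then Ve 0 0 else Ho (fst p) (snd p - 1))"

definition eout :: "nat \<times> nat \<Rightarrow> edge"
  where "eout p = (if p = (0, 0) then Ho 0 0 else Ve (fst p - 1) (snd p))"

lemma cells_obtain:
  assumes "p \<in> cells"
  obtains "p = (0, 0)" | u v where "p = (Suc u, Suc v)"
proof (cases "p = (0, 0)")
  case False
  then have "0 < fst p \<and> 0 < snd p" using cells_pos[of "fst p" "snd p"] assms by simp
  then show thesis using that(2)[of "fst p - 1" "snd p - 1"] by (simp add: prod_eq_iff)
qed (rule that(1))

lemma ein_eout_pair:
  assumes "p \<in> cells"
  shows "\<exists>q\<in>D. {ein p, eout p} = Lp q \<or> {ein p, eout p} = Up q"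
  using assms
proof (cases rule: cells_obtain)
  case 1
  then have "{ein p, eout p} = Lp (0, 0)" by (simp add: ein_def eout_def Lp_def)
  then show ?thesis using D_00 by (intro bexI[of _ "(0, 0)"] disjI1)
next
  case (2 u v)
  then have "{ein p, eout p} = Up (u, v)" by (simp add: ein_def eout_def Up_def)
  moreover have "(u, v) \<in> D" using cells_H[OF assms] 2 by (simp add: D_def)
  ultimately show ?thesis by (intro bexI[of _ "(u, v)"] disjI2)
qed

lemma ein_ne_eout: "p \<in> cells \<Longrightarrow> ein p \<noteq> eout p"
  by (simp add: ein_def eout_def)

lemma flip_ein:
  assumes C: "C \<subseteq> cells" and p: "p \<in> cells"
  shows "flip C (ein p) = (if p \<in> C then eout p else ein p)"
    and "flip C (eout p) = (if p \<in> C then ein p else eout p)"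
proof -
  have "(Suc 0, 0) \<notin> C" "(0, Suc 0) \<notin> C" using C cells_pos[of "Suc 0" 0] cells_pos[of 0 "Suc 0"] by auto
  with p have "flip C (ein p) = (if p \<in> C then eout p else ein p)
      \<and> flip C (eout p) = (if p \<in> C then ein p else eout p)"
    by (cases rule: cells_obtain) (simp_all add: ein_def eout_def flip_def One_nat_def)
  then show "flip C (ein p) = (if p \<in> C then eout p else ein p)"
    "flip C (eout p) = (if p \<in> C then ein p else eout p)" by auto
qed

lemma flip_other:
  assumes C: "C \<subseteq> cells" and e: "\<And>p. p \<in> C \<Longrightarrow> e \<noteq> ein p \<and> e \<noteq> eout p"
  shows "flip C e = e"
proof (cases e)
  case (Ho r c)
  have "(r, Suc c) \<notin> C" using e[of "(r, Suc c)"] by (auto simp: Ho ein_def)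
  moreover have "\<not> (r = 0 \<and> c = 0 \<and> (0, 0) \<in> C)" using e[of "(0, 0)"] by (auto simp: Ho eout_def)
  ultimately show ?thesis by (auto simp: flip_def Ho)
next
  case (Ve r c)
  have "(Suc r, c) \<notin> C" using e[of "(Suc r, c)"] by (auto simp: Ve eout_def)
  moreover have "\<not> (r = 0 \<and> c = 0 \<and> (0, 0) \<in> C)" using e[of "(0, 0)"] by (auto simp: Ve ein_def)
  ultimately show ?thesis by (auto simp: flip_def Ve)
qed

lemma flip_pendant:
  assumes C: "C \<subseteq> cells" and e: "e \<in> P1 \<union> Pm"
  shows "flip C e = e"
proof (rule flip_other[OF C])
  fix p assume "p \<in> C"
  then have "p \<in> cells" using C by auto
  then obtain q where q: "q \<in> D" "{ein p, eout p} = Lp q \<or> {ein p, eout p} = Up q"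
    using ein_eout_pair[of p] by (elim meta_impE bexE)
  have "e \<notin> Lp q" "e \<notin> Up q" using e q(1) unfolding pendant_iff by auto
  then have "e \<notin> {ein p, eout p}" using q(2) by (elim disjE) (simp_all only: not_False_eq_True)
  then show "e \<noteq> ein p \<and> e \<noteq> eout p" by simp
qed

lemma alpha_outside: "e \<notin> P1 \<Longrightarrow> s 1 \<noteq> 1 \<longrightarrow> \<sigma> = id \<Longrightarrow> alpha \<sigma> e = e"
proof (cases "s 1 = 1")
  case True
  assume "e \<notin> P1"
  then show ?thesis unfolding P1_eq[OF True] by (cases e) (auto simp: alpha_def)
qed (simp add: alpha_id)

lemma beta_outside: "e \<notin> Pm \<Longrightarrow> t (m - 1) \<noteq> 1 \<longrightarrow> \<sigma> = id \<Longrightarrow> beta \<sigma> e = e"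
proof (cases "t (m - 1) = 1")
  case True
  assume "e \<notin> Pm"
  then show ?thesis unfolding Pm_eq[OF True] by (cases e) (auto simp: beta_def)
qed (simp add: beta_id)

text \<open>Flips fix all pendant edges, whereas flipping at \<open>p\<close> moves both edges at
  \<open>p\<close>.\<close>

lemma ein_eout_not_pendant: "p \<in> cells \<Longrightarrow> ein p \<notin> P1 \<union> Pm \<and> eout p \<notin> P1 \<union> Pm"
  using ein_ne_eout[of p] flip_pendant[of "{p}"] flip_ein[of "{p}" p] by (metis empty_subsetI insert_subset singletonI)

lemma nu_pair:
  assumes n: "(\<sigma>\<^sub>1, \<sigma>\<^sub>2, z) \<in> NC" and p: "p \<in> cells"
  shows "nu (\<sigma>\<^sub>1, \<sigma>\<^sub>2, z) (ein p) = (if p \<in> Cz z then eout p else ein p)"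
proof -
  have "alpha \<sigma>\<^sub>1 e = e" "beta \<sigma>\<^sub>2 e = e" if "e = ein p \<or> e = eout p" for e
    using that ein_eout_not_pendant[OF p] n alpha_outside[of e] beta_outside[of e] by (auto simp: NC_def)
  then show ?thesis by (simp add: nu_def flip_ein[OF Cz_cells p])
qed

lemma nu_alpha:
  assumes n: "(\<sigma>\<^sub>1, \<sigma>\<^sub>2, z) \<in> NC" and e: "e \<in> P1"
  shows "nu (\<sigma>\<^sub>1, \<sigma>\<^sub>2, z) e = alpha \<sigma>\<^sub>1 e"
proof -
  have "e \<notin> Pm" using e P1_Pm_disjoint by auto
  then have "beta \<sigma>\<^sub>2 e = e" using beta_outside n by (simp add: NC_def)
  moreover have "flip (Cz z) e = e" by (rule flip_pendant[OF Cz_cells]) (use e in simp)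
  ultimately show ?thesis by (simp add: nu_def)
qed

lemma nu_beta:
  assumes n: "(\<sigma>\<^sub>1, \<sigma>\<^sub>2, z) \<in> NC" and e: "e \<in> Pm"
  shows "nu (\<sigma>\<^sub>1, \<sigma>\<^sub>2, z) e = beta \<sigma>\<^sub>2 e"
proof -
  have "e \<notin> P1" using e P1_Pm_disjoint by auto
  then have "alpha \<sigma>\<^sub>1 e = e" using alpha_outside n by (simp add: NC_def)
  moreover have "flip (Cz z) e = e" by (rule flip_pendant[OF Cz_cells]) (use e in simp)
  ultimately show ?thesis by (simp add: nu_def alpha_beta)
qed

lemma alpha_inj:
  assumes p: "\<sigma> permutes {1..s 2 - s 1}" "\<sigma>' permutes {1..s 2 - s 1}"
    and s1: "s 1 = 1" and eq: "\<And>e. e \<in> P1 \<Longrightarrow> alpha \<sigma> e = alpha \<sigma>' e"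
  shows "\<sigma> = \<sigma>'"
proof (rule ext)
  fix i
  show "\<sigma> i = \<sigma>' i"
  proof (cases "i \<in> {1..s 2 - s 1}")
    case True
    then have r: "t 2 \<le> t 1 - i" "t 1 - i < t 1" "t 1 - (t 1 - i) = i" using t1_t2 by auto
    then have "Ve (t 1 - i) 0 \<in> P1" unfolding P1_eq[OF s1] by auto
    then have "alpha \<sigma> (Ve (t 1 - i) 0) = alpha \<sigma>' (Ve (t 1 - i) 0)" by (rule eq)
    then have "t 1 - \<sigma> i = t 1 - \<sigma>' i" using r by (simp add: alpha_def)
    then show ?thesis using perm_range(2)[OF p(1), of i] perm_range(2)[OF p(2), of i] True t1_t2 by auto
  next
    case False
    then show ?thesis using p by (simp add: permutes_not_in)
  qed
qed

lemma Pm_dual: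
  defines "s' \<equiv> \<lambda>k. t (m - k)"
  shows "e \<in> Pm \<longleftrightarrow> tau e \<in> shape.P1 m s'"
proof -
  interpret dp: dual_pair m s s' unfolding s'_def by (rule dual_pair_dual)
  show ?thesis by (cases e) (auto simp: Pm_def dp.B.P1_def dp.BH)
qed

lemma beta_inj:
  assumes p: "\<sigma> permutes {1..s (m - 1) - s (m - 2)}" "\<sigma>' permutes {1..s (m - 1) - s (m - 2)}"
    and tm: "t (m - 1) = 1" and eq: "\<And>e. e \<in> Pm \<Longrightarrow> beta \<sigma> e = beta \<sigma>' e"
  shows "\<sigma> = \<sigma>'"
proof -
  define s' where "s' = (\<lambda>k. t (m - k))"
  interpret dp: dual_pair m s s' unfolding s'_def by (rule dual_pair_dual)
  have n: "s (m - 1) - s (m - 2) = s' 2 - s' 1"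
    using s_plus_t[of "m - 1"] s_plus_t[of "m - 2"] unfolding s'_def by linarith
  show ?thesis
  proof (rule dp.B.alpha_inj)
    show "\<sigma> permutes {1..s' 2 - s' 1}" "\<sigma>' permutes {1..s' 2 - s' 1}" using p n by auto
    show "s' 1 = 1" using tm by (simp add: s'_def)
    fix e assume "e \<in> dp.B.P1"
    then have "beta \<sigma> (tau e) = beta \<sigma>' (tau e)" using eq[of "tau e"] Pm_dual[of "tau e"] by (simp add: s'_def)
    then have "tau (dp.B.alpha \<sigma> e) = tau (dp.B.alpha \<sigma>' e)"
      using beta_dual[folded s'_def] by simp
    then show "dp.B.alpha \<sigma> e = dp.B.alpha \<sigma>' e" using inj_tau by (simp add: inj_eq)
  qed
qed

text \<open>The three components are read off from the action on \<open>P1\<close>, on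
  \<open>Pm\<close> and on the edges \<open>ein p\<close> of the cells.\<close>

lemma nu_inj: "inj_on nu NC"
proof (rule inj_onI)
  fix n n' assume nn: "n \<in> NC" "n' \<in> NC" "nu n = nu n'"
  obtain \<sigma>\<^sub>1 \<sigma>\<^sub>2 z \<sigma>\<^sub>1' \<sigma>\<^sub>2' z' where eq: "n = (\<sigma>\<^sub>1, \<sigma>\<^sub>2, z)" "n' = (\<sigma>\<^sub>1', \<sigma>\<^sub>2', z')"
    by (cases n, cases n')
  note N = nn(1)[unfolded eq] nn(2)[unfolded eq] and same = nn(3)[unfolded eq]
  have 1: "\<sigma>\<^sub>1 = \<sigma>\<^sub>1'"
  proof (cases "s 1 = 1")
    case True
    show ?thesis
    proof (rule alpha_inj[OF _ _ True])
      fix e assume "e \<in> P1"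
      then show "alpha \<sigma>\<^sub>1 e = alpha \<sigma>\<^sub>1' e" using nu_alpha[OF N(1)] nu_alpha[OF N(2)] same by simp
    qed (use N in \<open>auto simp: NC_def\<close>)
  qed (use N in \<open>auto simp: NC_def\<close>)
  have 2: "\<sigma>\<^sub>2 = \<sigma>\<^sub>2'"
  proof (cases "t (m - 1) = 1")
    case True
    show ?thesis
    proof (rule beta_inj[OF _ _ True])
      fix e assume "e \<in> Pm"
      then show "beta \<sigma>\<^sub>2 e = beta \<sigma>\<^sub>2' e" using nu_beta[OF N(1)] nu_beta[OF N(2)] same by simp
    qed (use N in \<open>auto simp: NC_def\<close>)
  qed (use N in \<open>auto simp: NC_def\<close>)
  have 3: "z = z'"
  proof (rule PiE_ext)
    show "z \<in> {1..rr + 1} \<rightarrow>\<^sub>E {0, 1}" "z' \<in> {1..rr + 1} \<rightarrow>\<^sub>E {0, 1}" using N by (auto simp: NC_def)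
    fix i assume i: "i \<in> {1..rr + 1}"
    have p: "mid i \<in> cells" using mid_bij i by (auto simp: bij_betw_def)
    have "mid i \<in> Cz z \<longleftrightarrow> mid i \<in> Cz z'"
      using nu_pair[OF N(1) p] nu_pair[OF N(2) p] ein_ne_eout[OF p] same by (auto split: if_splits)
    then have "z i = 1 \<longleftrightarrow> z' i = 1" using mid_in_Cz[OF i] by simp
    moreover have "z i = 0 \<or> z i = 1" "z' i = 0 \<or> z' i = 1" using N i by (auto simp: NC_def PiE_iff)
    ultimately show "z i = z' i" by linarith
  qed
  show "n = n'" using 1 2 3 eq by simp
qed

lemma alpha_surj:
  assumes s1: "s 1 = 1" and inj: "inj \<pi>" and P: "\<And>e. e \<in> P1 \<Longrightarrow> \<pi> e \<in> P1"
  shows "\<exists>\<sigma>. \<sigma> permutes {1..s 2 - s 1} \<and> (\<forall>e\<in>P1. alpha \<sigma> e = \<pi> e)"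
proof -
  have "\<exists>j. 1 \<le> j \<and> j \<le> s 2 - s 1 \<and> \<pi> (Ve (t 1 - i) 0) = Ve (t 1 - j) 0" if "1 \<le> i" "i \<le> s 2 - s 1" for i
  proof -
    have "Ve (t 1 - i) 0 \<in> P1" using that t1_t2 unfolding P1_eq[OF s1] by auto
    then have "\<pi> (Ve (t 1 - i) 0) \<in> P1" by (rule P)
    then obtain r where r: "\<pi> (Ve (t 1 - i) 0) = Ve r 0" "t 2 \<le> r" "r < t 1"
      unfolding P1_eq[OF s1] by auto
    have "t 1 - (t 1 - r) = r" using r by simp
    then show ?thesis using r t1_t2 by (intro exI[of _ "t 1 - r"]) auto
  qed
  then obtain h where h: "\<And>i. 1 \<le> i \<Longrightarrow> i \<le> s 2 - s 1 \<Longrightarrow>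
      1 \<le> h i \<and> h i \<le> s 2 - s 1 \<and> \<pi> (Ve (t 1 - i) 0) = Ve (t 1 - h i) 0" by metis
  define \<sigma> where "\<sigma> i = (if i \<in> {1..s 2 - s 1} then h i else i)" for i
  have "inj_on \<sigma> {1..s 2 - s 1}"
  proof (rule inj_onI)
    fix i j assume ij: "i \<in> {1..s 2 - s 1}" "j \<in> {1..s 2 - s 1}" "\<sigma> i = \<sigma> j"
    then have "h i = h j" by (simp add: \<sigma>_def)
    then have "\<pi> (Ve (t 1 - i) 0) = \<pi> (Ve (t 1 - j) 0)" using h[of i] h[of j] ij by auto
    then have "t 1 - i = t 1 - j" using inj by (simp add: inj_eq)
    then show "i = j" using ij t1_t2 by auto
  qed
  moreover have "\<sigma> ` {1..s 2 - s 1} \<subseteq> {1..s 2 - s 1}" using h by (auto simp: \<sigma>_def)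
  ultimately have "bij_betw \<sigma> {1..s 2 - s 1} {1..s 2 - s 1}"
    by (simp add: bij_betw_def endo_inj_surj)
  then have "\<sigma> permutes {1..s 2 - s 1}" by (rule bij_imp_permutes) (simp only: \<sigma>_def if_False simp_thms)
  moreover have "alpha \<sigma> e = \<pi> e" if eP: "e \<in> P1" for e
  proof -
    obtain r where r: "e = Ve r 0" "t 2 \<le> r" "r < t 1" using eP unfolding P1_eq[OF s1] by auto
    then have i: "1 \<le> t 1 - r" "t 1 - r \<le> s 2 - s 1" "t 1 - (t 1 - r) = r" using t1_t2 by auto
    then show ?thesis using h[OF i(1,2)] r by (simp add: alpha_def \<sigma>_def)
  qed
  ultimately show ?thesis by blast
qed

lemma beta_surj:
  assumes tm: "t (m - 1) = 1" and inj: "inj \<pi>" and P: "\<And>e. e \<in> Pm \<Longrightarrow> \<pi> e \<in> Pm"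
  shows "\<exists>\<sigma>. \<sigma> permutes {1..s (m - 1) - s (m - 2)} \<and> (\<forall>e\<in>Pm. beta \<sigma> e = \<pi> e)"
proof -
  define s' where "s' = (\<lambda>k. t (m - k))"
  interpret dp: dual_pair m s s' unfolding s'_def by (rule dual_pair_dual)
  have n: "s (m - 1) - s (m - 2) = s' 2 - s' 1"
    using s_plus_t[of "m - 1"] s_plus_t[of "m - 2"] unfolding s'_def by linarith
  have "\<exists>\<sigma>. \<sigma> permutes {1..s' 2 - s' 1} \<and> (\<forall>e\<in>dp.B.P1. dp.B.alpha \<sigma> e = (tau \<circ> \<pi> \<circ> tau) e)"
  proof (rule dp.B.alpha_surj)
    show "s' 1 = 1" using tm by (simp add: s'_def)
    show "inj (tau \<circ> \<pi> \<circ> tau)" using inj inj_tau by (intro inj_compose)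
    fix e assume "e \<in> dp.B.P1"
    then have "tau e \<in> Pm" using Pm_dual[of "tau e"] by (simp add: s'_def)
    then have "\<pi> (tau e) \<in> Pm" by (rule P)
    then show "(tau \<circ> \<pi> \<circ> tau) e \<in> dp.B.P1" using Pm_dual[of "\<pi> (tau e)"] by (simp add: s'_def)
  qed
  then obtain \<sigma> where \<sigma>: "\<sigma> permutes {1..s' 2 - s' 1}"
    "\<And>e. e \<in> dp.B.P1 \<Longrightarrow> dp.B.alpha \<sigma> e = (tau \<circ> \<pi> \<circ> tau) e" by blast
  have "beta \<sigma> e = \<pi> e" if "e \<in> Pm" for e
    using \<sigma>(2)[of "tau e"] Pm_dual[of e] that beta_dual[folded s'_def] by (simp add: s'_def)
  then show ?thesis using \<sigma>(1) unfolding n by blast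
qed

text \<open>The action on pendant edges gives the two permutations, and the cells whose edges are
  exchanged give \<open>z\<close>. All other edges are fixed by \<pi>: by \<open>fix_Lp\<close> off
  the least square, by \<open>fix_Up\<close> when another square lies beyond, and by
  \<open>fixes_marks\<close> at an outer corner that is a mark.\<close>

lemma nu_surj:
  assumes fs: "fixes_squares \<pi>" and fm: "fixes_marks \<pi>"
  shows "\<exists>n\<in>NC. nu n = \<pi>"
proof -
  have A: "\<pi> \<in> AutT" using fs by (simp add: fixes_squares_def)
  have inj: "inj \<pi>" by (rule AutT_inj[OF A])
  have P1: "\<pi> ` P1 = P1" by (rule fixes_P1[OF fs fm])
  have Pm: "\<pi> ` Pm = Pm" by (rule fixes_Pm[OF fs P1])
  define C where "C = {p \<in> cells. \<pi> (ein p) \<noteq> ein p}"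
  define z :: "nat \<Rightarrow> int" where "z = (\<lambda>i\<in>{1..rr + 1}. if mid i \<in> C then 1 else 0)"
  have CzC: "Cz z = C"
  proof (rule equalityI; rule subsetI)
    fix p assume "p \<in> Cz z"
    then obtain i where "i \<in> {1..rr + 1}" "z i = 1" "p = mid i" by (auto simp: Cz_def)
    then show "p \<in> C" by (auto simp: z_def split: if_splits)
  next
    fix p assume p: "p \<in> C"
    then have "p \<in> mid ` {1..rr + 1}" using mid_bij by (simp add: C_def bij_betw_def)
    then obtain i where i: "i \<in> {1..rr + 1}" "p = mid i" by auto
    then have "z i = 1" using p by (simp add: z_def)
    then show "p \<in> Cz z" using i mid_in_Cz by simp
  qed
  have Cc: "C \<subseteq> cells" by (auto simp: C_def)
  have pair: "\<pi> (ein p) = ein p \<and> \<pi> (eout p) = eout p \<or> \<pi> (ein p) = eout p \<and> \<pi> (eout p) = ein p"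
    if p: "p \<in> cells" for p
  proof -
    obtain q where q: "q \<in> D" "{ein p, eout p} = Lp q \<or> {ein p, eout p} = Up q"
      using ein_eout_pair[OF p] by (elim bexE)
    have "\<pi> ` Lp q = Lp q" "\<pi> ` Up q = Up q" using fs q(1) by (auto simp: fixes_squares_def)
    then have "\<pi> ` {ein p, eout p} = {ein p, eout p}" using q(2) by (elim disjE) (simp_all only:)
    then have "{\<pi> (ein p), \<pi> (eout p)} = {ein p, eout p}" by simp
    then show ?thesis by (simp only: doubleton_eq_iff)
  qed
  have "\<exists>\<sigma>. \<sigma> permutes {1..s 2 - s 1} \<and> (s 1 \<noteq> 1 \<longrightarrow> \<sigma> = id) \<and> (\<forall>e\<in>P1. alpha \<sigma> e = \<pi> e)"
  proof (cases "s 1 = 1")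
    case True
    then show ?thesis using alpha_surj[OF True inj] P1 by auto
  next
    case False
    have "\<pi> (outE 1) = outE 1" using P1 unfolding P1_single[OF False] by simp
    then show ?thesis unfolding P1_single[OF False] by (intro exI[of _ id]) (simp add: alpha_id permutes_id)
  qed
  then obtain \<sigma>\<^sub>1 where \<sigma>1: "\<sigma>\<^sub>1 permutes {1..s 2 - s 1}" "s 1 \<noteq> 1 \<longrightarrow> \<sigma>\<^sub>1 = id"
    "\<And>e. e \<in> P1 \<Longrightarrow> alpha \<sigma>\<^sub>1 e = \<pi> e" by blast
  have "\<exists>\<sigma>. \<sigma> permutes {1..s (m - 1) - s (m - 2)} \<and> (t (m - 1) \<noteq> 1 \<longrightarrow> \<sigma> = id) \<and> (\<forall>e\<in>Pm. beta \<sigma> e = \<pi> e)"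
  proof (cases "t (m - 1) = 1")
    case True
    then show ?thesis using beta_surj[OF True inj] Pm by auto
  next
    case False
    obtain e where e: "Pm = {e}" using Pm_single[OF False] by (elim exE)
    have "\<pi> e = e" using Pm unfolding e by simp
    then show ?thesis unfolding e by (intro exI[of _ id]) (simp add: beta_id permutes_id)
  qed
  then obtain \<sigma>\<^sub>2 where \<sigma>2: "\<sigma>\<^sub>2 permutes {1..s (m - 1) - s (m - 2)}" "t (m - 1) \<noteq> 1 \<longrightarrow> \<sigma>\<^sub>2 = id"
    "\<And>e. e \<in> Pm \<Longrightarrow> beta \<sigma>\<^sub>2 e = \<pi> e" by blast
  have n: "(\<sigma>\<^sub>1, \<sigma>\<^sub>2, z) \<in> NC" using \<sigma>1 \<sigma>2 by (auto simp: NC_def z_def)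
  have "nu (\<sigma>\<^sub>1, \<sigma>\<^sub>2, z) e = \<pi> e" for e
  proof -
    consider "e \<notin> E" | "e \<in> P1" | "e \<in> Pm" | "e \<in> E" "e \<notin> P1 \<union> Pm" by blast
    then show ?thesis
    proof cases
      case 1
      then show ?thesis using AutT_permutes[OF A] AutT_permutes[OF nu_AutT[OF n]] by (simp add: permutes_not_in)
    next
      case 2
      then show ?thesis using nu_alpha[OF n] \<sigma>1(3) by simp
    next
      case 3
      then show ?thesis using nu_beta[OF n] \<sigma>2(3) by simp
    next
      case 4
      have "flip C e \<notin> P1 \<union> Pm"
      proof
        assume "flip C e \<in> P1 \<union> Pm"
        then have "flip C (flip C e) = flip C e" by (rule flip_pendant[OF Cc])
        moreover have "flip C (flip C e) = e" by (simp add: flip_flip[OF Cc Cc] flip_empty)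
        ultimately show False using 4 \<open>flip C e \<in> P1 \<union> Pm\<close> by simp
      qed
      then have "nu (\<sigma>\<^sub>1, \<sigma>\<^sub>2, z) e = flip C e"
        using alpha_outside[of "flip C e"] beta_outside[of "flip C e"] \<sigma>1(2) \<sigma>2(2) by (simp add: nu_def CzC)
      also have "flip C e = \<pi> e"
      proof (cases "\<exists>p\<in>cells. e = ein p \<or> e = eout p")
        case True
        then obtain p where p: "p \<in> cells" "e = ein p \<or> e = eout p" by (elim bexE)
        show ?thesis
        proof (cases "p \<in> C")
          case True
          then have "\<pi> (ein p) = eout p \<and> \<pi> (eout p) = ein p" using pair[OF p(1)] by (auto simp: C_def)
          then show ?thesis using p True flip_ein[OF Cc p(1)] by auto
        next
          case False
          then have "\<pi> (ein p) = ein p \<and> \<pi> (eout p) = eout p"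
            using pair[OF p(1)] p(1) ein_ne_eout[OF p(1)] by (auto simp: C_def)
          then show ?thesis using p False flip_ein[OF Cc p(1)] by auto
        qed
      next
        case False
        then have ne: "e \<noteq> ein p" "e \<noteq> eout p" if "p \<in> cells" for p using that by auto
        have "flip C e = e" using flip_other[OF Cc] ne Cc by blast
        moreover have "\<pi> e = e"
        proof -
          obtain r c where rc: "(r, c) \<in> D" "e \<in> Lp (r, c) \<or> e \<in> Up (r, c)"
            using 4 unfolding pendant_iff by auto
          show ?thesis
          proof (cases "e \<in> Lp (r, c)")
            case True
            have "(r, c) \<noteq> (0, 0)"
              using True ne[of "(0, 0)"] by (auto simp: Lp_def ein_def eout_def cells_def)
            then show ?thesis using True fix_Lp[OF fs rc(1)] by (auto simp: Lp_def)
          next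
            case False
            then have U: "e = Ho (Suc r) c \<or> e = Ve r (Suc c)" using rc(2) by (auto simp: Up_def)
            show ?thesis
            proof (cases "(Suc r, c) \<in> D \<or> (r, Suc c) \<in> D")
              case True
              then show ?thesis using U fix_Up[OF fs rc(1) True] by auto
            next
              case False
              then have out: "(Suc (Suc r), Suc c) \<notin> H" "(Suc r, Suc (Suc c)) \<notin> H" by (auto simp: D_def)
              have H: "(Suc r, Suc c) \<in> H" using rc(1) by (simp add: D_def)
              show ?thesis
              proof (cases "(Suc r, Suc c) \<in> Q")
                case True
                then obtain k where k: "k \<in> Kset" "(Suc r, Suc c) = ck k"
                  using outer_corner[OF True out] by (elim bexE)
                then have "(Suc r, Suc c) \<in> cells" by (simp add: cells_def)
                then show ?thesis using U ne[of "(Suc r, Suc c)"] by (auto simp: ein_def eout_def)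
              next
                case False
                then obtain k where k: "k \<in> {1..m}" "(Suc r, Suc c) = mk k" using H by (auto simp: H_def)
                then have eq: "t k = Suc r" "s (k - 1) = Suc c" by (auto simp: mk_def)
                have "k \<noteq> m" using eq t_m by (intro notI) simp
                moreover have "k \<noteq> 1" using eq by (intro notI) simp
                ultimately have "2 \<le> k \<and> k < m" using k(1) by auto
                then have "\<pi> (inE k) = inE k \<and> \<pi> (outE k) = outE k" using fm unfolding fixes_marks_def by blast
                moreover have "inE k = Ho (Suc r) c" "outE k = Ve r (Suc c)" by (simp_all add: inE_def outE_def eq)
                ultimately show ?thesis using U by auto
              qed
            qed
          qed
        qed
        ultimately show ?thesis by simp
      qed
      finally show ?thesis .
    qed
  qed
  then have "nu (\<sigma>\<^sub>1, \<sigma>\<^sub>2, z) = \<pi>" by (rule ext)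
  then show ?thesis using n by (intro bexI)
qed

lemma nu_P1:
  assumes "n \<in> NC" "e \<in> P1"
  shows "nu n e \<in> P1"
proof -
  obtain \<sigma>\<^sub>1 \<sigma>\<^sub>2 z where n: "n = (\<sigma>\<^sub>1, \<sigma>\<^sub>2, z)" by (cases n)
  have p: "\<sigma>\<^sub>1 permutes {1..s 2 - s 1}" "s 1 \<noteq> 1 \<longrightarrow> \<sigma>\<^sub>1 = id" using assms(1) by (auto simp: n NC_def)
  have "alpha \<sigma>\<^sub>1 e \<in> P1"
  proof (cases "s 1 = 1")
    case True
    then obtain r where r: "e = Ve r 0" "t 2 \<le> r" "r < t 1" using assms(2) unfolding P1_eq[OF True] by auto
    have "1 \<le> \<sigma>\<^sub>1 (t 1 - r)" "\<sigma>\<^sub>1 (t 1 - r) \<le> t 1 - t 2"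
      using perm_range[OF p(1), of "t 1 - r"] r t1_t2 by auto
    then show ?thesis using r t1_t2 unfolding P1_eq[OF True] by (auto simp: alpha_def)
  next
    case False
    then show ?thesis using p assms(2) by (simp add: alpha_id)
  qed
  then show ?thesis using nu_alpha assms by (simp add: n)
qed

section \<open>Conjugation by the transposition\<close>

lemma tau_flip:
  assumes C: "C \<subseteq> cells"
  shows "tau (flip C (tau e)) = flip (prod.swap ` C) e"
proof -
  have sw: "(r, c) \<in> prod.swap ` C \<longleftrightarrow> (c, r) \<in> C" for r c
  proof
    assume "(c, r) \<in> C"
    then have "prod.swap (c, r) \<in> prod.swap ` C" by (rule imageI)
    then show "(r, c) \<in> prod.swap ` C" by simp
  qed auto
  have pos: "0 < r \<and> 0 < c" if "(r, c) \<in> C" "(r, c) \<noteq> (0, 0)" for r c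
    using that C cells_pos[of r c] by blast
  show ?thesis
  proof (cases e)
    case (Ho r c)
    then show ?thesis using pos[of "Suc c" r] by (auto simp: flip_def sw)
  next
    case (Ve r c)
    then show ?thesis using pos[of c "Suc r"] by (auto simp: flip_def sw)
  qed
qed

definition zrev :: "(nat \<Rightarrow> int) \<Rightarrow> nat \<Rightarrow> int"
  where "zrev z = (\<lambda>i\<in>{1..rr + 1}. if i \<le> rr then z (rr + 1 - i) else z i)"

lemma symmetricD: "symmetric \<Longrightarrow> k \<le> m \<Longrightarrow> s k = t (m - k)"
  by (simp add: symmetric_def)

lemma symmetricD': "symmetric \<Longrightarrow> k \<le> m \<Longrightarrow> t k = s (m - k)"
  using symmetricD[of "m - k"] by simp

lemma symmetric_Kset:
  assumes sym: symmetric and k: "k \<in> Kset"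
  shows "m - k \<in> Kset"
proof -
  have k': "1 \<le> k" "k \<le> m - 1" "s (k - 1) + 2 \<le> s k" "s k + 2 \<le> s (Suc k)" using k by (auto simp: Kset_def)
  have le: "k - 1 \<le> m" "k \<le> m" "Suc k \<le> m" "m - k \<le> m" using k' m3 by auto
  have "m - k - 1 = m - Suc k" "Suc (m - k) = m - (k - 1)" using k' le by auto
  then have "s (m - k) = t k" "s (m - k - 1) = t (Suc k)" "s (Suc (m - k)) = t (k - 1)"
    using symmetricD'[OF sym le(2)] symmetricD'[OF sym le(3)] symmetricD'[OF sym le(1)] by simp_all
  moreover have "t (Suc k) + 2 \<le> t k" "t k + 2 \<le> t (k - 1)"
    using s_plus_t[OF le(1)] s_plus_t[OF le(2)] s_plus_t[OF le(3)] k' by linarith+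
  ultimately show ?thesis using k' m3 by (auto simp: Kset_def)
qed

text \<open>Subtraction from \<open>m\<close> reverses \<open>Kset\<close>. Combined with the
  reversal of indices it gives a strictly increasing self-map of the index range, hence the
  identity.\<close>

lemma kap_symmetric:
  assumes sym: symmetric and i: "1 \<le> i" "i \<le> rr"
  shows "kap (rr + 1 - i) = m - kap i"
proof -
  have K: "kap j \<in> Kset" if "1 \<le> j" "j \<le> rr" for j using kap_bij that by (auto simp: bij_betw_def)
  have "\<exists>l. 1 \<le> l \<and> l \<le> rr \<and> kap l = m - kap (rr + 1 - j)" if "1 \<le> j" "j \<le> rr" for j
  proof -
    have "m - kap (rr + 1 - j) \<in> kap ` {1..rr}"
      using symmetric_Kset[OF sym K, of "rr + 1 - j"] kap_bij that by (auto simp: bij_betw_def)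
    then show ?thesis by auto
  qed
  then obtain h where h: "\<And>j. 1 \<le> j \<Longrightarrow> j \<le> rr \<Longrightarrow> 1 \<le> h j \<and> h j \<le> rr \<and> kap (h j) = m - kap (rr + 1 - j)"
    by metis
  have hm: "h j = j" if "1 \<le> j" "j \<le> rr" for j
  proof (rule strict_self_map[of rr h, OF _ _ that])
    show "1 \<le> h i \<and> h i \<le> rr" if "1 \<le> i" "i \<le> rr" for i using h[OF that] by simp
    fix x y assume xy: "1 \<le> x" "x < y" "y \<le> rr"
    have "kap (rr + 1 - y) < kap (rr + 1 - x)" by (rule kap_less) (use xy in auto)
    moreover have "1 \<le> rr + 1 - y" "rr + 1 - y \<le> rr" using xy by auto
    then have "kap (rr + 1 - y) \<in> Kset" by (rule K)
    then have "kap (rr + 1 - y) < m" using m3 by (auto simp: Kset_def)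
    ultimately have "kap (h x) < kap (h y)" using h[of x] h[of y] xy by auto
    then show "h x < h y" using kap_less[of "h y" "h x"] h[of x] h[of y] xy
      by (metis less_asym less_imp_le_nat less_trans linorder_neqE_nat order.strict_trans1 order_less_irrefl)
  qed
  have "kap i = m - kap (rr + 1 - i)" using h[OF i] hm[OF i] by simp
  moreover have "1 \<le> rr + 1 - i" "rr + 1 - i \<le> rr" using i by auto
  then have "kap (rr + 1 - i) \<in> Kset" by (rule K)
  then have "kap (rr + 1 - i) \<le> m" by (auto simp: Kset_def)
  ultimately show ?thesis by simp
qed

lemma mid_symmetric:
  assumes sym: symmetric and i: "i \<in> {1..rr + 1}"
  shows "prod.swap (mid i) = mid (if i \<le> rr then rr + 1 - i else i)"
proof (cases "i \<le> rr")
  case True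
  have K: "kap i \<in> Kset" using kap_bij True i by (auto simp: bij_betw_def)
  then have "kap i \<le> m" by (auto simp: Kset_def)
  then have "t (kap i) = s (m - kap i)" "s (kap i) = t (m - kap i)"
    using symmetricD[OF sym] symmetricD'[OF sym] by auto
  then show ?thesis using True i kap_symmetric[OF sym, of i] by (auto simp: mid_def ck_def)
qed (simp add: mid_def)

lemma Cz_symmetric:
  assumes sym: symmetric
  shows "prod.swap ` Cz z = Cz (zrev z)"
proof -
  define j where "j i = (if i \<le> rr then rr + 1 - i else i)" for i
  have j: "j i \<in> {1..rr + 1}" "j (j i) = i" if "i \<in> {1..rr + 1}" for i using that by (auto simp: j_def)
  have zj: "zrev z i = z (j i)" if "i \<in> {1..rr + 1}" for i using that by (simp add: zrev_def j_def)
  have sm: "prod.swap (mid i) = mid (j i)" if "i \<in> {1..rr + 1}" for i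
    using mid_symmetric[OF sym that] by (simp add: j_def)
  show ?thesis
  proof (rule equalityI; rule subsetI)
    fix p assume "p \<in> prod.swap ` Cz z"
    then obtain i where i: "i \<in> {1..rr + 1}" "z i = 1" "p = prod.swap (mid i)" by (auto simp: Cz_def)
    then have "p = mid (j i)" using sm by simp
    then show "p \<in> Cz (zrev z)" using mid_in_Cz[OF j(1)[OF i(1)]] zj[OF j(1)[OF i(1)]] j(2)[OF i(1)] i by simp
  next
    fix p assume "p \<in> Cz (zrev z)"
    then obtain i where i: "i \<in> {1..rr + 1}" "zrev z i = 1" "p = mid i" by (auto simp: Cz_def)
    then have "mid (j i) \<in> Cz z" using mid_in_Cz[OF j(1)[OF i(1)]] zj by simp
    moreover have "p = prod.swap (mid (j i))" using sm[OF j(1)[OF i(1)]] j(2)[OF i(1)] i by simp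
    ultimately show "p \<in> prod.swap ` Cz z" by simp
  qed
qed

lemma symmetric_numbers:
  assumes sym: symmetric
  shows "s (m - 1) = t 1" "s (m - 2) = t 2" "s (m - 1) - s (m - 2) = s 2 - s 1" "t (m - 1) = s 1"
  using symmetricD'[OF sym, of 1] symmetricD'[OF sym, of 2] symmetricD[OF sym, of 1] m3 t1_t2 by auto

lemma NC_swap:
  assumes sym: symmetric and n: "(\<sigma>\<^sub>1, \<sigma>\<^sub>2, z) \<in> NC"
  shows "(\<sigma>\<^sub>2, \<sigma>\<^sub>1, zrev z) \<in> NC"
  using n symmetric_numbers[OF sym] by (auto simp: NC_def zrev_def PiE_iff)

text \<open>Transposition exchanges the two pendant chains together with their numberings and
  reverses the outer corners, so conjugation by \<open>tauE\<close> is the action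
  \<open>swap_hom\<close>.\<close>

lemma nu_conj:
  assumes sym: symmetric and n: "(\<sigma>\<^sub>1, \<sigma>\<^sub>2, z) \<in> NC"
  shows "tauE \<circ> nu (\<sigma>\<^sub>1, \<sigma>\<^sub>2, z) = nu (\<sigma>\<^sub>2, \<sigma>\<^sub>1, zrev z) \<circ> tauE"
proof (rule ext)
  fix e
  have ab: "tau (alpha \<sigma> e) = beta \<sigma> (tau e)" "tau (beta \<sigma> e) = alpha \<sigma> (tau e)" for \<sigma> e
    by (cases e; auto simp: alpha_def beta_def symmetric_numbers[OF sym])+
  have tf: "tau (flip (Cz z) e) = flip (Cz (zrev z)) (tau e)" for e
    using tau_flip[OF Cz_cells, of z "tau e"] by (simp add: Cz_symmetric[OF sym])
  show "(tauE \<circ> nu (\<sigma>\<^sub>1, \<sigma>\<^sub>2, z)) e = (nu (\<sigma>\<^sub>2, \<sigma>\<^sub>1, zrev z) \<circ> tauE) e"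
  proof (cases "e \<in> E")
    case True
    have "nu (\<sigma>\<^sub>1, \<sigma>\<^sub>2, z) e \<in> E" using True AutT_E[OF nu_AutT[OF n]] by simp
    then have "(tauE \<circ> nu (\<sigma>\<^sub>1, \<sigma>\<^sub>2, z)) e = tau (alpha \<sigma>\<^sub>1 (beta \<sigma>\<^sub>2 (flip (Cz z) e)))"
      by (simp add: tauE_def nu_def)
    also have "\<dots> = beta \<sigma>\<^sub>1 (alpha \<sigma>\<^sub>2 (flip (Cz (zrev z)) (tau e)))"
      by (simp only: ab tf)
    also have "\<dots> = (nu (\<sigma>\<^sub>2, \<sigma>\<^sub>1, zrev z) \<circ> tauE) e"
      using True by (simp add: nu_def tauE_def alpha_beta)
    finally show ?thesis .
  next
    case False
    then show ?thesis
      using AutT_permutes[OF nu_AutT[OF n]] AutT_permutes[OF nu_AutT[OF NC_swap[OF sym n]]]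
      by (simp add: tauE_def permutes_not_in)
  qed
qed

text \<open>Separates the two cosets: \<open>nu n\<close> preserves \<open>P1\<close>, so
  \<open>tauE\<close> occurs in an element of the image of \<open>Psi\<close> exactly if
  \<open>outE 1\<close> leaves \<open>P1\<close>.\<close>

lemma tauE_P1: "e \<in> P1 \<Longrightarrow> tauE e \<notin> P1"
  using P1_E by (auto simp: P1_def tauE_def)

section \<open>The isomorphism with the semidirect product\<close>

lemma NC_carrier:
  assumes a: "\<And>k. 1 \<le> k \<Longrightarrow> k \<le> m \<Longrightarrow> a k = s k - s (k - 1)"
  shows "carrier (GT_normal_part m a rr) = NC"
    and "(\<sigma>\<^sub>1, \<sigma>\<^sub>2, z) \<in> NC \<Longrightarrow> (\<sigma>\<^sub>1', \<sigma>\<^sub>2', z') \<in> NC \<Longrightarrow>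
      (\<sigma>\<^sub>1, \<sigma>\<^sub>2, z) \<otimes>\<^bsub>GT_normal_part m a rr\<^esub> (\<sigma>\<^sub>1', \<sigma>\<^sub>2', z') =
      (\<sigma>\<^sub>1 \<circ> \<sigma>\<^sub>1', \<sigma>\<^sub>2 \<circ> \<sigma>\<^sub>2', \<lambda>i\<in>{1..rr + 1}. (z i + z' i) mod 2)"
proof -
  have vals: "a 1 = s 1" "a 2 = s 2 - s 1" "a (m - 1) = s (m - 1) - s (m - 2)" "a m = t (m - 1)"
  proof -
    show "a 1 = s 1" using a[of 1] m3 by simp
    show "a 2 = s 2 - s 1" using a[of 2] m3 by (simp add: One_nat_def)
    have "m - 1 - 1 = m - 2" by simp
    then show "a (m - 1) = s (m - 1) - s (m - 2)" using a[of "m - 1"] m3 by auto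
    show "a m = t (m - 1)" using a[of m] m3 s_plus_t[of "m - 1"] by auto
  qed
  have Z2: "carrier Z2 = {0, 1}" by (auto simp: carrier_integer_mod_group)
  show "carrier (GT_normal_part m a rr) = NC"
    by (auto simp: GT_normal_part_def zero_one_power_def kronecker_def singleton_group_def sym_group_def
        vals NC_def Z2 permutes_id)
  show "(\<sigma>\<^sub>1, \<sigma>\<^sub>2, z) \<in> NC \<Longrightarrow> (\<sigma>\<^sub>1', \<sigma>\<^sub>2', z') \<in> NC \<Longrightarrow>
      (\<sigma>\<^sub>1, \<sigma>\<^sub>2, z) \<otimes>\<^bsub>GT_normal_part m a rr\<^esub> (\<sigma>\<^sub>1', \<sigma>\<^sub>2', z') =
      (\<sigma>\<^sub>1 \<circ> \<sigma>\<^sub>1', \<sigma>\<^sub>2 \<circ> \<sigma>\<^sub>2', \<lambda>i\<in>{1..rr + 1}. (z i + z' i) mod 2)"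
    by (auto simp: GT_normal_part_def zero_one_power_def kronecker_def singleton_group_def sym_group_def
        vals NC_def)
qed

definition Psi :: "((nat \<Rightarrow> nat) \<times> (nat \<Rightarrow> nat) \<times> (nat \<Rightarrow> int)) \<times> int \<Rightarrow> edge \<Rightarrow> edge"
  where "Psi = (\<lambda>(n, h). nu n \<circ> (if h = 0 then id else tauE))"

lemma nu_P1_iff:
  assumes n: "n \<in> NC" shows "nu n e \<in> P1 \<longleftrightarrow> e \<in> P1"
proof
  assume e: "nu n e \<in> P1"
  have inj: "inj (nu n)" by (rule AutT_inj[OF nu_AutT[OF n]])
  have "nu n ` P1 \<subseteq> P1" using nu_P1[OF n] by auto
  then have "nu n ` P1 = P1"
    by (rule endo_inj_surj[OF finite_pendants(1)]) (rule inj_on_subset[OF inj], simp)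
  then have "nu n e \<in> nu n ` P1" using e by simp
  then show "e \<in> P1" using inj by (simp add: inj_image_mem_iff)
qed (rule nu_P1[OF n])

text \<open>\<open>Psi\<close> is multiplicative by \<open>nu_conj\<close>, injective by
  \<open>nu_inj\<close> and the invariance of \<open>P1\<close>, and surjective by
  \<open>AutT_normal_form\<close> and \<open>nu_surj\<close>.\<close>

theorem semidirect_iso:
  assumes a: "\<And>k. 1 \<le> k \<Longrightarrow> k \<le> m \<Longrightarrow> a k = s k - s (k - 1)"
  shows "semidirect (GT_normal_part m a rr) (zero_one_power Z2 (if symmetric then 1 else 0))
      (swap_hom (GT_normal_part m a rr) rr) \<cong> perm_Aut E Ts"
    (is "semidirect ?N ?H ?\<phi> \<cong> _")
proof -
  have Z2: "carrier Z2 = {0, 1}" by (auto simp: carrier_integer_mod_group)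
  have cN: "carrier ?N = NC" by (rule NC_carrier(1)[OF a])
  have cH: "carrier ?H = (if symmetric then {0, 1} else {0})"
    by (simp add: zero_one_power_def singleton_group_def Z2)
  have c: "carrier (semidirect ?N ?H ?\<phi>) = NC \<times> carrier ?H" by (simp add: semidirect_def cN)
  have cA: "carrier (perm_Aut E Ts) = AutT" by (simp add: perm_Aut_def AutT_def)
  have Psi_AutT: "Psi (n, h) \<in> AutT" if "n \<in> NC" "h \<in> carrier ?H" for n h
  proof (cases "h = 0")
    case True
    then show ?thesis using nu_AutT[OF that(1)] by (simp add: Psi_def)
  next
    case False
    then have symmetric using that(2) by (simp add: cH split: if_splits)
    then show ?thesis using AutT_comp[OF nu_AutT[OF that(1)] tauE_AutT] False by (simp add: Psi_def)
  qed
  have phi0: "?\<phi> 0 n = n" if "n \<in> NC" for n using that by (simp add: swap_hom_def cN)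
  have phi1: "?\<phi> 1 (\<sigma>\<^sub>1, \<sigma>\<^sub>2, z) = (\<sigma>\<^sub>2, \<sigma>\<^sub>1, zrev z)" if "(\<sigma>\<^sub>1, \<sigma>\<^sub>2, z) \<in> NC" for \<sigma>\<^sub>1 \<sigma>\<^sub>2 z
    using that by (simp add: swap_hom_def cN zrev_def)
  have mult: "nu (n \<otimes>\<^bsub>?N\<^esub> n') = nu n \<circ> nu n'" if "n \<in> NC" "n' \<in> NC" for n n'
  proof -
    obtain \<sigma>\<^sub>1 \<sigma>\<^sub>2 z \<sigma>\<^sub>1' \<sigma>\<^sub>2' z' where eq: "n = (\<sigma>\<^sub>1, \<sigma>\<^sub>2, z)" "n' = (\<sigma>\<^sub>1', \<sigma>\<^sub>2', z')"
      by (cases n, cases n')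
    note N = that(1)[unfolded eq] that(2)[unfolded eq]
    have "n \<otimes>\<^bsub>?N\<^esub> n' = (\<sigma>\<^sub>1 \<circ> \<sigma>\<^sub>1', \<sigma>\<^sub>2 \<circ> \<sigma>\<^sub>2', \<lambda>i\<in>{1..rr + 1}. (z i + z' i) mod 2)"
      unfolding eq by (rule NC_carrier(2)[OF a N])
    then show ?thesis using nu_mult[OF N] by (simp only: eq)
  qed
  have "Psi \<in> hom (semidirect ?N ?H ?\<phi>) (perm_Aut E Ts)"
  proof (rule homI)
    fix x assume "x \<in> carrier (semidirect ?N ?H ?\<phi>)"
    then show "Psi x \<in> carrier (perm_Aut E Ts)" using Psi_AutT by (cases x) (simp add: c cA)
  next
    fix x y assume xy: "x \<in> carrier (semidirect ?N ?H ?\<phi>)" "y \<in> carrier (semidirect ?N ?H ?\<phi>)"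
    obtain n h n' k where eq: "x = (n, h)" "y = (n', k)" by (cases x, cases y)
    have N: "n \<in> NC" "n' \<in> NC" "h \<in> carrier ?H" "k \<in> carrier ?H" using xy by (simp_all add: c eq)
    have prod: "x \<otimes>\<^bsub>semidirect ?N ?H ?\<phi>\<^esub> y = (n \<otimes>\<^bsub>?N\<^esub> ?\<phi> h n', h \<otimes>\<^bsub>?H\<^esub> k)"
      by (simp add: semidirect_def eq)
    have "Psi (n \<otimes>\<^bsub>?N\<^esub> ?\<phi> h n', h \<otimes>\<^bsub>?H\<^esub> k) = Psi (n, h) \<circ> Psi (n', k)"
    proof (cases "h = 0")
      case True
      have "h \<otimes>\<^bsub>?H\<^esub> k = k"
        using N True by (auto simp: zero_one_power_def singleton_group_def cH Z2 split: if_splits)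
      then show ?thesis using True N by (simp add: phi0 mult Psi_def o_assoc)
    next
      case False
      then have sym: symmetric and h: "h = 1" using N(3) by (auto simp: cH split: if_splits)
      obtain \<sigma>\<^sub>1 \<sigma>\<^sub>2 z where n': "n' = (\<sigma>\<^sub>1, \<sigma>\<^sub>2, z)" by (cases n')
      have N': "(\<sigma>\<^sub>1, \<sigma>\<^sub>2, z) \<in> NC" using N(2) n' by simp
      have swp: "nu (\<sigma>\<^sub>2, \<sigma>\<^sub>1, zrev z) (tauE e) = tauE (nu (\<sigma>\<^sub>1, \<sigma>\<^sub>2, z) e)" for e
        using fun_cong[OF nu_conj[OF sym N'], of e] by simp
      have m1: "nu (n \<otimes>\<^bsub>?N\<^esub> ?\<phi> h n') = nu n \<circ> nu (\<sigma>\<^sub>2, \<sigma>\<^sub>1, zrev z)"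
        unfolding n' h phi1[OF N'] by (rule mult[OF N(1) NC_swap[OF sym N']])
      have hk: "h \<otimes>\<^bsub>?H\<^esub> k = (1 + k) mod 2" using sym by (simp add: h zero_one_power_def)
      have "k = 0 \<or> k = 1" using N(4) by (auto simp: cH split: if_splits)
      then show ?thesis
      proof
        assume "k = 0"
        then show ?thesis unfolding Psi_def using m1 hk swp by (simp add: fun_eq_iff h n')
      next
        assume k: "k = 1"
        have "nu (\<sigma>\<^sub>2, \<sigma>\<^sub>1, zrev z) e = tauE (nu (\<sigma>\<^sub>1, \<sigma>\<^sub>2, z) (tauE e))" for e
          using swp[of "tauE e"] tauE_tauE[OF sym] by simp
        then show ?thesis unfolding Psi_def using m1 hk by (simp add: fun_eq_iff h n' k)
      qed
    qed
    then show "Psi (x \<otimes>\<^bsub>semidirect ?N ?H ?\<phi>\<^esub> y) = Psi x \<otimes>\<^bsub>perm_Aut E Ts\<^esub> Psi y"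
      unfolding prod by (simp add: perm_Aut_def eq)
  qed
  moreover have "bij_betw Psi (carrier (semidirect ?N ?H ?\<phi>)) (carrier (perm_Aut E Ts))"
  proof (rule bij_betw_imageI)
    have PsiP1: "Psi (n, h) (outE 1) \<in> P1 \<longleftrightarrow> h = 0" if "n \<in> NC" for n h
      using nu_P1_iff[OF that] outE_1_P1 tauE_P1[OF outE_1_P1] by (simp add: Psi_def)
    show "inj_on Psi (carrier (semidirect ?N ?H ?\<phi>))"
    proof (rule inj_onI)
      fix x y assume xy: "x \<in> carrier (semidirect ?N ?H ?\<phi>)" "y \<in> carrier (semidirect ?N ?H ?\<phi>)" "Psi x = Psi y"
      obtain n h n' k where eq: "x = (n, h)" "y = (n', k)" by (cases x, cases y)
      have N: "n \<in> NC" "n' \<in> NC" "h \<in> carrier ?H" "k \<in> carrier ?H" using xy by (simp_all add: c eq)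
      have "h = 0 \<longleftrightarrow> k = 0" using PsiP1[OF N(1), of h] PsiP1[OF N(2), of k] xy(3) by (simp add: eq)
      then have hk: "h = k" using N by (auto simp: cH split: if_splits)
      have "nu n = nu n'"
      proof (cases "h = 0")
        case True
        then show ?thesis using xy(3) hk by (simp add: Psi_def eq)
      next
        case False
        then have sym: symmetric using N(3) by (simp add: cH split: if_splits)
        have eqP: "nu n (tauE e) = nu n' (tauE e)" for e
          using fun_cong[OF xy(3), of e] False hk by (simp add: Psi_def eq)
        show ?thesis
        proof (rule ext)
          fix e show "nu n e = nu n' e" using eqP[of "tauE e"] tauE_tauE[OF sym] by simp
        qed
      qed
      then show "x = y" using inj_onD[OF nu_inj _ N(1,2)] hk by (simp add: eq)
    qed
    show "Psi ` carrier (semidirect ?N ?H ?\<phi>) = carrier (perm_Aut E Ts)"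
    proof (rule equalityI; rule subsetI)
      fix \<pi> assume "\<pi> \<in> Psi ` carrier (semidirect ?N ?H ?\<phi>)"
      then show "\<pi> \<in> carrier (perm_Aut E Ts)" using Psi_AutT by (auto simp: c cA)
    next
      fix \<pi> assume "\<pi> \<in> carrier (perm_Aut E Ts)"
      then have A: "\<pi> \<in> AutT" by (simp add: cA)
      from AutT_normal_form[OF A] have "\<exists>n\<in>NC. \<exists>h\<in>carrier ?H. Psi (n, h) = \<pi>"
      proof
        assume fm: "fixes_squares \<pi> \<and> fixes_marks \<pi>"
        have "\<exists>n\<in>NC. nu n = \<pi>" by (rule nu_surj) (use fm in simp_all)
        then obtain n where n: "n \<in> NC" "nu n = \<pi>" by (elim bexE)
        then have "Psi (n, 0) = \<pi>" by (simp add: Psi_def)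
        moreover have "0 \<in> carrier ?H" by (simp add: cH)
        ultimately show ?thesis using n(1) by (intro bexI)
      next
        assume fm: "symmetric \<and> fixes_squares (tauE \<circ> \<pi>) \<and> fixes_marks (tauE \<circ> \<pi>)"
        then have sym: symmetric by simp
        have "\<exists>n\<in>NC. nu n = tauE \<circ> \<pi>" by (rule nu_surj) (use fm in simp_all)
        then obtain n where n: "n \<in> NC" "nu n = tauE \<circ> \<pi>" by (elim bexE)
        obtain \<sigma>\<^sub>1 \<sigma>\<^sub>2 z where eq: "n = (\<sigma>\<^sub>1, \<sigma>\<^sub>2, z)" by (cases n)
        have N: "(\<sigma>\<^sub>1, \<sigma>\<^sub>2, z) \<in> NC" using n eq by simp
        \<comment> \<open>The normal form has \<open>tauE\<close> on the left, \<open>Psi\<close>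
          has it on the right; moving it across \<open>nu n\<close> swaps the components.\<close>
        have "Psi ((\<sigma>\<^sub>2, \<sigma>\<^sub>1, zrev z), 1) e = \<pi> e" for e
          using fun_cong[OF nu_conj[OF sym N], of e] fun_cong[OF n(2), of e] tauE_tauE[OF sym]
          by (simp add: Psi_def eq)
        then have "Psi ((\<sigma>\<^sub>2, \<sigma>\<^sub>1, zrev z), 1) = \<pi>" by (rule ext)
        moreover have "1 \<in> carrier ?H" unfolding cH using sym by simp
        ultimately show ?thesis using NC_swap[OF sym N] by (intro bexI)
      qed
      then obtain n h where nh: "n \<in> NC" "h \<in> carrier ?H" "Psi (n, h) = \<pi>" by (elim bexE)
      then have "(n, h) \<in> carrier (semidirect ?N ?H ?\<phi>)" by (simp add: c)
      then show "\<pi> \<in> Psi ` carrier (semidirect ?N ?H ?\<phi>)" using nh(3) by (intro image_eqI[of _ _ "(n, h)"]) simp_all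
    qed
  qed
  ultimately show ?thesis by (auto simp: is_iso_def iso_def)
qed

declare One_nat_def [simp]

end

section \<open>The Gelfand--Tsetlin polytope\<close>

lemma lookup_scaleR:
  "Poly_Mapping.lookup (r *\<^sub>R x) i = r * Poly_Mapping.lookup (x :: 'b \<Rightarrow>\<^sub>0 real) i"
proof -
  have "finite {i. r *\<^sub>R Poly_Mapping.lookup x i \<noteq> 0}"
    by (rule finite_subset[OF _ finite_keys[of x]]) (auto simp: in_keys_iff)
  then show ?thesis by (simp add: scaleR_poly_mapping_def lookup_Abs_poly_mapping)
qed

lemma mult_partition_Suc: "mult_partition (Suc m) a = mult_partition m a @ replicate (a (Suc m)) (Suc m)"
  by (simp add: mult_partition_def)

lemma length_mult_partition: "length (mult_partition m a) = (\<Sum>i\<in>{1..m}. a i)"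
  by (induction m) (simp_all add: mult_partition_Suc, simp add: mult_partition_def)

lemma mult_partition_nth:
  "1 \<le> k \<Longrightarrow> k \<le> m \<Longrightarrow> (\<Sum>i\<in>{1..k - 1}. a i) \<le> p \<Longrightarrow> p < (\<Sum>i\<in>{1..k}. a i) \<Longrightarrow>
    mult_partition m a ! p = k"
proof (induction m)
  case (Suc m)
  show ?case
  proof (cases "k = Suc m")
    case True
    then show ?thesis using Suc.prems
      by (simp add: mult_partition_Suc nth_append length_mult_partition less_diff_conv2 add.commute)
  next
    case False
    then have k: "k \<le> m" using Suc.prems by simp
    have "(\<Sum>i\<in>{1..k}. a i) \<le> (\<Sum>i\<in>{1..m}. a i)" using k by (intro sum_mono2) auto
    then show ?thesis using Suc k by (simp add: mult_partition_Suc nth_append length_mult_partition)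
  qed
qed simp

definition gap :: "nat \<Rightarrow> edge \<Rightarrow> ((nat \<times> nat) \<Rightarrow>\<^sub>0 real) \<Rightarrow> real"
  where "gap n e x = (case tgt e of (r, c) \<Rightarrow> Poly_Mapping.lookup x (n - r, Suc c))
    - (case src e of (r, c) \<Rightarrow> Poly_Mapping.lookup x (n - r, Suc c))"

lemma linear_gap: "linear (gap n e)"
  by (rule linearI) (auto simp: gap_def lookup_add lookup_scaleR algebra_simps split: prod.splits)

text \<open>The step is \<open>c / M\<close>, where \<open>c\<close> is at most every positive slack
  and \<open>M\<close> at least every \<open>v e\<close>: no positive slack is used up, and
  vanishing slacks stay zero.\<close>

lemma small_step:
  fixes u v :: "'e \<Rightarrow> real"
  assumes fin: "finite F" and u: "\<And>e. e \<in> F \<Longrightarrow> 0 \<le> u e" and v: "\<And>e. e \<in> F \<Longrightarrow> 0 \<le> v e"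
    and uv: "\<And>e. e \<in> F \<Longrightarrow> u e = 0 \<Longrightarrow> v e = 0"
  shows "\<exists>d>0. \<forall>e\<in>F. 0 \<le> u e + d * (u e - v e)"
proof -
  define M where "M = 1 + (\<Sum>e\<in>F. v e)"
  define c where "c = Min (insert 1 (u ` {e \<in> F. 0 < u e}))"
  have M: "1 \<le> M" using v by (simp add: M_def sum_nonneg)
  have vM: "v e \<le> M" if "e \<in> F" for e
    using member_le_sum[of e F v] that fin v by (simp add: M_def)
  have fin': "finite (insert 1 (u ` {e \<in> F. 0 < u e}))" using fin by simp
  have "c \<in> insert 1 (u ` {e \<in> F. 0 < u e})" unfolding c_def using fin' by (intro Min_in) auto
  then have c: "0 < c" by auto
  have cu: "c \<le> u e" if "e \<in> F" "0 < u e" for e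
    unfolding c_def using fin' that by (intro Min_le) auto
  have "0 \<le> u e + c / M * (u e - v e)" if e: "e \<in> F" for e
  proof (cases "u e = 0")
    case True
    then show ?thesis using uv[OF e] by simp
  next
    case False
    then have ue: "0 < u e" using u[OF e] by simp
    have "c / M * v e \<le> c" using vM[OF e] M c by (simp add: pos_divide_le_eq)
    then have "c / M * v e \<le> u e" using cu[OF e ue] by simp
    moreover have "0 \<le> c / M * u e" using c M ue by simp
    ultimately show ?thesis by (simp add: right_diff_distrib)
  qed
  then show ?thesis using c M by (intro exI[of _ "c / M"]) auto
qed

locale GT_shape = shape +
  fixes a :: "nat \<Rightarrow> nat"
  assumes s_a: "s = (\<lambda>k. \<Sum>i\<in>{1..k}. a i)"
begin

definition lam :: "nat list"
  where "lam = mult_partition m a"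

definition val :: "((nat \<times> nat) \<Rightarrow>\<^sub>0 real) \<Rightarrow> nat \<times> nat \<Rightarrow> real"
  where "val x = (\<lambda>(r, c). Poly_Mapping.lookup x (s m - r, Suc c))"

lemma gap_val: "gap (s m) e x = val x (tgt e) - val x (src e)"
  by (simp add: gap_def val_def)

lemma length_lam: "length lam = s m"
  by (simp add: lam_def length_mult_partition s_a)

lemma lam_nth: "1 \<le> k \<Longrightarrow> k \<le> m \<Longrightarrow> s (k - 1) < i \<Longrightarrow> i \<le> s k \<Longrightarrow> lam ! (i - 1) = k"
  unfolding lam_def s_a by (rule mult_partition_nth) auto

lemma block_exists:
  assumes "1 \<le> j" "j \<le> s m"
  obtains k where "1 \<le> k" "k \<le> m" "s (k - 1) < j" "j \<le> s k"
proof -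
  define k where "k = (LEAST k. j \<le> s k)"
  have k: "j \<le> s k" unfolding k_def by (rule LeastI[of _ m]) (rule assms)
  have km: "k \<le> m" unfolding k_def by (rule Least_le) (rule assms)
  have "k \<noteq> 0" using k assms by (intro notI) simp
  moreover from this have "s (k - 1) < j"
    using not_less_Least[of "k - 1" "\<lambda>k. j \<le> s k"] by (simp add: k_def)
  ultimately show thesis using that[of k] k km by simp
qed

lemma H_GT_indices:
  assumes "(r, c) \<in> H"
  shows "(s m - r, Suc c) \<in> GT_indices (s m)" "r < s m"
proof -
  have "r + c < s m"
  proof (cases "(r, c) \<in> Q")
    case True
    then obtain k where k: "k \<in> {1..m - 1}" "r < t k" "c < s k" by (auto simp: Q_def)
    then have "k \<le> m" by auto
    then show ?thesis using k s_plus_t[of k] by linarith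
  next
    case False
    then obtain k where k: "k \<in> {1..m}" "(r, c) = mk k" using assms by (auto simp: H_def)
    then have "s (k - 1) < s k" using s_less[of "k - 1" k] by simp
    then show ?thesis using k s_plus_t[of k] by (auto simp: mk_def)
  qed
  then show "(s m - r, Suc c) \<in> GT_indices (s m)" "r < s m" by (auto simp: GT_indices_def)
qed

lemma forced_notin_Q:
  assumes "1 \<le> k" "k \<le> m" "s (k - 1) < j" "i \<le> s k" "1 \<le> j"
  shows "(s m - i, j - 1) \<notin> Q"
proof
  assume "(s m - i, j - 1) \<in> Q"
  then obtain l where l: "l \<in> {1..m - 1}" "s m - i < t l" "j - 1 < s l" by (auto simp: Q_def)
  then have lm: "l \<le> m" by auto
  then have "s l < i" "j \<le> s l" using l s_plus_t[of l] assms by linarith+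
  then have "s l < s k" "s (k - 1) < s l" using assms by auto
  then have "l < k" "k - 1 < l" using s_less_iff lm assms by auto
  then show False by simp
qed

lemma not_forced_in_Q:
  assumes "1 \<le> k" "k \<le> m" "j \<le> s k" "s k < i" "i \<le> s m" "1 \<le> j"
  shows "(s m - i, j - 1) \<in> Q"
proof -
  have "k \<noteq> m" using assms by auto
  then have "k \<in> {1..m - 1}" using assms by auto
  moreover have "s m - i < t k" "j - 1 < s k" using assms s_plus_t[of k] by auto
  ultimately show ?thesis unfolding Q_def by blast
qed

text \<open>Entries in the triangle below a run of equal diagonal entries are forced, which leaves
  the inequalities along edges of \<open>H\<close>. Conversely, an inequality crossing the border of
  a forced triangle follows by comparison with its mark, since values are monotone on
  \<open>H\<close>.\<close>

lemma GT_polytope_iff: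
  "x \<in> GT_polytope lam \<longleftrightarrow>
    Poly_Mapping.keys x \<subseteq> GT_indices (s m) \<and>
    (\<forall>k\<in>{1..m}. \<forall>i j. s (k - 1) < j \<longrightarrow> j \<le> i \<longrightarrow> i \<le> s k \<longrightarrow> Poly_Mapping.lookup x (i, j) = real k) \<and>
    (\<forall>e\<in>E. 0 \<le> gap (s m) e x)" (is "_ \<longleftrightarrow> ?keys \<and> ?forced \<and> ?gaps")
proof
  assume x: "x \<in> GT_polytope lam"
  have keys: ?keys and diag: "\<And>i. i \<in> {1..s m} \<Longrightarrow> Poly_Mapping.lookup x (i, i) = real (lam ! (i - 1))"
    and down: "\<And>i j. (i, j) \<in> GT_indices (s m) \<Longrightarrow> (i + 1, j) \<in> GT_indices (s m) \<Longrightarrow>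
      Poly_Mapping.lookup x (i, j) \<le> Poly_Mapping.lookup x (i + 1, j)"
    and right: "\<And>i j. (i, j) \<in> GT_indices (s m) \<Longrightarrow> (i, j + 1) \<in> GT_indices (s m) \<Longrightarrow>
      Poly_Mapping.lookup x (i, j) \<le> Poly_Mapping.lookup x (i, j + 1)"
    using x by (auto simp: GT_polytope_def Let_def length_lam)
  have forced: "Poly_Mapping.lookup x (i, j) = real k"
    if k: "k \<in> {1..m}" and ij: "s (k - 1) < j" "j \<le> i" "i \<le> s k" for k i j
  proof -
    have im: "i \<le> s m" using ij k s_le_iff[of k m] by auto
    have d: "Poly_Mapping.lookup x (l, l) = real k" if "j \<le> l" "l \<le> i" for l
      using diag[of l] lam_nth[of k l] k ij im that by auto
    have "Poly_Mapping.lookup x (j, j) \<le> Poly_Mapping.lookup x (j + d, j)" if "j + d \<le> i" for d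
      using that
    proof (induction d)
      case (Suc d)
      then have "(j + d, j) \<in> GT_indices (s m)" "(j + d + 1, j) \<in> GT_indices (s m)"
        using ij im by (auto simp: GT_indices_def)
      then show ?case using down[of "j + d" j] Suc by simp
    qed simp
    from this[of "i - j"] have lo: "real k \<le> Poly_Mapping.lookup x (i, j)" using d[of j] ij by simp
    have "Poly_Mapping.lookup x (i, i - d) \<le> Poly_Mapping.lookup x (i, i)" if "d \<le> i - j" for d
      using that
    proof (induction d)
      case (Suc d)
      then have "i - Suc d + 1 = i - d" using ij by simp
      moreover from this have "(i, i - Suc d) \<in> GT_indices (s m)" "(i, i - Suc d + 1) \<in> GT_indices (s m)"
        using ij im Suc.prems by (auto simp: GT_indices_def)
      ultimately show ?case using right[of i "i - Suc d"] Suc by simp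
    qed simp
    from this[of "i - j"] have "Poly_Mapping.lookup x (i, j) \<le> real k" using d[of i] ij by simp
    then show ?thesis using lo by simp
  qed
  have "0 \<le> gap (s m) e x" if e: "e \<in> E" for e
  proof (cases e)
    case (Ho r c)
    have "(r, c) \<in> H" "(r, Suc c) \<in> H" using e by (auto simp: E_def Ho)
    then show ?thesis using right[of "s m - r" "Suc c"] H_GT_indices[of r c] H_GT_indices[of r "Suc c"]
      by (simp add: gap_def Ho)
  next
    case (Ve r c)
    have H: "(Suc r, c) \<in> H" "(r, c) \<in> H" using e by (auto simp: E_def Ve)
    then have "s m - Suc r + 1 = s m - r" using H_GT_indices(2)[of "Suc r" c] by simp
    then show ?thesis using down[of "s m - Suc r" "Suc c"] H_GT_indices[OF H(1)] H_GT_indices[OF H(2)]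
      by (simp add: gap_def Ve)
  qed
  then show "?keys \<and> ?forced \<and> ?gaps" using keys forced by blast
next
  assume x: "?keys \<and> ?forced \<and> ?gaps"
  have forced: "Poly_Mapping.lookup x (i, j) = real k"
    if "1 \<le> k" "k \<le> m" "s (k - 1) < j" "j \<le> i" "i \<le> s k" for k i j using x that by auto
  have "val x (mk k) = real k" if k: "k \<in> {1..m}" for k
  proof -
    have "s (k - 1) < s k" "s m - t k = s k" using k s_less[of "k - 1" k] s_plus_t[of k] by auto
    then show ?thesis using forced[of k "Suc (s (k - 1))" "s k"] k by (simp add: val_def mk_def)
  qed
  then have f: "val x \<in> pts" using x by (auto simp: pts_def gap_val)
  have mono: "val x p \<le> val x q" if "p \<in> H" "q \<in> H" "below p q" for p q by (rule pts_below[OF f that])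
  have look: "Poly_Mapping.lookup x (i, j) = val x (s m - i, j - 1)" if "1 \<le> j" "i \<le> s m" for i j
    using that by (simp add: val_def)
  have down: "Poly_Mapping.lookup x (i, j) \<le> Poly_Mapping.lookup x (i + 1, j)"
    if T: "(i, j) \<in> GT_indices (s m)" "(i + 1, j) \<in> GT_indices (s m)" for i j
  proof -
    have ij: "1 \<le> j" "j \<le> i" "i + 1 \<le> s m" using T by (auto simp: GT_indices_def)
    obtain k where k: "1 \<le> k" "k \<le> m" "s (k - 1) < j" "j \<le> s k" using block_exists[of j] ij by auto
    consider "i + 1 \<le> s k" | "i = s k" | "s k < i" by linarith
    then show ?thesis
    proof cases
      case 1
      then show ?thesis using forced[OF k(1-3)] ij by simp
    next
      case 2
      have q: "(s m - (i + 1), j - 1) \<in> Q" by (rule not_forced_in_Q[OF k(1,2,4)]) (use 2 ij in auto)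
      have "below (mk k) (s m - (i + 1), j - 1)"
        using 2 k ij s_plus_t[of k] by (auto simp: below_def mk_def)
      then have "val x (mk k) \<le> val x (s m - (i + 1), j - 1)" using mono q k by (simp add: H_def)
      moreover have "val x (mk k) = real k" using f k by (simp add: pts_def)
      ultimately show ?thesis using forced[OF k(1-3) ij(2)] 2 look[of j "i + 1"] ij by simp
    next
      case 3
      have "(s m - i, j - 1) \<in> Q" "(s m - (i + 1), j - 1) \<in> Q"
        by (rule not_forced_in_Q[OF k(1,2,4)]; use 3 ij in auto)+
      then have "val x (s m - i, j - 1) \<le> val x (s m - (i + 1), j - 1)"
        by (intro mono) (auto simp: H_def below_def)
      then show ?thesis using look[of j i] look[of j "i + 1"] ij by simp
    qed
  qed
  have right: "Poly_Mapping.lookup x (i, j) \<le> Poly_Mapping.lookup x (i, j + 1)"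
    if T: "(i, j) \<in> GT_indices (s m)" "(i, j + 1) \<in> GT_indices (s m)" for i j
  proof -
    have ij: "1 \<le> j" "j + 1 \<le> i" "i \<le> s m" using T by (auto simp: GT_indices_def)
    obtain k where k: "1 \<le> k" "k \<le> m" "s (k - 1) < j + 1" "j + 1 \<le> s k" using block_exists[of "j + 1"] ij by auto
    consider "i \<le> s k" "s (k - 1) < j" | "i \<le> s k" "j = s (k - 1)" | "s k < i" using k by linarith
    then show ?thesis
    proof cases
      case 1
      then show ?thesis using forced[of k j i] forced[of k "j + 1" i] k ij by simp
    next
      case 2
      have "k - 1 \<noteq> 0" using 2 ij by (intro notI) simp
      then have k1: "1 \<le> k - 1" "k - 1 \<le> m" using k by auto
      have "(s m - i, j - 1) \<in> Q"
        by (rule not_forced_in_Q[OF k1]) (use 2 ij in auto)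
      moreover have "below (s m - i, j - 1) (mk k)"
        using 2 k s_plus_t[of k] by (auto simp: below_def mk_def)
      ultimately have "val x (s m - i, j - 1) \<le> val x (mk k)" using mono k by (simp add: H_def)
      moreover have "val x (mk k) = real k" using f k by (simp add: pts_def)
      ultimately show ?thesis using forced[OF k(1-3) ij(2)] 2 look[of j i] ij by simp
    next
      case 3
      have "(s m - i, (j + 1) - 1) \<in> Q" "(s m - i, j - 1) \<in> Q"
        by (rule not_forced_in_Q[OF k(1,2)]; use 3 ij k in auto)+
      then have "val x (s m - i, j - 1) \<le> val x (s m - i, (j + 1) - 1)"
        by (intro mono) (auto simp: H_def below_def)
      then show ?thesis using look[of j i] look[of "j + 1" i] ij by simp
    qed
  qed
  have diag: "Poly_Mapping.lookup x (i, i) = real (lam ! (i - 1))" if i: "i \<in> {1..s m}" for i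
  proof -
    obtain k where k: "1 \<le> k" "k \<le> m" "s (k - 1) < i" "i \<le> s k" using block_exists[of i] i by auto
    then show ?thesis using forced[of k i i] lam_nth[of k i] by simp
  qed
  show "x \<in> GT_polytope lam"
    using x down right diag by (auto simp: GT_polytope_def Let_def length_lam)
qed

lemma inequality_system: "inequality_system (GT_polytope lam) E (gap (s m))"
proof (rule inequality_system.intro)
  show "finite E" by (rule finite_E)
  show "linear (gap (s m) e)" for e by (rule linear_gap)
  show "0 \<le> gap (s m) e x" if "x \<in> GT_polytope lam" "e \<in> E" for x e
    using that unfolding GT_polytope_iff by blast
  have lin: "gap (s m) e (u *\<^sub>R x + v *\<^sub>R y) = u * gap (s m) e x + v * gap (s m) e y" for e u v x y
    using linear_gap[of "s m" e] by (simp add: linear_add linear_scale)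
  show "convex (GT_polytope lam)"
  proof (rule convexI)
    fix x y and u v :: real
    assume xy: "x \<in> GT_polytope lam" "y \<in> GT_polytope lam" and uv: "0 \<le> u" "0 \<le> v" "u + v = 1"
    have "Poly_Mapping.keys (u *\<^sub>R x + v *\<^sub>R y) \<subseteq> Poly_Mapping.keys x \<union> Poly_Mapping.keys y"
      by (auto simp: in_keys_iff lookup_add lookup_scaleR)
    moreover have "u * real k + v * real k = real k" for k using uv(3) by (simp flip: distrib_right)
    ultimately show "u *\<^sub>R x + v *\<^sub>R y \<in> GT_polytope lam"
      using xy uv unfolding GT_polytope_iff
      by (auto simp: lookup_add lookup_scaleR lin)
  qed
  show "\<exists>d>0. x + d *\<^sub>R (x - y) \<in> GT_polytope lam"
    if xy: "x \<in> GT_polytope lam" "y \<in> GT_polytope lam" "tight (gap (s m)) E x \<subseteq> tight (gap (s m)) E y" for x y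
  proof -
    have "\<exists>d>0. \<forall>e\<in>E. 0 \<le> gap (s m) e x + d * (gap (s m) e x - gap (s m) e y)"
      by (rule small_step[OF finite_E])
        (use xy GT_polytope_iff[of x] GT_polytope_iff[of y] in \<open>auto simp: tight_def\<close>)
    then obtain d where d: "0 < d" "\<And>e. e \<in> E \<Longrightarrow> 0 \<le> gap (s m) e x + d * (gap (s m) e x - gap (s m) e y)"
      by blast
    \<comment> \<open>The coefficients sum to 1, so the forced values survive the step.\<close>
    have eq: "x + d *\<^sub>R (x - y) = (1 + d) *\<^sub>R x + (- d) *\<^sub>R y" by (simp add: algebra_simps)
    have "Poly_Mapping.keys ((1 + d) *\<^sub>R x + (- d) *\<^sub>R y) \<subseteq> Poly_Mapping.keys x \<union> Poly_Mapping.keys y"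
      unfolding subset_iff Un_iff in_keys_iff lookup_add lookup_scaleR by auto
    moreover have "(1 + d) * real k + (- d) * real k = real k" for k by (simp add: algebra_simps)
    moreover have "0 \<le> (1 + d) * gap (s m) e x + (- d) * gap (s m) e y" if "e \<in> E" for e
      using d(2)[OF that] by (simp add: algebra_simps)
    ultimately have "x + d *\<^sub>R (x - y) \<in> GT_polytope lam"
      using xy(1,2) unfolding eq GT_polytope_iff lookup_add lookup_scaleR lin by auto
    then show ?thesis using d(1) by blast
  qed
qed

lemma tight_GT: "tight (gap (s m)) E ` GT_polytope lam = Ts"
proof (rule equalityI; rule subsetI)
  fix S assume "S \<in> tight (gap (s m)) E ` GT_polytope lam"
  then obtain x where x: "x \<in> GT_polytope lam" "S = tight (gap (s m)) E x" by auto
  have forced: "Poly_Mapping.lookup x (i, j) = real k"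
    if "1 \<le> k" "k \<le> m" "s (k - 1) < j" "j \<le> i" "i \<le> s k" for k i j
    using x(1) that unfolding GT_polytope_iff by auto
  have "val x (mk k) = real k" if k: "k \<in> {1..m}" for k
  proof -
    have "s (k - 1) < s k" "s m - t k = s k" using k s_less[of "k - 1" k] s_plus_t[of k] by auto
    then show ?thesis using forced[of k "Suc (s (k - 1))" "s k"] k by (simp add: val_def mk_def)
  qed
  then have "val x \<in> pts" using x(1) unfolding GT_polytope_iff by (auto simp: pts_def gap_val)
  moreover have "S = tt (val x)" by (auto simp: x(2) tight_def tt_def gap_val)
  ultimately show "S \<in> Ts" by (simp add: Ts_def)
next
  fix S assume "S \<in> Ts"
  then obtain f where f: "f \<in> pts" "S = tt f" by (auto simp: Ts_def)
  \<comment> \<open>Outside \<open>Q\<close> the entry lies in a forced triangle, where it equals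
    the diagonal entry of its row.\<close>
  define h where "h = (\<lambda>(i, j). if (i, j) \<in> GT_indices (s m) then
      (if (s m - i, j - 1) \<in> Q then f (s m - i, j - 1) else real (lam ! (i - 1))) else 0)"
  define x where "x = Abs_poly_mapping h"
  have "finite (GT_indices (s m))"
    by (rule finite_subset[of _ "{1..s m} \<times> {1..s m}"]) (auto simp: GT_indices_def)
  then have "finite {p. h p \<noteq> 0}" by (rule finite_subset[rotated]) (auto simp: h_def split: if_splits)
  then have look: "Poly_Mapping.lookup x p = h p" for p by (simp add: x_def lookup_Abs_poly_mapping)
  have forced: "Poly_Mapping.lookup x (i, j) = real k"
    if k: "k \<in> {1..m}" and ij: "s (k - 1) < j" "j \<le> i" "i \<le> s k" for k i j
  proof -
    have "i \<le> s m" using ij k s_le_iff[of k m] by auto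
    then have "(i, j) \<in> GT_indices (s m)" using ij by (auto simp: GT_indices_def)
    moreover have "(s m - i, j - 1) \<notin> Q" using forced_notin_Q[of k j i] k ij by auto
    moreover have "lam ! (i - 1) = k" using lam_nth[of k i] k ij by auto
    ultimately show ?thesis by (simp add: look h_def)
  qed
  have valf: "val x p = f p" if p: "p \<in> H" for p
  proof (cases "p \<in> Q")
    case True
    obtain r c where rc: "p = (r, c)" by (cases p)
    have "s m - (s m - r) = r" using H_GT_indices(2)[of r c] p rc by simp
    then show ?thesis using H_GT_indices(1)[of r c] p rc True by (simp add: val_def look h_def)
  next
    case False
    then obtain k where k: "k \<in> {1..m}" "p = mk k" using p by (auto simp: H_def)
    have "s (k - 1) < s k" "s m - t k = s k" using k s_less[of "k - 1" k] s_plus_t[of k] by auto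
    then have "val x (mk k) = real k" using forced[of k "Suc (s (k - 1))" "s k"] k by (simp add: val_def mk_def)
    then show ?thesis using f(1) k by (simp add: pts_def)
  qed
  have gapf: "gap (s m) e x = f (tgt e) - f (src e)" if "e \<in> E" for e
    using that valf by (simp add: gap_val E_def)
  have "x \<in> GT_polytope lam"
    unfolding GT_polytope_iff
  proof (intro conjI ballI allI impI)
    show "Poly_Mapping.keys x \<subseteq> GT_indices (s m)"
      by (auto simp: in_keys_iff look h_def split: if_splits)
    show "0 \<le> gap (s m) e x" if "e \<in> E" for e using gapf[OF that] f(1) that by (simp add: pts_def)
  qed (rule forced)
  moreover have "S = tight (gap (s m)) E x" using gapf by (auto simp: f(2) tight_def tt_def)
  ultimately show "S \<in> tight (gap (s m)) E ` GT_polytope lam" by blast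
qed

text \<open>\<open>E\<close> is not a tight set because it contains the path
  \<open>Xp 1\<close>.\<close>

theorem face_Aut_GT: "face_Aut (GT_polytope lam) \<cong> perm_Aut E Ts"
proof -
  interpret inequality_system "GT_polytope lam" E "gap (s m)" by (rule inequality_system)
  have "E \<notin> Ts" using Xp_inconsistent[of 1 E] Xp_E[of 1] m3 by auto
  show ?thesis
  proof (rule face_Aut_iso_perm_Aut[unfolded tight_GT])
    show "{} \<in> Ts" by (rule Ts_empty)
    show "{e} \<in> Ts" if "e \<in> E" for e using that by (rule Ts_single)
    show "E \<notin> Ts" by fact
  qed
qed

section \<open>Translation into multiplicities\<close>

lemma a_s: "1 \<le> k \<Longrightarrow> a k = s k - s (k - 1)"
  by (cases k) (simp_all add: s_a)

lemma rr_a: "rr = card {k \<in> {1..m - 1}. a k \<ge> 2 \<and> a (k + 1) \<ge> 2}"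
proof -
  have "s (k - 1) + 2 \<le> s k \<longleftrightarrow> 2 \<le> a k" "s k + 2 \<le> s (Suc k) \<longleftrightarrow> 2 \<le> a (k + 1)" if "k \<in> {1..m - 1}" for k
    using that a_s[of k] a_s[of "Suc k"] by auto
  then have "Kset = {k \<in> {1..m - 1}. a k \<ge> 2 \<and> a (k + 1) \<ge> 2}" unfolding Kset_def by blast
  then show ?thesis by (simp add: rr_def)
qed

text \<open>\<open>t (m - k)\<close> is the sum of the last \<open>k\<close> multiplicities, so both
  sides compare the partial sums from the two ends.\<close>

lemma symmetric_a: "symmetric \<longleftrightarrow> (\<forall>i\<in>{1..m}. a i = a (m + 1 - i))"
proof
  assume sym: symmetric
  show "\<forall>i\<in>{1..m}. a i = a (m + 1 - i)"
  proof
    fix i assume i: "i \<in> {1..m}"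
    have "m + 1 - i - 1 = m - i" "m - (i - 1) = m + 1 - i" using i by auto
    then have "s i = t (m - i)" "s (i - 1) = t (m + 1 - i)" "a (m + 1 - i) = s (m + 1 - i) - s (m - i)"
      using symmetricD[OF sym, of i] symmetricD[OF sym, of "i - 1"] a_s[of "m + 1 - i"] i by auto
    then show "a i = a (m + 1 - i)"
    proof -
      have "m + 1 - i \<le> m" using i by auto
      then show ?thesis
        using a_s[of i] i s_plus_t[of "m - i"] s_plus_t[of "m + 1 - i"] \<open>s i = _\<close> \<open>s (i - 1) = _\<close>
          \<open>a (m + 1 - i) = _\<close> by simp linarith
    qed
  qed
next
  assume h: "\<forall>i\<in>{1..m}. a i = a (m + 1 - i)"
  have "k \<le> m \<longrightarrow> s k = t (m - k)" for k
  proof (induction k)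
    case (Suc k)
    show ?case
    proof
      assume k: "Suc k \<le> m"
      have "a (Suc k) = a (m - k)" using bspec[OF h, of "Suc k"] k by simp
      moreover have "s (Suc k) = s k + a (Suc k)" by (simp add: s_a)
      moreover have "m - k = Suc (m - Suc k)" using k by simp
      then have "s (m - k) = s (m - Suc k) + a (m - k)" by (simp add: s_a)
      ultimately show "s (Suc k) = t (m - Suc k)"
        using Suc k s_plus_t[of "m - k"] s_plus_t[of "m - Suc k"] by auto
    qed
  qed simp
  then show symmetric by (simp add: symmetric_def)
qed

theorem face_Aut_iso:
  "face_Aut (GT_polytope (mult_partition m a)) \<cong>
    semidirect (GT_normal_part m a rr) (zero_one_power Z2 (if symmetric then 1 else 0))
      (swap_hom (GT_normal_part m a rr) rr)"
proof -
  have si: "semidirect (GT_normal_part m a rr) (zero_one_power Z2 (if symmetric then 1 else 0))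
      (swap_hom (GT_normal_part m a rr) rr) \<cong> perm_Aut E Ts" (is "?G \<cong> _")
    by (rule semidirect_iso) (rule a_s)
  \<comment> \<open>Inverting the isomorphism \<open>si\<close> by \<open>group.iso_sym\<close>
    requires its source to be a group.\<close>
  have "group ?G"
  proof (rule group_semidirect)
    show "group (GT_normal_part m a rr)" by (rule group_GT_normal_part)
    show "group (zero_one_power Z2 (if symmetric then 1 else 0))"
      by (simp add: zero_one_power_def)
    show "swap_hom (GT_normal_part m a rr) rr \<in>
        hom (zero_one_power Z2 (if symmetric then 1 else 0)) (AutoGroup (GT_normal_part m a rr))"
    proof (cases symmetric)
      case True
      have "a 1 = a m" "a 2 = a (m - 1)"
        using bspec[OF symmetric_a[THEN iffD1, OF True], of 1]
          bspec[OF symmetric_a[THEN iffD1, OF True], of 2] m3 by auto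
      then show ?thesis using swap_hom_in_hom True by simp
    next
      case False
      then show ?thesis using swap_hom_trivial[OF group_GT_normal_part] by simp
    qed
  qed
  then have "perm_Aut E Ts \<cong> ?G" using si by (rule group.iso_sym)
  then show ?thesis by (rule iso_trans[OF face_Aut_GT[unfolded lam_def]])
qed

end

theorem theorem1p3:
  fixes m :: nat and a :: "nat \<Rightarrow> nat" and r\<^sub>1 r\<^sub>2 :: nat
  assumes "m \<ge> 3"
    and "\<forall>i\<in>{1..m}. a i \<ge> 1"
    and "r\<^sub>1 = card {k \<in> {1..m - 1}. a k \<ge> 2 \<and> a (k + 1) \<ge> 2}"
    and "r\<^sub>2 = (if \<forall>i\<in>{1..m}. a i = a (m + 1 - i) then 1 else 0)"
  shows "face_Aut (GT_polytope (mult_partition m a)) \<cong>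
         semidirect (GT_normal_part m a r\<^sub>1) (zero_one_power Z2 r\<^sub>2)
           (swap_hom (GT_normal_part m a r\<^sub>1) r\<^sub>1)"
proof -
  define s where "s = (\<lambda>k. \<Sum>i\<in>{1..k}. a i)"
  have "s k < s (Suc k)" if "k < m" for k
  proof -
    have "1 \<le> a (Suc k)" using assms(2) that by auto
    then show ?thesis by (simp add: s_def)
  qed
  then interpret GT_shape m s a
    using assms(1) by unfold_locales (simp_all add: s_def)
  show ?thesis
    using face_Aut_iso unfolding rr_a symmetric_a assms(3,4) .
qed

end
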